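(* Let $\mathcal{T}$ be a Turing machine and let $\mathbf{B}(\mathcal{T})$ be the finite algebra associated with $\mathcal{T}$ (both as defined in the context). If $\mathcal{T}$ does not halt, then $\mathbf{4} \notin \mathrm{typ}\{V(\mathbf{B}(\mathcal{T}))\}$.
   Context: **Types.** $V(\mathbf{A})$ is the variety generated by $\mathbf{A}$. Types are those of tame congruence theory (Hobby–McKenzie): each prime quotient (covering pair) in the congruence lattice of a finite algebra has a type in $\{\mathbf{1},\mathbf{2},\mathbf{3},\mathbf{4},\mathbf{5}\}$; type $\mathbf{4}$ is the lattice type. For a locally finite variety $\mathcal{V}$, $\mathrm{typ}\{\mathcal{V}\}$ is the set of all types of prime quotients of congruence lattices of finite algebras in $\mathcal{V}$. **Turing machines.** A Turing machine $\mathcal{T}$ has internal states $\mu_1,\dots,\mu_k$ ($k\ge 1$), a halting state $\mu_0$, tape symbols $0,1$ and a two-way infinite tape (a function $\mathbb{Z}\to\{0,1\}$). For every $1\le i\le k$ and $r\in\{0,1\}$ it has exactly one instruction $\mu_i r s T\mu_m$, with $s\in\{0,1\}$, $T\in\{L,R\}$, $0\le m\le k$; it means: in state $\mu_i$ reading $r$, replace $r$ by $s$, move one square left (if $T=L$) or right (if $T=R$), and go to state $\mu_m$. There is no instruction beginning with $\mu_0$. $\mathcal{T}$ halts if, started in state $\mu_1$ with the head on square $0$ of the all-zero tape, it reaches state $\mu_0$ after finitely many steps. **Universe of $\mathbf{B}(\mathcal{T})$.** It is the disjoint union $B(\mathcal{T})=\{0\}\cup P\cup U\cup V\cup\overline{V}$,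 where $P=\{P_0,P_1,P_2\}$, $U=\{1,2,H\}$, and $V$ consists of pairwise distinct symbols $C_{ir}^s$, $D_{ir}^s$, $M_i^r$ for $0\le i\le k$ and $r,s\in\{0,1\}$. The set $\overline{V}=\{\overline{v}:v\in V\}$ is a disjoint copy of $V$, and bar is extended to an involution of $V\cup\overline{V}$ by $\overline{\overline{v}}=v$. (Here $0$ is a bottom element and $1,2,H$ are formal symbols.) Put $V_{ir}^s=\{C_{ir}^s,D_{ir}^s,M_i^r\}$ and $V_i=\bigcup_{r,s}V_{ir}^s$. In particular $V_{10}^0=\{C_{10}^0,D_{10}^0,M_1^0\}$ and $V_0$ is the set of elements of $V$ with state index $0$. The algebra has $20k+27$ elements. **Basic operations of $\mathbf{B}(\mathcal{T})$.** They are the following. (1) The constant $0$. (2) $x\wedge y$: the greatest lower bound for the partial order in which $x\le y$ iff $x=0$, or $x=y$, or ($x=P_2$ and $y\in\{P_0,P_1\}$). (3) For $i\in\{0,1,2\}$, with $s_0=C_{10}^0$, $s_1=M_1^0$, $s_2=D_{10}^0$: $x\wedge^i y=x$ if $x=y\in (P\cup V_{10}^0)-\{s_i\}$, and $0$ otherwise. (4) $T_0(x)=P_2$ if $x\in\{P_0,P_2\}$; $T_0(x)=P_0$ if $x=P_1$; $T_0(x)=x$ if $x\in V_0$; $T_0(x)=0$ otherwise. (5) $T_1(x,y)=P_1$ if $x=y=P_0$ or $\{x,y\}=\{P_0,P_1\}$ or $\{x,y\}=\{P_0,P_2\}$; $T_1(x,y)=P_2$ if $\{x,y\}\subseteq\{P_1,P_2\}$;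 $T_1(x,y)=x$ if $x=y\in V_{10}^0$; $T_1(x,y)=0$ otherwise. (6) $J'(x,y,z)=x\wedge z$ if $x=y$ or $\{x,y\}\subseteq P$; $J'(x,y,z)=x$ if $x=\overline{y}\in V\cup\overline{V}$; $J'(x,y,z)=0$ otherwise. (7) Let $t(x,y,z)=z$ if $x=y$ and $t(x,y,z)=x$ otherwise. Then $S_1(u,x,y,z)=x$ if $u\in\{1,2\}$ and $x=y=z\in U\cup V\cup\overline{V}$; $S_1(u,x,y,z)=t(x,y,z)$ if $\{x,y,z\}\subseteq P$; $S_1(u,x,y,z)=0$ otherwise. (8) $S_2(u,v,x,y,z)=x$ if $u=\overline{v}\in V\cup\overline{V}$ and $x=y=z\in U\cup V\cup\overline{V}$; $S_2(u,v,x,y,z)=t(x,y,z)$ if $\{x,y,z\}\subseteq P$; $S_2(u,v,x,y,z)=0$ otherwise. (9) For each instruction $\mu_i r s L\mu_m$ of $\mathcal{T}$ and each $t\in\{0,1\}$, the ternary operation $L_{irt}(x,y,u)$ given by: - $u$ if $x=y=1$ and $u\in P$; - $C_{mt}^{s'}$ if $x=y=1$ and $u=C_{ir}^{s'}$ for some $s'$; - $M_m^t$ if $x=H$, $y=1$, $u=C_{ir}^t$; - $D_{mt}^s$ if $x=2$, $y=H$, $u=M_i^r$; - $D_{mt}^{s'}$ if $x=y=2$ and $u=D_{ir}^{s'}$ for some $s'$; - $\overline{v}$ if $u\in\overline{V}$ and $L_{irt}(x,y,\overline{u})=v\in V$ by the preceding clauses; - $0$ otherwise. (10) For each instruction $\mu_i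 r s R\mu_m$ of $\mathcal{T}$ and each $t\in\{0,1\}$, the ternary operation $R_{irt}(x,y,u)$ given by: - $u$ if $x=y=1$ and $u\in P$; - $C_{mt}^{s'}$ if $x=y=1$ and $u=C_{ir}^{s'}$ for some $s'$; - $C_{mt}^s$ if $x=H$, $y=1$, $u=M_i^r$; - $M_m^t$ if $x=2$, $y=H$, $u=D_{ir}^t$; - $D_{mt}^{s'}$ if $x=y=2$ and $u=D_{ir}^{s'}$ for some $s'$; - $\overline{v}$ if $u\in\overline{V}$ and $R_{irt}(x,y,\overline{u})=v\in V$ by the preceding clauses; - $0$ otherwise. (11) For each operation $F$ in (9) or (10), its reverse $F^o$: $F^o(x,y,u)=v$ when $F(x,y,v)=u\ne 0$ (such $v$ is unique), and $F^o(x,y,u)=0$ if there is no such $v$. Let $\mathcal{M}$ be the set of all operations in (9), (10), (11). (12) Let $\prec$ be the relation on $U$ holding exactly for $2\prec 2$, $2\prec H$, $H\prec 1$, $1\prec 1$. For each $F\in\mathcal{M}$ there are two $4$-ary operations: - $U_F^1(x,y,z,u)=\overline{F(x,y,u)}$ if $x\prec y$, $x\prec z$, $y\ne z$ and $F(x,y,u)\in V\cup\overline{V}$; it equals $F(x,y,u)$ if $x\prec y$ and $y=z$; it equals $0$ otherwise. - $U_F^2(x,y,z,u)=\overline{F(y,z,u)}$ if $x\prec z$, $y\prec z$, $x\ne y$ and $F(y,z,u)\in V\cup\overline{V}$; it equals $F(y,z,u)$ if $x=y$ and $y\prec z$; it equals $0$ otherwise. *)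

theory Defs
  imports "HOL-Algebra.Bij" "HOL-Algebra.Module"
begin

section \<open>Algebras and the variety generated by an algebra\<close>

record ('f, 'a) ualg =
  univ :: "'a set"
  syms :: "'f set"
  arity :: "'f \<Rightarrow> nat"
  oper :: "'f \<Rightarrow> 'a list \<Rightarrow> 'a"

definition tuples :: "nat \<Rightarrow> 'a set \<Rightarrow> 'a list set" where
  "tuples n U = {xs. length xs = n \<and> set xs \<subseteq> U}"

definition is_algebra :: "('f, 'a) ualg \<Rightarrow> bool" where
  "is_algebra A \<longleftrightarrow> univ A \<noteq> {} \<and>
     (\<forall>f\<in>syms A. \<forall>xs\<in>tuples (arity A f) (univ A). oper A f xs \<in> univ A)"

definition power_alg :: "('f, 'a) ualg \<Rightarrow> 'i set \<Rightarrow> ('f, 'i \<Rightarrow> 'a) ualg" where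
  "power_alg A I = \<lparr>univ = I \<rightarrow>\<^sub>E univ A, syms = syms A, arity = arity A,
     oper = (\<lambda>f xs. \<lambda>i\<in>I. oper A f (map (\<lambda>x. x i) xs))\<rparr>"

definition subuniverse :: "('f, 'a) ualg \<Rightarrow> 'a set \<Rightarrow> bool" where
  "subuniverse A S \<longleftrightarrow> S \<noteq> {} \<and> S \<subseteq> univ A \<and>
     (\<forall>f\<in>syms A. \<forall>xs\<in>tuples (arity A f) S. oper A f xs \<in> S)"

definition subalgebra :: "('f, 'a) ualg \<Rightarrow> 'a set \<Rightarrow> ('f, 'a) ualg" where
  "subalgebra A S = A\<lparr>univ := S\<rparr>"

definition same_signature :: "('f, 'a) ualg \<Rightarrow> ('f, 'b) ualg \<Rightarrow> bool" where
  "same_signature A B \<longleftrightarrow> syms A = syms B \<and> (\<forall>f\<in>syms A. arity A f = arity B f)"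

definition homomorphism :: "('f, 'a) ualg \<Rightarrow> ('f, 'b) ualg \<Rightarrow> ('a \<Rightarrow> 'b) \<Rightarrow> bool" where
  "homomorphism A B h \<longleftrightarrow> h ` univ A \<subseteq> univ B \<and>
     (\<forall>f\<in>syms A. \<forall>xs\<in>tuples (arity A f) (univ A). h (oper A f xs) = oper B f (map h xs))"

text \<open>
  The variety generated by \<open>A\<close> is \<open>HSP(A)\<close>: all homomorphic images of subalgebras of powers
  of \<open>A\<close>.  HOL cannot quantify over types inside a definition, so the type \<open>'i\<close> of the
  exponents and the type \<open>'b\<close> of the elements of the members are parameters; a theorem in
  which both are type variables speaks about all exponents and all members.
\<close>

definition variety :: "'i itself \<Rightarrow> ('f, 'a) ualg \<Rightarrow> ('f, 'b) ualg set" where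
  "variety _ A = {B. same_signature A B \<and>
     (\<exists>(I :: 'i set) S h. subuniverse (power_alg A I) S \<and>
        homomorphism (subalgebra (power_alg A I) S) B h \<and> h ` S = univ B)}"

section \<open>Congruences, polynomials and induced algebras\<close>

definition congruence :: "('f, 'a) ualg \<Rightarrow> 'a rel \<Rightarrow> bool" where
  "congruence A \<theta> \<longleftrightarrow> equiv (univ A) \<theta> \<and>
     (\<forall>f\<in>syms A. \<forall>xs\<in>tuples (arity A f) (univ A). \<forall>ys\<in>tuples (arity A f) (univ A).
        list_all2 (\<lambda>x y. (x, y) \<in> \<theta>) xs ys \<longrightarrow> (oper A f xs, oper A f ys) \<in> \<theta>)"

definition prime_quotient :: "('f, 'a) ualg \<Rightarrow> 'a rel \<Rightarrow> 'a rel \<Rightarrow> bool" where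
  "prime_quotient A \<alpha> \<beta> \<longleftrightarrow> congruence A \<alpha> \<and> congruence A \<beta> \<and> \<alpha> \<subset> \<beta> \<and>
     \<not> (\<exists>\<gamma>. congruence A \<gamma> \<and> \<alpha> \<subset> \<gamma> \<and> \<gamma> \<subset> \<beta>)"

definition quotient_alg :: "('f, 'a) ualg \<Rightarrow> 'a rel \<Rightarrow> ('f, 'a set) ualg" where
  "quotient_alg A \<theta> = \<lparr>univ = univ A // \<theta>, syms = syms A, arity = arity A,
     oper = (\<lambda>f Xs. \<theta> `` {oper A f (map (\<lambda>X. SOME x. x \<in> X) Xs)})\<rparr>"

text \<open>
  The \<open>n\<close>-ary polynomial operations, as functions that are \<^const>\<open>undefined\<close> off
  \<^term>\<open>tuples n (univ A)\<close>, so that equality of functions is equality of operations.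
\<close>

inductive_set poly_ops :: "('f, 'a) ualg \<Rightarrow> nat \<Rightarrow> ('a list \<Rightarrow> 'a) set"
  for A :: "('f, 'a) ualg" and n :: nat where
  const: "c \<in> univ A \<Longrightarrow> (\<lambda>xs\<in>tuples n (univ A). c) \<in> poly_ops A n"
| proj: "i < n \<Longrightarrow> (\<lambda>xs\<in>tuples n (univ A). xs ! i) \<in> poly_ops A n"
| comp: "f \<in> syms A \<Longrightarrow> length gs = arity A f \<Longrightarrow> \<forall>g\<in>set gs. g \<in> poly_ops A n \<Longrightarrow>
    (\<lambda>xs\<in>tuples n (univ A). oper A f (map (\<lambda>g. g xs) gs)) \<in> poly_ops A n"

definition poly_equivalent :: "('f, 'a) ualg \<Rightarrow> ('g, 'a) ualg \<Rightarrow> bool" where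
  "poly_equivalent A B \<longleftrightarrow> univ A = univ B \<and> (\<forall>n. poly_ops A n = poly_ops B n)"

text \<open>
  The algebra induced by \<open>A\<close> on \<open>N\<close>: its basic operations are the restrictions to \<open>N\<close> of all
  polynomial operations of \<open>A\<close> that preserve \<open>N\<close>.  Each serves as its own symbol, tagged
  with its arity.
\<close>

definition induced_alg ::
  "('f, 'a) ualg \<Rightarrow> 'a set \<Rightarrow> (nat \<times> ('a list \<Rightarrow> 'a), 'a) ualg" where
  "induced_alg A N = \<lparr>univ = N,
     syms = {(n, p). p \<in> poly_ops A n \<and> (\<forall>xs\<in>tuples n N. p xs \<in> N)},
     arity = fst, oper = snd\<rparr>"

section \<open>Types of prime quotients\<close>

definition minimal_algebra :: "('f, 'a) ualg \<Rightarrow> bool" where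
  "minimal_algebra M \<longleftrightarrow> finite (univ M) \<and> card (univ M) > 1 \<and>
     (\<forall>p\<in>poly_ops M 1. (\<exists>c. \<forall>x\<in>univ M. p [x] = c) \<or>
        bij_betw (\<lambda>x. p [x]) (univ M) (univ M))"

datatype tct_type = Type1 | Type2 | Type3 | Type4 | Type5

definition gset_alg :: "'a set \<Rightarrow> ('a \<Rightarrow> 'a) set \<Rightarrow> ('a \<Rightarrow> 'a, 'a) ualg" where
  "gset_alg U G = \<lparr>univ = U, syms = G, arity = (\<lambda>_. 1), oper = (\<lambda>g xs. g (xs ! 0))\<rparr>"

datatype 'k module_sym = Plus | Scale 'k

definition module_alg :: "'k ring \<Rightarrow> ('k, 'a) module \<Rightarrow> ('k module_sym, 'a) ualg" where
  "module_alg F W = \<lparr>univ = carrier W, syms = {Plus} \<union> Scale ` carrier F,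
     arity = (\<lambda>f. case f of Plus \<Rightarrow> 2 | Scale _ \<Rightarrow> 1),
     oper = (\<lambda>f xs. case f of Plus \<Rightarrow> xs ! 0 \<oplus>\<^bsub>W\<^esub> xs ! 1 | Scale k \<Rightarrow> k \<odot>\<^bsub>W\<^esub> xs ! 0)\<rparr>"

datatype bool_sym = Meet | Join | Compl

text \<open>The reduct to the symbols \<open>F\<close> of the two-element Boolean algebra with bottom \<open>a\<close>, top \<open>b\<close>.\<close>

definition two_alg :: "bool_sym set \<Rightarrow> 'a \<Rightarrow> 'a \<Rightarrow> (bool_sym, 'a) ualg" where
  "two_alg F a b = \<lparr>univ = {a, b}, syms = F,
     arity = (\<lambda>f. case f of Meet \<Rightarrow> 2 | Join \<Rightarrow> 2 | Compl \<Rightarrow> 1),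
     oper = (\<lambda>f xs. case f of
         Meet \<Rightarrow> if xs ! 0 = b \<and> xs ! 1 = b then b else a
       | Join \<Rightarrow> if xs ! 0 = a \<and> xs ! 1 = a then a else b
       | Compl \<Rightarrow> if xs ! 0 = a then b else a)\<rparr>"

text \<open>
  Every finite field has an isomorphic copy on a set of natural numbers, so type 2 loses nothing
  by taking the scalars in \<^typ>\<open>nat\<close>.
\<close>

fun minimal_type :: "('f, 'a) ualg \<Rightarrow> tct_type \<Rightarrow> bool" where
  "minimal_type M Type1 \<longleftrightarrow> minimal_algebra M \<and>
     (\<exists>G. subgroup G (BijGroup (univ M)) \<and> poly_equivalent M (gset_alg (univ M) G))"
| "minimal_type M Type2 \<longleftrightarrow> minimal_algebra M \<and>
     (\<exists>(F :: nat ring) W. field F \<and> finite (carrier F) \<and> module F W \<and>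
        poly_equivalent M (module_alg F W))"
| "minimal_type M Type3 \<longleftrightarrow> minimal_algebra M \<and>
     (\<exists>a b. a \<noteq> b \<and> poly_equivalent M (two_alg {Meet, Join, Compl} a b))"
| "minimal_type M Type4 \<longleftrightarrow> minimal_algebra M \<and>
     (\<exists>a b. a \<noteq> b \<and> poly_equivalent M (two_alg {Meet, Join} a b))"
| "minimal_type M Type5 \<longleftrightarrow> minimal_algebra M \<and>
     (\<exists>a b. a \<noteq> b \<and> poly_equivalent M (two_alg {Meet} a b))"

definition poly_images :: "('f, 'a) ualg \<Rightarrow> 'a rel \<Rightarrow> 'a rel \<Rightarrow> 'a set set" where
  "poly_images A \<alpha> \<beta> = {(\<lambda>x. p [x]) ` univ A | p.
     p \<in> poly_ops A 1 \<and> \<not> (\<forall>(x, y)\<in>\<beta>. (p [x], p [y]) \<in> \<alpha>)}"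

definition minimal_sets :: "('f, 'a) ualg \<Rightarrow> 'a rel \<Rightarrow> 'a rel \<Rightarrow> 'a set set" where
  "minimal_sets A \<alpha> \<beta> = {U \<in> poly_images A \<alpha> \<beta>. \<not> (\<exists>U'\<in>poly_images A \<alpha> \<beta>. U' \<subset> U)}"

definition traces :: "('f, 'a) ualg \<Rightarrow> 'a rel \<Rightarrow> 'a rel \<Rightarrow> 'a set set" where
  "traces A \<alpha> \<beta> = {U \<inter> \<beta> `` {x} | U x.
     U \<in> minimal_sets A \<alpha> \<beta> \<and> x \<in> U \<and> \<not> U \<inter> \<beta> `` {x} \<subseteq> \<alpha> `` {x}}"

text \<open>
  All traces of a prime quotient of a finite algebra give minimal algebras of the same type, so
  it is immaterial that the trace is chosen existentially.
\<close>

definition has_type :: "('f, 'a) ualg \<Rightarrow> 'a rel \<Rightarrow> 'a rel \<Rightarrow> tct_type \<Rightarrow> bool" where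
  "has_type A \<alpha> \<beta> t \<longleftrightarrow> (\<exists>N\<in>traces A \<alpha> \<beta>.
     minimal_type (quotient_alg (induced_alg A N) (\<alpha> \<inter> N \<times> N)) t)"

definition typ_class :: "('f, 'a) ualg set \<Rightarrow> tct_type set" where
  "typ_class K = {t. \<exists>A\<in>K. finite (univ A) \<and>
     (\<exists>\<alpha> \<beta>. prime_quotient A \<alpha> \<beta> \<and> has_type A \<alpha> \<beta> t)}"

section \<open>Turing machines\<close>

datatype tsym = S0 | S1
datatype dir = L | R

text \<open>
  \<^term>\<open>instr T i r = (s, d, m)\<close> is the instruction \<open>\<mu>\<^sub>i r s d \<mu>\<^sub>m\<close>; the halting state is
  \<open>0\<close>, and only the values of \<open>instr\<close> at \<open>1 \<le> i \<le> num_states T\<close> are meaningful.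
\<close>

record turing =
  num_states :: nat
  instr :: "nat \<Rightarrow> tsym \<Rightarrow> tsym \<times> dir \<times> nat"

definition turing_machine :: "turing \<Rightarrow> bool" where
  "turing_machine T \<longleftrightarrow> num_states T \<ge> 1 \<and>
     (\<forall>i\<in>{1..num_states T}. \<forall>r. case instr T i r of (s, d, m) \<Rightarrow> m \<le> num_states T)"

type_synonym config = "nat \<times> int \<times> (int \<Rightarrow> tsym)"

inductive step :: "turing \<Rightarrow> config \<Rightarrow> config \<Rightarrow> bool" for T where
  "i \<in> {1..num_states T} \<Longrightarrow> instr T i (tape h) = (s, d, m) \<Longrightarrow>
   step T (i, h, tape) (m, (case d of L \<Rightarrow> h - 1 | R \<Rightarrow> h + 1), tape(h := s))"

definition halts :: "turing \<Rightarrow> bool" where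
  "halts T \<longleftrightarrow> (\<exists>h tape. (step T)\<^sup>*\<^sup>* (1, 0, \<lambda>_. S0) (0, h, tape))"

section \<open>The algebra of a Turing machine\<close>

text \<open>
  \<open>C i r s\<close>, \<open>D i r s\<close> and \<open>M i r\<close> are \<open>C\<^sub>i\<^sub>r\<^sup>s\<close>, \<open>D\<^sub>i\<^sub>r\<^sup>s\<close> and \<open>M\<^sub>i\<^sup>r\<close>.
\<close>

datatype vel = C nat tsym tsym | D nat tsym tsym | M nat tsym

datatype elt = Zero | P0 | P1 | P2 | One | Two | H | Vel vel | Bar vel

fun state_of :: "vel \<Rightarrow> nat" where
  "state_of (C i r s) = i"
| "state_of (D i r s) = i"
| "state_of (M i r) = i"

definition Pset :: "elt set" where "Pset = {P0, P1, P2}"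
definition Uset :: "elt set" where "Uset = {One, Two, H}"
definition Vset :: "turing \<Rightarrow> elt set" where "Vset T = {Vel v | v. state_of v \<le> num_states T}"
definition Vbarset :: "turing \<Rightarrow> elt set" where "Vbarset T = {Bar v | v. state_of v \<le> num_states T}"
definition VVbar :: "turing \<Rightarrow> elt set" where "VVbar T = Vset T \<union> Vbarset T"
definition V0 :: "elt set" where "V0 = {Vel v | v. state_of v = 0}"
definition V10 :: "elt set" where "V10 = {Vel (C 1 S0 S0), Vel (D 1 S0 S0), Vel (M 1 S0)}"

definition Bset :: "turing \<Rightarrow> elt set" where
  "Bset T = {Zero} \<union> Pset \<union> Uset \<union> Vset T \<union> Vbarset T"

text \<open>Only the values on elements of \<open>V\<close> and its barred copy matter.\<close>

fun bar :: "elt \<Rightarrow> elt" where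
  "bar (Vel v) = Bar v"
| "bar (Bar v) = Vel v"
| "bar x = x"

definition ble :: "elt \<Rightarrow> elt \<Rightarrow> bool" where
  "ble x y \<longleftrightarrow> x = Zero \<or> x = y \<or> x = P2 \<and> y \<in> {P0, P1}"

definition wedge :: "elt \<Rightarrow> elt \<Rightarrow> elt" where
  "wedge x y = (THE z. ble z x \<and> ble z y \<and> (\<forall>w. ble w x \<and> ble w y \<longrightarrow> ble w z))"

datatype idx3 = I0 | I1 | I2

fun s_elt :: "idx3 \<Rightarrow> elt" where
  "s_elt I0 = Vel (C 1 S0 S0)"
| "s_elt I1 = Vel (M 1 S0)"
| "s_elt I2 = Vel (D 1 S0 S0)"

definition wedge_i :: "idx3 \<Rightarrow> elt \<Rightarrow> elt \<Rightarrow> elt" where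
  "wedge_i i x y = (if x = y \<and> x \<in> (Pset \<union> V10) - {s_elt i} then x else Zero)"

definition T0 :: "elt \<Rightarrow> elt" where
  "T0 x = (if x \<in> {P0, P2} then P2 else if x = P1 then P0 else if x \<in> V0 then x else Zero)"

definition T1 :: "elt \<Rightarrow> elt \<Rightarrow> elt" where
  "T1 x y =
    (if x = P0 \<and> y = P0 \<or> {x, y} = {P0, P1} \<or> {x, y} = {P0, P2} then P1
     else if {x, y} \<subseteq> {P1, P2} then P2
     else if x = y \<and> x \<in> V10 then x
     else Zero)"

definition J' :: "turing \<Rightarrow> elt \<Rightarrow> elt \<Rightarrow> elt \<Rightarrow> elt" where
  "J' T x y z =
    (if x = y \<or> {x, y} \<subseteq> Pset then wedge x z
     else if x = bar y \<and> x \<in> VVbar T then x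
     else Zero)"

definition tt :: "elt \<Rightarrow> elt \<Rightarrow> elt \<Rightarrow> elt" where
  "tt x y z = (if x = y then z else x)"

definition Sone :: "turing \<Rightarrow> elt \<Rightarrow> elt \<Rightarrow> elt \<Rightarrow> elt \<Rightarrow> elt" where
  "Sone T u x y z =
    (if u \<in> {One, Two} \<and> x = y \<and> y = z \<and> x \<in> Uset \<union> VVbar T then x
     else if {x, y, z} \<subseteq> Pset then tt x y z
     else Zero)"

definition Stwo :: "turing \<Rightarrow> elt \<Rightarrow> elt \<Rightarrow> elt \<Rightarrow> elt \<Rightarrow> elt \<Rightarrow> elt" where
  "Stwo T u v x y z =
    (if u = bar v \<and> u \<in> VVbar T \<and> x = y \<and> y = z \<and> x \<in> Uset \<union> VVbar T then x
     else if {x, y, z} \<subseteq> Pset then tt x y z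
     else Zero)"

text \<open>
  The machine operation of the instruction \<open>\<mu>\<^sub>i r s d \<mu>\<^sub>m\<close> and the symbol \<open>t\<close>,
  first on the elements of \<open>V\<close> (with \<^const>\<open>None\<close> where the value is \<open>0\<close>).
\<close>

fun left_V :: "nat \<Rightarrow> tsym \<Rightarrow> tsym \<Rightarrow> nat \<Rightarrow> tsym \<Rightarrow> elt \<Rightarrow> elt \<Rightarrow> vel \<Rightarrow> vel option" where
  "left_V i r s m t x y (C j q s') =
     (if j = i \<and> q = r \<and> x = One \<and> y = One then Some (C m t s')
      else if j = i \<and> q = r \<and> s' = t \<and> x = H \<and> y = One then Some (M m t)
      else None)"
| "left_V i r s m t x y (M j q) =
     (if j = i \<and> q = r \<and> x = Two \<and> y = H then Some (D m t s) else None)"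
| "left_V i r s m t x y (D j q s') =
     (if j = i \<and> q = r \<and> x = Two \<and> y = Two then Some (D m t s') else None)"

fun right_V :: "nat \<Rightarrow> tsym \<Rightarrow> tsym \<Rightarrow> nat \<Rightarrow> tsym \<Rightarrow> elt \<Rightarrow> elt \<Rightarrow> vel \<Rightarrow> vel option" where
  "right_V i r s m t x y (C j q s') =
     (if j = i \<and> q = r \<and> x = One \<and> y = One then Some (C m t s') else None)"
| "right_V i r s m t x y (M j q) =
     (if j = i \<and> q = r \<and> x = H \<and> y = One then Some (C m t s) else None)"
| "right_V i r s m t x y (D j q s') =
     (if j = i \<and> q = r \<and> s' = t \<and> x = Two \<and> y = H then Some (M m t)
      else if j = i \<and> q = r \<and> x = Two \<and> y = Two then Some (D m t s')
      else None)"

definition move_V :: "turing \<Rightarrow> nat \<Rightarrow> tsym \<Rightarrow> tsym \<Rightarrow> elt \<Rightarrow> elt \<Rightarrow> vel \<Rightarrow> vel option" where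
  "move_V T i r t = (case instr T i r of
     (s, L, m) \<Rightarrow> left_V i r s m t | (s, R, m) \<Rightarrow> right_V i r s m t)"

definition move :: "turing \<Rightarrow> nat \<Rightarrow> tsym \<Rightarrow> tsym \<Rightarrow> elt \<Rightarrow> elt \<Rightarrow> elt \<Rightarrow> elt" where
  "move T i r t x y u =
    (if u \<in> Pset then (if x = One \<and> y = One then u else Zero)
     else case u of
         Vel v \<Rightarrow> (case move_V T i r t x y v of Some w \<Rightarrow> Vel w | None \<Rightarrow> Zero)
       | Bar v \<Rightarrow> (case move_V T i r t x y v of Some w \<Rightarrow> Bar w | None \<Rightarrow> Zero)
       | _ \<Rightarrow> Zero)"

text \<open>
  \<open>Fwd i r t\<close> names \<open>L\<^sub>i\<^sub>r\<^sub>t\<close> or \<open>R\<^sub>i\<^sub>r\<^sub>t\<close>, according to the direction in the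
  unique instruction beginning with \<open>\<mu>\<^sub>i r\<close>; \<open>Rev i r t\<close> names its reverse.
\<close>

datatype mop = Fwd nat tsym tsym | Rev nat tsym tsym

definition Mset :: "turing \<Rightarrow> mop set" where
  "Mset T = {Fwd i r t | i r t. i \<in> {1..num_states T}} \<union> {Rev i r t | i r t. i \<in> {1..num_states T}}"

fun mop_fun :: "turing \<Rightarrow> mop \<Rightarrow> elt \<Rightarrow> elt \<Rightarrow> elt \<Rightarrow> elt" where
  "mop_fun T (Fwd i r t) x y u = move T i r t x y u"
| "mop_fun T (Rev i r t) x y u =
     (if u \<noteq> Zero \<and> (\<exists>v\<in>Bset T. move T i r t x y v = u)
      then THE v. v \<in> Bset T \<and> move T i r t x y v = u else Zero)"

definition prec :: "elt \<Rightarrow> elt \<Rightarrow> bool" where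
  "prec x y \<longleftrightarrow> (x, y) \<in> {(Two, Two), (Two, H), (H, One), (One, One)}"

definition Uone :: "turing \<Rightarrow> mop \<Rightarrow> elt \<Rightarrow> elt \<Rightarrow> elt \<Rightarrow> elt \<Rightarrow> elt" where
  "Uone T F x y z u =
    (if prec x y \<and> prec x z \<and> y \<noteq> z \<and> mop_fun T F x y u \<in> VVbar T then bar (mop_fun T F x y u)
     else if prec x y \<and> y = z then mop_fun T F x y u
     else Zero)"

definition Utwo :: "turing \<Rightarrow> mop \<Rightarrow> elt \<Rightarrow> elt \<Rightarrow> elt \<Rightarrow> elt \<Rightarrow> elt" where
  "Utwo T F x y z u =
    (if prec x z \<and> prec y z \<and> x \<noteq> y \<and> mop_fun T F y z u \<in> VVbar T then bar (mop_fun T F y z u)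
     else if x = y \<and> prec y z then mop_fun T F y z u
     else Zero)"

datatype opsym = ZeroOp | WedgeOp | WedgeIOp idx3 | T0Op | T1Op | JOp | S1Op | S2Op
  | MOp mop | U1Op mop | U2Op mop

fun op_arity :: "opsym \<Rightarrow> nat" where
  "op_arity ZeroOp = 0"
| "op_arity WedgeOp = 2"
| "op_arity (WedgeIOp i) = 2"
| "op_arity T0Op = 1"
| "op_arity T1Op = 2"
| "op_arity JOp = 3"
| "op_arity S1Op = 4"
| "op_arity S2Op = 5"
| "op_arity (MOp F) = 3"
| "op_arity (U1Op F) = 4"
| "op_arity (U2Op F) = 4"

fun op_fun :: "turing \<Rightarrow> opsym \<Rightarrow> elt list \<Rightarrow> elt" where
  "op_fun T ZeroOp xs = Zero"
| "op_fun T WedgeOp xs = wedge (xs ! 0) (xs ! 1)"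
| "op_fun T (WedgeIOp i) xs = wedge_i i (xs ! 0) (xs ! 1)"
| "op_fun T T0Op xs = T0 (xs ! 0)"
| "op_fun T T1Op xs = T1 (xs ! 0) (xs ! 1)"
| "op_fun T JOp xs = J' T (xs ! 0) (xs ! 1) (xs ! 2)"
| "op_fun T S1Op xs = Sone T (xs ! 0) (xs ! 1) (xs ! 2) (xs ! 3)"
| "op_fun T S2Op xs = Stwo T (xs ! 0) (xs ! 1) (xs ! 2) (xs ! 3) (xs ! 4)"
| "op_fun T (MOp F) xs = mop_fun T F (xs ! 0) (xs ! 1) (xs ! 2)"
| "op_fun T (U1Op F) xs = Uone T F (xs ! 0) (xs ! 1) (xs ! 2) (xs ! 3)"
| "op_fun T (U2Op F) xs = Utwo T F (xs ! 0) (xs ! 1) (xs ! 2) (xs ! 3)"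

definition BT :: "turing \<Rightarrow> (opsym, elt) ualg" where
  "BT T = \<lparr>univ = Bset T,
     syms = {ZeroOp, WedgeOp, T0Op, T1Op, JOp, S1Op, S2Op} \<union> range WedgeIOp \<union>
       MOp ` Mset T \<union> U1Op ` Mset T \<union> U2Op ` Mset T,
     arity = op_arity, oper = op_fun T\<rparr>"

end

theory Submission
  imports Defs
begin

text \<open>
  A finite member of the variety is a quotient of a finite \<open>S \<le> B(T)\<^sup>I\<close>.  If it has a prime quotient of
  type 4, pulling it back to \<open>S\<close> gives a pair \<open>c < b\<close> on which there is a join polynomial but no
  complementing polynomial.  For a suitable \<open>c\<close>, the elements \<open>c\<close> and \<open>b\<close> differ only at coordinates
  where \<open>c\<close> is \<open>P2\<close> and \<open>b\<close> is \<open>P0\<close> or \<open>P1\<close>.  A polynomial of the form \<open>S1\<close> or \<open>S2\<close> acting as the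
  discriminator on the live coordinates would produce a complement, and all the other operations
  except \<open>T1\<close> preserve meets, so the join comes from \<open>T1\<close>.  Since \<open>T1\<close> turns \<open>P0\<close> into \<open>P1\<close> and only
  \<open>T0\<close> turns \<open>P1\<close> back, some chain of translations leads from a value of \<open>T1\<close> to an argument of \<open>T0\<close>,
  that is, on the live coordinates outside \<open>P\<close>, from the initial letters \<open>V10\<close> to the halting letters
  \<open>V0\<close> by machine operations.  When the number of live coordinates is minimal, the operations \<open>U1\<close>,
  \<open>U2\<close> and \<open>J'\<close> force the coordinates to be arranged along a tape, so that the chain is a
  computation, with forward and backward steps, from the initial configuration to a halting one.
  As the machine is deterministic, it then halts.
\<close>

text \<open>The obstacle is that the quotient is known only modulo its lower congruence \<alpha>,
  while the operations must be examined coordinate by coordinate. It is removed by taking b of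
  minimal rank in S: then a vector is true modulo \<alpha> exactly when it lies above b, and the
  false vectors below b form a set F inside one class of \<alpha>. Hence c may be replaced by a
  better member of F, and no polynomial tells the members of F apart. A separating polynomial is
  traced to a path of basic translations. Each translation is strict or constant, so only the
  coordinates where the whole path sends \<open>Zero\<close> to \<open>Zero\<close> matter; these
  are the live ones. A single path might use T1 and never return through T0. But its output, met
  with b, is b or a member of F again, so the path can be run twice, and the second T1 forces a T0
  in between. As machine operations have reverses, a chain of them walks back and forth between
  configurations. Determinism, and the absence of instructions for state 0, turn a walk ending in
  state 0 into a forward run.\<close>

section \<open>The elements of the algebra, their order and the bar\<close>

definition VB :: "elt set" where "VB = range Vel \<union> range Bar"

lemma VB_simps [simp]: "Vel v \<in> VB" "Bar v \<in> VB" "Zero \<notin> VB" "P0 \<notin> VB" "P1 \<notin> VB" "P2 \<notin> VB"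
  "One \<notin> VB" "Two \<notin> VB" "H \<notin> VB"
  by (auto simp: VB_def)

lemma VVbar_eq: "VVbar T = VB \<inter> Bset T"
  by (auto simp: VB_def VVbar_def Bset_def Vset_def Vbarset_def Pset_def Uset_def)

lemma VVbar_imp_VB: "x \<in> VVbar T \<Longrightarrow> x \<in> VB"
  by (simp add: VVbar_eq)

lemma Pset_simps [simp]: "P0 \<in> Pset" "P1 \<in> Pset" "P2 \<in> Pset" "Zero \<notin> Pset" "One \<notin> Pset"
  "Two \<notin> Pset" "H \<notin> Pset" "Vel v \<notin> Pset" "Bar v \<notin> Pset"
  by (auto simp: Pset_def)

lemma Uset_simps [simp]: "One \<in> Uset" "Two \<in> Uset" "H \<in> Uset" "Zero \<notin> Uset" "P0 \<notin> Uset"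
  "P1 \<notin> Uset" "P2 \<notin> Uset" "Vel v \<notin> Uset" "Bar v \<notin> Uset"
  by (auto simp: Uset_def)

lemma VB_not_Pset: "x \<in> VB \<Longrightarrow> x \<notin> Pset"
  by (auto simp: VB_def)

lemma Bset_cases: "x \<in> Bset T \<Longrightarrow> x = Zero \<or> x \<in> Pset \<or> x \<in> Uset \<union> VVbar T"
  by (auto simp: Bset_def VVbar_def)

lemma UV_not: "x \<in> Uset \<union> VVbar T \<Longrightarrow> x \<noteq> Zero \<and> x \<notin> Pset"
  by (auto simp: Uset_def VVbar_eq VB_def)

lemma bar_bar [simp]: "bar (bar x) = x"
  by (cases x) auto

lemma bar_VB [simp]: "bar x \<in> VB \<longleftrightarrow> x \<in> VB"
  by (cases x) auto

lemma bar_neq: "x \<in> VB \<Longrightarrow> bar x \<noteq> x"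
  by (cases x) auto

text \<open>The order is flat over \<open>Zero\<close> except for \<open>P2\<close> below
  \<open>P0\<close> and \<open>P1\<close>, so distinct elements can have a nonzero meet only inside
  \<open>Pset\<close>.\<close>

lemma wedge_eq:
  "wedge x y = (if x = y then x else if x \<in> Pset \<and> y \<in> Pset then P2 else Zero)"
proof -
  have "ble z x \<and> ble z y \<and> (\<forall>w. ble w x \<and> ble w y \<longrightarrow> ble w z)
      \<longleftrightarrow> z = (if x = y then x else if x \<in> Pset \<and> y \<in> Pset then P2 else Zero)" for z
  proof
    assume z: "ble z x \<and> ble z y \<and> (\<forall>w. ble w x \<and> ble w y \<longrightarrow> ble w z)"
    then have zz: "ble z x" "ble z y" and m: "\<And>w. ble w x \<Longrightarrow> ble w y \<Longrightarrow> ble w z" by auto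
    show "z = (if x = y then x else if x \<in> Pset \<and> y \<in> Pset then P2 else Zero)"
      using zz m[of x] m[of P2]
      by (auto simp: ble_def Pset_def split: if_splits)
  qed (auto simp: ble_def Pset_def)
  then show ?thesis by (simp add: wedge_def)
qed

lemma ble_refl [simp]: "ble x x" and ble_Zero [simp]: "ble Zero x"
  and ble_to_Zero [simp]: "ble x Zero \<longleftrightarrow> x = Zero"
  by (auto simp: ble_def)

lemma ble_trans: "ble x y \<Longrightarrow> ble y z \<Longrightarrow> ble x z"
  by (auto simp: ble_def)

lemma ble_iff_wedge: "ble x y \<longleftrightarrow> wedge x y = x"
  by (auto simp: ble_def wedge_eq Pset_def)

lemma wedge_le: "ble (wedge x y) x" "ble (wedge x y) y"
  by (auto simp: ble_def wedge_eq Pset_def)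

lemma wedge_idem [simp]: "wedge x x = x" and wedge_Zero [simp]: "wedge Zero x = Zero" "wedge x Zero = Zero"
  by (auto simp: wedge_eq)

lemma wedge_commute: "wedge x y = wedge y x"
  by (auto simp: wedge_eq)

lemma wedge_assoc: "wedge (wedge x y) z = wedge x (wedge y z)"
  by (auto simp: wedge_eq)

lemma prec_One: "prec One y \<longleftrightarrow> y = One" "prec x Two \<longleftrightarrow> x = Two"
  by (auto simp: prec_def)

lemma prec_Uset: "prec x y \<Longrightarrow> x \<in> Uset \<and> y \<in> Uset"
  by (auto simp: prec_def)

section \<open>Machine operations\<close>

text \<open>The letter at a square with content \<open>c\<close> when \<open>q\<close> tells where this square lies relative to
  the head: \<open>One\<close> to its left, \<open>H\<close> under it, \<open>Two\<close> to its right.\<close>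

definition enc :: "nat \<Rightarrow> tsym \<Rightarrow> tsym \<Rightarrow> elt \<Rightarrow> vel" where
  "enc j r c q = (if q = One then C j r c else if q = H then M j r else D j r c)"

text \<open>One formula for both directions. For a coordinate standing for some square, x and y
  locate this square relative to two adjacent head positions, x belonging to the left one. So q and
  q' are its locations before and after the step, and c is its content, forced to be r under the old
  head and t under the new one.\<close>

lemma move_V_enc:
  assumes ins: "instr T i r = (s, d, m)"
  shows "move_V T i r t x y v = Some v' \<longleftrightarrow> prec x y \<and>
    (let q = (case d of L \<Rightarrow> y | R \<Rightarrow> x); q' = (case d of L \<Rightarrow> x | R \<Rightarrow> y) in
     \<exists>c. (q = H \<longrightarrow> c = r) \<and> (q' = H \<longrightarrow> c = t) \<and>
         v = enc i r c q \<and> v' = enc m t (if q = H then s else c) q')"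
proof (cases d)
  case L
  then show ?thesis
    using ins unfolding move_V_def
    by (cases v) (auto simp: enc_def prec_def split: if_splits)
next
  case R
  then show ?thesis
    using ins unfolding move_V_def
    by (cases v) (auto simp: enc_def prec_def split: if_splits)
qed

text \<open>A step destroys only the symbol overwritten under the head, and this is r, which the
  operation itself determines.\<close>

lemma move_V_inj:
  assumes "move_V T i r t x y v = Some w" "move_V T i r t x y v' = Some w"
  shows "v = v'"
proof -
  obtain s d m where "instr T i r = (s, d, m)" by (metis prod_cases3)
  then show ?thesis
    using assms by (auto simp: move_V_enc Let_def enc_def prec_def split: dir.splits if_splits)
qed

lemma move_V_prec: "move_V T i r t x y v = Some w \<Longrightarrow> prec x y"
  by (metis (no_types, lifting) move_V_enc prod_cases3)

lemma move_V_state: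
  assumes "move_V T i r t x y v = Some w"
  shows "state_of v = i"
proof -
  obtain s d m where "instr T i r = (s, d, m)" by (metis prod_cases3)
  then show ?thesis
    using assms by (auto simp: move_V_enc Let_def enc_def)
qed

lemma move_nonzero:
  assumes "move T i r t x y u = v" "v \<noteq> Zero"
  shows "prec x y \<and> (u \<in> Pset \<and> x = One \<and> y = One \<and> v = u \<or>
    u \<in> VB \<and> v \<in> VB \<and> u \<in> {Vel u' |u'. state_of u' = i} \<union> {Bar u' |u'. state_of u' = i})"
  using assms
  by (cases u) (auto simp: move_def prec_def dest: move_V_prec move_V_state
    split: if_splits option.splits)

lemma move_inj:
  assumes "move T i r t x y u = v" "move T i r t x y u' = v" "v \<noteq> Zero"
  shows "u = u'"
  using assms
  by (cases u; cases u') (auto simp: move_def dest: move_V_inj split: if_splits option.splits)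

lemma move_bar: "u \<in> VB \<Longrightarrow> move T i r t x y (bar u) = bar (move T i r t x y u)"
  by (cases u) (auto simp: move_def split: option.splits)

lemma Bset_Vel: "Vel v \<in> Bset T \<longleftrightarrow> state_of v \<le> num_states T"
    "Bar v \<in> Bset T \<longleftrightarrow> state_of v \<le> num_states T"
  by (auto simp: Bset_def Vset_def Vbarset_def Pset_def Uset_def)

lemma Pset_Bset: "u \<in> Pset \<Longrightarrow> u \<in> Bset T"
  by (auto simp: Bset_def)

lemma Zero_Bset [simp]: "Zero \<in> Bset T" by (simp add: Bset_def)

text \<open>The definition searches preimages only in \<open>Bset T\<close>. Nothing is lost: a
  preimage of a nonzero value lies in P or has state index i, which is a state of the
  machine.\<close>

lemma rev_iff:
  assumes "i \<in> {1..num_states T}" "v \<noteq> Zero"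
  shows "mop_fun T (Rev i r t) x y u = v \<longleftrightarrow> u \<noteq> Zero \<and> move T i r t x y v = u"
proof -
  have B: "v \<in> Bset T" if "move T i r t x y v = u" "u \<noteq> Zero" for v
    using move_nonzero[OF that] assms(1) by (auto simp: Bset_Vel Pset_Bset)
  have "(THE v. v \<in> Bset T \<and> move T i r t x y v = u) = w"
    if "move T i r t x y w = u" "u \<noteq> Zero" for w
    using move_inj[OF _ that(1) that(2)] B[OF that] that by blast
  then show ?thesis using assms B by (auto)
qed

fun inv_mop :: "mop \<Rightarrow> mop" where
  "inv_mop (Fwd i r t) = Rev i r t"
| "inv_mop (Rev i r t) = Fwd i r t"

lemma inv_mop_Mset: "F \<in> Mset T \<Longrightarrow> inv_mop F \<in> Mset T"
  by (auto simp: Mset_def)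

lemma mop_inv:
  assumes "F \<in> Mset T" "mop_fun T F x y u = v" "v \<noteq> Zero"
  shows "mop_fun T (inv_mop F) x y v = u"
proof (cases F)
  case (Fwd i r t)
  then have "i \<in> {1..num_states T}" "move T i r t x y u = v" using assms by (auto simp: Mset_def)
  moreover then have "u \<noteq> Zero" using move_nonzero[of T i r t x y u v] assms by auto
  ultimately show ?thesis using rev_iff[of i T u r t x y v] assms Fwd by auto
next
  case (Rev i r t)
  then have "i \<in> {1..num_states T}" using assms by (auto simp: Mset_def)
  then show ?thesis using rev_iff[of i T v r t x y u] assms Rev by auto
qed

lemma mop_nonzero:
  assumes "F \<in> Mset T" "mop_fun T F x y u = v" "v \<noteq> Zero"
  shows "prec x y \<and> (u \<in> Pset \<and> x = One \<and> y = One \<and> v = u \<or> u \<in> VB \<and> v \<in> VB)"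
proof (cases F)
  case (Fwd i r t)
  then show ?thesis using assms move_nonzero[of T i r t x y u v] by auto
next
  case (Rev i r t)
  then have "i \<in> {1..num_states T}" using assms by (auto simp: Mset_def)
  then show ?thesis using rev_iff[of i T v r t x y u] assms Rev move_nonzero[of T i r t x y v u] by auto
qed

lemma mop_Pset:
  assumes "F \<in> Mset T" "u \<in> Pset"
  shows "mop_fun T F One One u = u"
proof (cases F)
  case (Fwd i r t)
  then show ?thesis using assms by (simp add: move_def)
next
  case (Rev i r t)
  have "u \<noteq> Zero" using assms by auto
  moreover have "i \<in> {1..num_states T}" using assms Rev by (auto simp: Mset_def)
  ultimately show ?thesis using rev_iff[of i T u r t One One u] assms Rev by (simp add: move_def)
qed

text \<open>Serves to pull the bars produced by U1 and U2 back along a chain of machine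
  operations.\<close>

lemma mop_bar:
  assumes F: "F \<in> Mset T" and u: "u \<in> VB"
  shows "mop_fun T F x y (bar u) = bar (mop_fun T F x y u)"
proof (cases F)
  case (Fwd i r t)
  then show ?thesis using assms by (simp add: move_bar)
next
  case (Rev i r t)
  then have i: "i \<in> {1..num_states T}" using assms by (auto simp: Mset_def)
  have *: "mop_fun T F x y (bar u) = bar v" if "mop_fun T F x y u = v" "v \<noteq> Zero" "u \<in> VB" for u v
  proof -
    have "v \<in> VB" using mop_nonzero[OF F that(1,2)] that by (auto dest: VB_not_Pset)
    then have z: "bar v \<noteq> Zero" "bar u \<noteq> Zero" using that by (metis VB_simps(3) bar_VB)+
    have "move T i r t x y (bar v) = bar u"
      using rev_iff[of i T v r t x y u] that i Rev \<open>v \<in> VB\<close> by (simp add: move_bar del: mop_fun.simps)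
    then show ?thesis using rev_iff[OF i z(1)] z Rev by (simp del: mop_fun.simps)
  qed
  show ?thesis
  proof (cases "mop_fun T F x y u = Zero")
    case False
    then show ?thesis using *[OF refl _ u] by simp
  next
    \<comment> \<open>A nonzero value at \<open>bar u\<close> would, by the claim applied to
      \<open>bar u\<close>, give a nonzero value at u.\<close>
    case True
    then show ?thesis
      using *[OF refl, of "bar u"] u by (metis bar_VB bar_bar bar.simps(3))
  qed
qed

text \<open>On P a nonzero value needs x = y = \<open>One\<close>, and then \<open>prec x z\<close>
  leaves only z = \<open>One\<close>, so the barred branch never meets P.\<close>

lemma Uone_nonzero:
  assumes "F \<in> Mset T" "Uone T F x y z u \<noteq> Zero"
  shows "prec x y \<and> prec x z \<and> mop_fun T F x y u \<noteq> Zero \<and>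
    (u \<in> Pset \<and> x = One \<and> y = One \<and> z = One \<and> Uone T F x y z u = u \<or>
     u \<in> VB \<and> Uone T F x y z u \<in> VB \<and>
       Uone T F x y z u = (if y = z then mop_fun T F x y u else bar (mop_fun T F x y u)))"
proof -
  have nz: "mop_fun T F x y u \<noteq> Zero"
    using assms(2) by (auto simp: Uone_def VVbar_eq split: if_splits simp del: mop_fun.simps)
  show ?thesis
    using mop_nonzero[OF assms(1) refl nz] assms(2) nz
    by (auto simp: Uone_def VVbar_eq prec_One dest: VB_not_Pset split: if_splits simp del: mop_fun.simps)
qed

text \<open>Here \<open>prec x z\<close> with z = \<open>One\<close> would also allow x =
  \<open>H\<close>; on P this is excluded only because the barred branch asks for a value in V or
  its copy. This asymmetry reappears in \<open>uniq_left\<close>.\<close>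

lemma Utwo_nonzero:
  assumes "F \<in> Mset T" "Utwo T F x y z u \<noteq> Zero"
  shows "prec x z \<and> prec y z \<and> mop_fun T F y z u \<noteq> Zero \<and>
    (u \<in> Pset \<and> x = One \<and> y = One \<and> z = One \<and> Utwo T F x y z u = u \<or>
     u \<in> VB \<and> Utwo T F x y z u \<in> VB \<and>
       Utwo T F x y z u = (if x = y then mop_fun T F y z u else bar (mop_fun T F y z u)))"
proof -
  have nz: "mop_fun T F y z u \<noteq> Zero"
    using assms(2) by (auto simp: Utwo_def VVbar_eq split: if_splits simp del: mop_fun.simps)
  show ?thesis
    using mop_nonzero[OF assms(1) refl nz] assms(2) nz
    by (cases "x = y") (auto simp: Utwo_def VVbar_eq prec_def dest: VB_not_Pset split: if_splits simp del: mop_fun.simps)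
qed

section \<open>Strict arguments of the basic operations\<close>

abbreviation ops :: "turing \<Rightarrow> opsym set" where "ops T \<equiv> syms (BT T)"

lemma ops_simps [simp]:
  "MOp F \<in> ops T \<longleftrightarrow> F \<in> Mset T" "U1Op F \<in> ops T \<longleftrightarrow> F \<in> Mset T" "U2Op F \<in> ops T \<longleftrightarrow> F \<in> Mset T"
  "WedgeOp \<in> ops T" "JOp \<in> ops T" "S1Op \<in> ops T" "S2Op \<in> ops T" "WedgeIOp i \<in> ops T"
  "T0Op \<in> ops T" "T1Op \<in> ops T" "ZeroOp \<in> ops T"
  by (auto simp: BT_def)

lemma len_expand:
  "length xs = 2 \<longleftrightarrow> (\<exists>x y. xs = [x, y])"
  "length xs = 3 \<longleftrightarrow> (\<exists>x y z. xs = [x, y, z])"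
  "length xs = 4 \<longleftrightarrow> (\<exists>x y z u. xs = [x, y, z, u])"
  "length xs = 5 \<longleftrightarrow> (\<exists>x y z u v. xs = [x, y, z, u, v])"
  "length xs = Suc 0 \<longleftrightarrow> (\<exists>x. xs = [x])"
  by (auto simp: numeral_eq_Suc length_Suc_conv)

lemma less_expand:
  "(j::nat) < 2 \<longleftrightarrow> j = 0 \<or> j = 1" "j < 3 \<longleftrightarrow> j = 0 \<or> j = 1 \<or> j = 2"
  "j < 4 \<longleftrightarrow> j = 0 \<or> j = 1 \<or> j = 2 \<or> j = 3" "j < 5 \<longleftrightarrow> j = 0 \<or> j = 1 \<or> j = 2 \<or> j = 3 \<or> j = 4"
  by auto

lemma nth_expand [simp]: "(x # xs) ! 2 = xs ! 1" "(x # xs) ! 3 = xs ! 2" "(x # xs) ! 4 = xs ! 3"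
  by (auto simp: numeral_eq_Suc)

lemma upd_expand [simp]: "(x # xs)[1 := y] = x # xs[0 := y]" "(x # xs)[2 := y] = x # xs[1 := y]"
  "(x # xs)[3 := y] = x # xs[2 := y]"
   "(x # xs)[4 := y] = x # xs[3 := y]"
  by (auto simp: numeral_eq_Suc)

lemma wedge_nonzero: "wedge x y \<noteq> Zero \<Longrightarrow> x = y \<or> x \<in> Pset \<and> y \<in> Pset"
  by (auto simp: wedge_eq split: if_splits)

definition PZ :: "elt set" where "PZ = insert Zero Pset"

lemma PZ_simps [simp]: "Zero \<in> PZ" "P0 \<in> PZ" "P1 \<in> PZ" "P2 \<in> PZ" "One \<notin> PZ"
  "Two \<notin> PZ" "H \<notin> PZ" "Vel v \<notin> PZ" "Bar v \<notin> PZ"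
  by (auto simp: PZ_def)

lemma T0_nonzero: "T0 x \<noteq> Zero \<Longrightarrow> x \<in> Pset \<and> T0 x \<in> Pset \<or> x \<in> V0 \<and> T0 x = x"
  by (auto simp: T0_def Pset_def split: if_splits)

lemma T1_eq: "x \<in> Pset \<Longrightarrow> y \<in> Pset \<Longrightarrow> T1 x y = (if x = P0 \<or> y = P0 then P1 else P2)"
  by (cases x; cases y) (simp_all add: T1_def doubleton_eq_iff)

lemma T1_outside:
  assumes "x \<notin> Pset \<or> y \<notin> Pset"
  shows "T1 x y = (if x = y \<and> x \<in> V10 then x else Zero)"
proof -
  have "\<not> {x, y} \<subseteq> Pset" using assms by auto
  moreover have "{P0, P1} \<subseteq> Pset" "{P0, P2} \<subseteq> Pset" "{P1, P2} \<subseteq> Pset" by auto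
  moreover have "\<not> (x = P0 \<and> y = P0)" using assms by auto
  ultimately have "\<not> (x = P0 \<and> y = P0 \<or> {x, y} = {P0, P1} \<or> {x, y} = {P0, P2})" "\<not> {x, y} \<subseteq> {P1, P2}"
    by blast+
  then show ?thesis unfolding T1_def by presburger
qed

lemma T1_nonzero: "T1 x y \<noteq> Zero \<Longrightarrow>
    x \<in> Pset \<and> y \<in> Pset \<and> T1 x y \<in> Pset \<or> x \<in> V10 \<and> y = x \<and> T1 x y = x"
  by (cases "x \<in> Pset \<and> y \<in> Pset") (auto simp: T1_eq T1_outside split: if_splits)

lemma V10_VB: "x \<in> V10 \<Longrightarrow> x \<in> VB" and V0_VB: "x \<in> V0 \<Longrightarrow> x \<in> VB"
  by (auto simp: V10_def V0_def)

lemma J'_nonzero: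
  assumes nz: "J' T x y z \<noteq> Zero"
  shows "x \<in> Pset \<and> y \<in> Pset \<and> z \<in> Pset \<and> J' T x y z = wedge x z \<or>
    x \<notin> PZ \<and> y \<notin> PZ \<and> J' T x y z = x \<and> (y = x \<and> z = x \<or> x \<in> VVbar T \<and> x = bar y)"
proof (cases "x = y \<or> {x, y} \<subseteq> Pset")
  case True
  then have J: "J' T x y z = wedge x z" by (simp add: J'_def)
  then have "x \<noteq> Zero" "z = x \<or> x \<in> Pset \<and> z \<in> Pset" using nz wedge_nonzero[of x z] by auto
  then show ?thesis using True J by (cases "x \<in> Pset") (auto simp: PZ_def)
next
  case False
  then have J: "J' T x y z = x" "x = bar y" "x \<in> VVbar T" using nz by (auto simp: J'_def split: if_splits)
  then have "x \<in> VB" "y \<in> VB" using bar_VB[of y] VVbar_imp_VB[of x T] by metis+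
  then have "x \<notin> PZ" "y \<notin> PZ" by (auto simp: VB_def)
  then show ?thesis using J by simp
qed

lemma tt_Pset: "x \<in> Pset \<Longrightarrow> z \<in> Pset \<Longrightarrow> tt x y z \<in> Pset"
  by (simp add: tt_def)

lemma UV_notPZ: "x \<in> Uset \<union> VVbar T \<Longrightarrow> x \<notin> PZ"
  using UV_not by (auto simp: PZ_def)

lemma Sone_nonzero: "Sone T u x y z \<noteq> Zero \<Longrightarrow>
    x \<in> Pset \<and> y \<in> Pset \<and> z \<in> Pset \<and> Sone T u x y z = tt x y z \<or>
    u \<in> {One, Two} \<and> x \<in> Uset \<union> VVbar T \<and> y = x \<and> z = x \<and> Sone T u x y z = x"
  by (auto simp: Sone_def split: if_splits)

lemma Stwo_nonzero: "Stwo T u v x y z \<noteq> Zero \<Longrightarrow>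
    x \<in> Pset \<and> y \<in> Pset \<and> z \<in> Pset \<and> Stwo T u v x y z = tt x y z \<or>
    u = bar v \<and> u \<in> VVbar T \<and> u \<notin> PZ \<and> v \<notin> PZ \<and>
      x \<in> Uset \<union> VVbar T \<and> y = x \<and> z = x \<and> Stwo T u v x y z = x"
  by (cases v) (auto simp: Stwo_def VVbar_eq split: if_splits)

lemma J'_const: "J' T x y Zero \<noteq> Zero \<Longrightarrow> J' T x y z = J' T x y Zero"
  using J'_nonzero[of T x y Zero] by (cases y) (auto simp: J'_def)

lemma Sone_Pset: "x \<in> Pset \<Longrightarrow> y \<in> Pset \<Longrightarrow> z \<in> Pset \<Longrightarrow> Sone T u x y z = tt x y z"
  by (auto simp: Sone_def VVbar_eq Uset_def VB_not_Pset)

lemma Stwo_Pset: "x \<in> Pset \<Longrightarrow> y \<in> Pset \<Longrightarrow> z \<in> Pset \<Longrightarrow> Stwo T u v x y z = tt x y z"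
  by (auto simp: Stwo_def VVbar_eq Uset_def VB_not_Pset)

lemma wedge_i_nonzero: "wedge_i i x y \<noteq> Zero \<Longrightarrow> y = x \<and> x \<in> Pset \<union> V10 \<and> x \<noteq> s_elt i \<and> wedge_i i x y = x"
  by (auto simp: wedge_i_def split: if_splits)

lemma Sone_args: "Sone T u x y z \<noteq> Zero \<Longrightarrow> x \<noteq> Zero \<and> y \<noteq> Zero \<and> z \<noteq> Zero"
  by (auto simp: Sone_def VVbar_eq split: if_splits)

lemma Stwo_args: "Stwo T u v x y z \<noteq> Zero \<Longrightarrow> x \<noteq> Zero \<and> y \<noteq> Zero \<and> z \<noteq> Zero"
  by (auto simp: Stwo_def VVbar_eq split: if_splits)

lemma Sone_nonP: "Sone T u x y z \<notin> PZ \<Longrightarrow> u \<notin> PZ \<and> x \<notin> PZ \<and> y \<notin> PZ \<and> z \<notin> PZ"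
  using Sone_nonzero[of T u x y z] tt_Pset[of x z y] by (auto simp: PZ_def)

lemma Stwo_nonP: "Stwo T u v x y z \<notin> PZ \<Longrightarrow> u \<notin> PZ \<and> v \<notin> PZ \<and> x \<notin> PZ \<and> y \<notin> PZ \<and> z \<notin> PZ"
  using Stwo_nonzero[of T u v x y z] tt_Pset[of x z y] by (auto simp: PZ_def)

lemma mop_args:
  assumes F: "F \<in> Mset T" and nz: "mop_fun T F x y u \<noteq> Zero"
  shows "x \<noteq> Zero \<and> y \<noteq> Zero \<and> u \<noteq> Zero \<and>
    (mop_fun T F x y u \<notin> PZ \<longrightarrow> x \<notin> PZ \<and> y \<notin> PZ \<and> u \<notin> PZ)"
proof -
  have "x \<in> Uset \<and> y \<in> Uset \<and> (u \<in> Pset \<and> mop_fun T F x y u \<in> Pset \<or> u \<in> VB)"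
    using mop_nonzero[OF F refl nz] prec_Uset by metis
  moreover have "v \<notin> PZ" if "v \<in> Uset \<or> v \<in> VB" for v
    using that by (auto simp: Uset_def VB_def)
  moreover have "v \<noteq> Zero" if "v \<in> Pset" for v using that by auto
  moreover have "v \<in> PZ" if "v \<in> Pset" for v using that by (simp add: PZ_def)
  ultimately show ?thesis by (metis PZ_simps(1))
qed

lemma Uone_args:
  assumes F: "F \<in> Mset T" and nz: "Uone T F x y z u \<noteq> Zero"
  shows "x \<noteq> Zero \<and> y \<noteq> Zero \<and> z \<noteq> Zero \<and> u \<noteq> Zero \<and>
    (Uone T F x y z u \<notin> PZ \<longrightarrow> x \<notin> PZ \<and> y \<notin> PZ \<and> z \<notin> PZ \<and> u \<notin> PZ)"
proof -
  have "x \<in> Uset \<and> y \<in> Uset \<and> z \<in> Uset \<and> (u \<in> Pset \<and> Uone T F x y z u \<in> Pset \<or> u \<in> VB)"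
    using Uone_nonzero[OF F nz] prec_Uset by metis
  moreover have "v \<notin> PZ" if "v \<in> Uset \<or> v \<in> VB" for v
    using that by (auto simp: Uset_def VB_def)
  moreover have "v \<noteq> Zero" if "v \<in> Pset" for v using that by auto
  moreover have "v \<in> PZ" if "v \<in> Pset" for v using that by (simp add: PZ_def)
  ultimately show ?thesis by (metis PZ_simps(1))
qed

lemma Utwo_args:
  assumes F: "F \<in> Mset T" and nz: "Utwo T F x y z u \<noteq> Zero"
  shows "x \<noteq> Zero \<and> y \<noteq> Zero \<and> z \<noteq> Zero \<and> u \<noteq> Zero \<and>
    (Utwo T F x y z u \<notin> PZ \<longrightarrow> x \<notin> PZ \<and> y \<notin> PZ \<and> z \<notin> PZ \<and> u \<notin> PZ)"
proof -
  have "x \<in> Uset \<and> y \<in> Uset \<and> z \<in> Uset \<and> (u \<in> Pset \<and> Utwo T F x y z u \<in> Pset \<or> u \<in> VB)"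
    using Utwo_nonzero[OF F nz] prec_Uset by metis
  moreover have "v \<notin> PZ" if "v \<in> Uset \<or> v \<in> VB" for v
    using that by (auto simp: Uset_def VB_def)
  moreover have "v \<noteq> Zero" if "v \<in> Pset" for v using that by auto
  moreover have "v \<in> PZ" if "v \<in> Pset" for v using that by (simp add: PZ_def)
  ultimately show ?thesis by (metis PZ_simps(1))
qed

text \<open>The exceptions are the arguments that can be ignored: the third one of J' when the first
  two are opposite under the bar, and the controls of S1 and S2 when x, y, z lie in P.\<close>

lemma op_nonzero_args:
  assumes f: "f \<in> ops T" and len: "length xs = op_arity f" and nz: "op_fun T f xs \<noteq> Zero"
    and l: "l < op_arity f"
  shows "xs ! l \<noteq> Zero \<or> f = JOp \<and> l = 2 \<or> f = S1Op \<and> l = 0 \<or> f = S2Op \<and> (l = 0 \<or> l = 1)"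
proof (cases f)
  case (MOp F)
  then show ?thesis using f l nz mop_args[of F T "xs ! 0" "xs ! 1" "xs ! 2"]
      by (auto simp: less_expand simp del: mop_fun.simps)
next
  case (U1Op F)
  then show ?thesis using f l nz Uone_args[of F T "xs ! 0" "xs ! 1" "xs ! 2" "xs ! 3"]
      by (auto simp: less_expand simp del: mop_fun.simps)
next
  case (U2Op F)
  then show ?thesis using f l nz Utwo_args[of F T "xs ! 0" "xs ! 1" "xs ! 2" "xs ! 3"]
      by (auto simp: less_expand simp del: mop_fun.simps)
next
  case WedgeOp
  then show ?thesis using l nz by (auto simp: less_expand)
next
  case (WedgeIOp i)
  then show ?thesis using l nz wedge_i_nonzero[of i "xs ! 0" "xs ! 1"] by (auto simp: less_expand)
next
  case T0Op
  then show ?thesis using l nz T0_nonzero[of "xs ! 0"] by auto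
next
  case T1Op
  then show ?thesis using l nz T1_nonzero[of "xs ! 0" "xs ! 1"] by (auto simp: less_expand)
next
  case JOp
  then show ?thesis using l nz J'_nonzero[of T "xs ! 0" "xs ! 1" "xs ! 2"] by (auto simp: less_expand)
next
  case S1Op
  then show ?thesis using l nz Sone_args[of T "xs ! 0" "xs ! 1" "xs ! 2" "xs ! 3"]
    by (auto simp: less_expand)
next
  case S2Op
  then show ?thesis using l nz Stwo_args[of T "xs ! 0" "xs ! 1" "xs ! 2" "xs ! 3" "xs ! 4"]
    by (auto simp: less_expand)
qed (use assms in auto)

text \<open>Elements of P interact only among themselves and then yield values in P or
  \<open>Zero\<close>; the third argument of J' can still be ignored.\<close>

lemma op_nonP_args:
  assumes f: "f \<in> ops T" and nz: "op_fun T f xs \<notin> PZ" and l: "l < op_arity f"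
  shows "xs ! l \<notin> PZ \<or> f = JOp \<and> l = 2"
proof -
  have nz': "op_fun T f xs \<noteq> Zero" using nz by auto
  have VB: "x \<in> VB \<Longrightarrow> x \<notin> PZ" for x by (auto simp: PZ_def VB_not_Pset)
  show ?thesis
  proof (cases f)
    case (MOp F)
    then show ?thesis using f l nz nz' mop_args[of F T "xs ! 0" "xs ! 1" "xs ! 2"]
      by (auto simp: less_expand simp del: mop_fun.simps)
  next
    case (U1Op F)
    then show ?thesis using f l nz nz' Uone_args[of F T "xs ! 0" "xs ! 1" "xs ! 2" "xs ! 3"]
      by (auto simp: less_expand simp del: mop_fun.simps)
  next
    case (U2Op F)
    then show ?thesis using f l nz nz' Utwo_args[of F T "xs ! 0" "xs ! 1" "xs ! 2" "xs ! 3"]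
      by (auto simp: less_expand simp del: mop_fun.simps)
  next
    case WedgeOp
    then show ?thesis using l nz by (auto simp: less_expand wedge_eq PZ_def split: if_splits)
  next
    case (WedgeIOp i)
    then show ?thesis using l nz nz' wedge_i_nonzero[of i "xs ! 0" "xs ! 1"]
      by (auto simp: less_expand)
  next
    case T0Op
    then show ?thesis using l nz nz' T0_nonzero[of "xs ! 0"] V0_VB VB by (auto simp: PZ_def)
  next
    case T1Op
    then show ?thesis using l nz nz' T1_nonzero[of "xs ! 0" "xs ! 1"] V10_VB VB
      by (auto simp: less_expand PZ_def)
  next
    case JOp
    then show ?thesis using l nz nz' J'_nonzero[of T "xs ! 0" "xs ! 1" "xs ! 2"]
      by (auto simp: less_expand PZ_def wedge_eq split: if_splits)
  next
    case S1Op
    then show ?thesis using l nz Sone_nonP[of T "xs ! 0" "xs ! 1" "xs ! 2" "xs ! 3"]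
      by (auto simp: less_expand)
  next
    case S2Op
    then show ?thesis using l nz Stwo_nonP[of T "xs ! 0" "xs ! 1" "xs ! 2" "xs ! 3" "xs ! 4"]
      by (auto simp: less_expand)
  qed (use assms in auto)
qed

text \<open>Where an argument \<open>Zero\<close> does not kill the value, the argument is ignored
  altogether. Hence every basic translation is strict or constant.\<close>

lemma op_const:
  assumes f: "f \<in> ops T" and len: "length xs = op_arity f" and j: "j < op_arity f"
    and nz: "op_fun T f (xs[j := Zero]) \<noteq> Zero"
  shows "op_fun T f (xs[j := x]) = op_fun T f (xs[j := Zero])"
proof -
  have "f = JOp \<and> j = 2 \<or> f = S1Op \<and> j = 0 \<or> f = S2Op \<and> (j = 0 \<or> j = 1)"
    using op_nonzero_args[of f T "xs[j := Zero]" j] assms by auto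
  then consider "f = JOp" "j = 2" | "f = S1Op" "j = 0" | "f = S2Op" "j = 0 \<or> j = 1" by blast
  then show ?thesis
  proof cases
    case 1
    then show ?thesis using len nz J'_const[of T "xs ! 0" "xs ! 1" x] by simp
  next
    case 2
    have "Sone T x a b c = Sone T Zero a b c" if "Sone T Zero a b c \<noteq> Zero" for a b c
      using Sone_nonzero[OF that] by (auto simp: Sone_Pset)
    then show ?thesis using len nz 2 by simp
  next
    case 3
    have "Stwo T x v a b c = Stwo T Zero v a b c" if "Stwo T Zero v a b c \<noteq> Zero" for v a b c
      using Stwo_nonzero[OF that] by (auto simp: Stwo_Pset)
    moreover have "Stwo T u x a b c = Stwo T u Zero a b c" if "Stwo T u Zero a b c \<noteq> Zero" for u a b c
      using Stwo_nonzero[OF that] by (auto simp: Stwo_Pset)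
    ultimately show ?thesis using len nz 3 by auto
  qed
qed

text \<open>Think of xs, ys, zs as the arguments at (0,1), (1,0) and (0,0). An argument that matters
  must be nonzero in both xs and ys, so it is the same in all three lists; the others are
  ignored.\<close>

lemma op_strict_join:
  assumes f: "f \<in> ops T" and len: "length xs = op_arity f" "length ys = op_arity f" "length zs = op_arity f"
    and nz: "op_fun T f xs \<noteq> Zero" "op_fun T f ys \<noteq> Zero"
    and eq: "\<And>l. l < op_arity f \<Longrightarrow> xs ! l \<noteq> Zero \<Longrightarrow> ys ! l \<noteq> Zero \<Longrightarrow> xs ! l = ys ! l \<and> zs ! l = xs ! l"
  shows "op_fun T f ys = op_fun T f xs \<and> op_fun T f zs = op_fun T f xs"
proof -
  have a: "xs ! l = ys ! l \<and> zs ! l = xs ! l"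
    if "l < op_arity f" "\<not> (f = JOp \<and> l = 2 \<or> f = S1Op \<and> l = 0 \<or> f = S2Op \<and> (l = 0 \<or> l = 1))" for l
    using op_nonzero_args[OF f len(1) nz(1) that(1)] op_nonzero_args[OF f len(2) nz(2) that(1)]
      eq[OF that(1)] that(2) by blast
  consider "f = JOp" | "f = S1Op" | "f = S2Op" | "f \<noteq> JOp" "f \<noteq> S1Op" "f \<noteq> S2Op" by auto
  then show ?thesis
  proof cases
    case 1
    have b0: "xs ! 0 = ys ! 0 \<and> zs ! 0 = xs ! 0" by (rule a) (simp_all add: 1)
    have b1: "xs ! 1 = ys ! 1 \<and> zs ! 1 = xs ! 1" by (rule a) (simp_all add: 1)
    have args: "ys ! 0 = xs ! 0" "ys ! 1 = xs ! 1" "zs ! 0 = xs ! 0" "zs ! 1 = xs ! 1"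
      by (simp_all only: b0 b1)
    show ?thesis
    proof (cases "J' T (xs ! 0) (xs ! 1) Zero = Zero")
      case True
      then have "xs ! 2 \<noteq> Zero" "ys ! 2 \<noteq> Zero" using nz args 1 by auto
      then show ?thesis using eq[of 2] args 1 by auto
    next
      case False
      then have "J' T (xs ! 0) (xs ! 1) z = xs ! 0" for z
        using J'_const[OF False, of z] J'_nonzero[OF False] by auto
      then show ?thesis using args 1 by simp
    qed
  next
    case 2
    have b1: "xs ! 1 = ys ! 1 \<and> zs ! 1 = xs ! 1" by (rule a) (simp_all add: 2)
    have b2: "xs ! 2 = ys ! 2 \<and> zs ! 2 = xs ! 2" by (rule a) (simp_all add: 2)
    have b3: "xs ! 3 = ys ! 3 \<and> zs ! 3 = xs ! 3" by (rule a) (simp_all add: 2)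
    have args: "ys ! 1 = xs ! 1" "ys ! 2 = xs ! 2" "ys ! 3 = xs ! 3"
        "zs ! 1 = xs ! 1" "zs ! 2 = xs ! 2" "zs ! 3 = xs ! 3"
      by (simp_all only: b1 b2 b3)
    show ?thesis
    proof (cases "xs ! 1 \<in> Pset \<and> xs ! 2 \<in> Pset \<and> xs ! 3 \<in> Pset")
      case False
      have *: "u \<noteq> Zero" if "Sone T u x y z \<noteq> Zero" "\<not> (x \<in> Pset \<and> y \<in> Pset \<and> z \<in> Pset)" for u x y z
        using Sone_nonzero[OF that(1)] that(2) by auto
      have "xs ! 0 \<noteq> Zero" "ys ! 0 \<noteq> Zero"
        using *[OF _ False, of "xs ! 0"] *[OF _ False, of "ys ! 0"] nz args 2 by simp_all
      then show ?thesis using eq[of 0] args 2 by auto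
    qed (use args 2 Sone_Pset in auto)
  next
    case 3
    have b2: "xs ! 2 = ys ! 2 \<and> zs ! 2 = xs ! 2" by (rule a) (simp_all add: 3)
    have b3: "xs ! 3 = ys ! 3 \<and> zs ! 3 = xs ! 3" by (rule a) (simp_all add: 3)
    have b4: "xs ! 4 = ys ! 4 \<and> zs ! 4 = xs ! 4" by (rule a) (simp_all add: 3)
    have args: "ys ! 2 = xs ! 2" "ys ! 3 = xs ! 3" "ys ! 4 = xs ! 4"
        "zs ! 2 = xs ! 2" "zs ! 3 = xs ! 3" "zs ! 4 = xs ! 4"
      by (simp_all only: b2 b3 b4)
    show ?thesis
    proof (cases "xs ! 2 \<in> Pset \<and> xs ! 3 \<in> Pset \<and> xs ! 4 \<in> Pset")
      case False
      have *: "u \<noteq> Zero \<and> v \<noteq> Zero"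
        if "Stwo T u v x y z \<noteq> Zero" "\<not> (x \<in> Pset \<and> y \<in> Pset \<and> z \<in> Pset)" for u v x y z
        using Stwo_nonzero[OF that(1)] that(2) by auto
      have "xs ! 0 \<noteq> Zero \<and> xs ! 1 \<noteq> Zero" "ys ! 0 \<noteq> Zero \<and> ys ! 1 \<noteq> Zero"
        using *[OF _ False, of "xs ! 0" "xs ! 1"] *[OF _ False, of "ys ! 0" "ys ! 1"] nz args 3
        by simp_all
      then show ?thesis using eq[of 0] eq[of 1] args 3 by simp
    qed (use args 3 Stwo_Pset in auto)
  next
    case 4
    then have "xs = ys" "zs = ys" using a len by (auto intro!: nth_equalityI)
    then show ?thesis by simp
  qed
qed

text \<open>Invariant of the two values of a unary polynomial at one coordinate: the generators c
  and b differ only inside P, and no operation turns such a difference into two distinct elements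
  outside \<open>PZ\<close>.\<close>

definition NP :: "elt \<Rightarrow> elt \<Rightarrow> bool" where
  "NP u v \<longleftrightarrow> u = v \<or> u \<in> PZ \<or> v \<in> PZ"

lemma op_NP:
  assumes f: "f \<in> ops T" and len: "length xs = op_arity f" "length ys = op_arity f"
    and eq: "\<And>l. l < op_arity f \<Longrightarrow> NP (xs ! l) (ys ! l)"
  shows "NP (op_fun T f xs) (op_fun T f ys)"
proof (rule ccontr)
  assume "\<not> ?thesis"
  then have nz: "op_fun T f xs \<notin> PZ" "op_fun T f ys \<notin> PZ" and ne: "op_fun T f xs \<noteq> op_fun T f ys"
    by (auto simp: NP_def)
  have a: "xs ! l = ys ! l" if "l < op_arity f" "\<not> (f = JOp \<and> l = 2)" for l
    using op_nonP_args[OF f nz(1) that(1)] op_nonP_args[OF f nz(2) that(1)]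
      eq[OF that(1)] that(2) by (auto simp: NP_def)
  show False
  proof (cases "f = JOp")
    case True
    then have "op_fun T f xs \<noteq> Zero" "op_fun T f ys \<noteq> Zero" using nz by auto
    moreover have "J' T x y z = x" if "J' T x y z \<noteq> Zero" "J' T x y z \<notin> PZ" for x y z
      using J'_nonzero[OF that(1)] that(2) by (auto simp: PZ_def wedge_eq split: if_splits)
    ultimately have "op_fun T f xs = xs ! 0" "op_fun T f ys = ys ! 0"
      using True nz by auto
    then show ?thesis using a[of 0] ne True by simp
  next
    case False
    then have "xs = ys" using a len by (auto intro!: nth_equalityI)
    then show ?thesis using ne by simp
  qed
qed

section \<open>Translations on one coordinate\<close>

text \<open>What a strict translation in an admissible position does at one coordinate, in a form
  closed under composition. The meet clause is one half of meet preservation on P, monotonicity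
  being the other. By the last clause, P is mapped into P or sent to \<open>Zero\<close> as a
  whole.\<close>

definition tame :: "(elt \<Rightarrow> elt) \<Rightarrow> bool" where
  "tame g \<longleftrightarrow> g Zero = Zero \<and> (\<forall>x y. ble x y \<longrightarrow> ble (g x) (g y)) \<and>
    (\<forall>x. g x \<in> Pset \<longrightarrow> x \<in> Pset) \<and> (\<forall>x. g x \<notin> PZ \<longrightarrow> x \<notin> PZ) \<and>
    (\<forall>x\<in>Pset. \<forall>y\<in>Pset. ble (wedge (g x) (g y)) (g (wedge x y))) \<and>
    ((\<exists>p\<in>Pset. g p \<in> Pset) \<longrightarrow> (\<forall>p\<in>Pset. g p \<in> Pset))"

lemma tameD:
  assumes "tame g"
  shows tame_0: "g Zero = Zero"
    and tame_mono: "\<And>x y. ble x y \<Longrightarrow> ble (g x) (g y)"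
    and tame_P: "\<And>x. g x \<in> Pset \<Longrightarrow> x \<in> Pset"
    and tame_nP: "\<And>x. g x \<notin> PZ \<Longrightarrow> x \<notin> PZ"
    and tame_meet: "\<And>x y. x \<in> Pset \<Longrightarrow> y \<in> Pset \<Longrightarrow> ble (wedge (g x) (g y)) (g (wedge x y))"
    and tame_PP: "\<And>p p'. p \<in> Pset \<Longrightarrow> g p \<in> Pset \<Longrightarrow> p' \<in> Pset \<Longrightarrow> g p' \<in> Pset"
  using assms unfolding tame_def by blast+

lemma tameI:
  assumes "g Zero = Zero" "\<And>x y. ble x y \<Longrightarrow> ble (g x) (g y)" "\<And>x. g x \<in> Pset \<Longrightarrow> x \<in> Pset"
    "\<And>x. g x \<notin> PZ \<Longrightarrow> x \<notin> PZ"
    "\<And>x y. x \<in> Pset \<Longrightarrow> y \<in> Pset \<Longrightarrow> ble (wedge (g x) (g y)) (g (wedge x y))"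
    "\<And>p p'. p \<in> Pset \<Longrightarrow> g p \<in> Pset \<Longrightarrow> p' \<in> Pset \<Longrightarrow> g p' \<in> Pset"
  shows "tame g"
  using assms unfolding tame_def by blast

lemma tame_id: "tame (\<lambda>x. x)"
  by (rule tameI) auto

lemma PZ_cases: "x \<in> PZ \<Longrightarrow> x = Zero \<or> x \<in> Pset"
  by (auto simp: PZ_def)

lemma Pset_PZ: "x \<in> Pset \<Longrightarrow> x \<in> PZ"
  by (auto simp: PZ_def)

lemma tame_comp:
  assumes g: "tame g" and h: "tame h"
  shows "tame (\<lambda>x. h (g x))"
proof (rule tameI)
  fix x y :: elt assume xy: "x \<in> Pset" "y \<in> Pset"
  have PZ: "g x \<in> PZ" "g y \<in> PZ" using tame_nP[OF g] xy Pset_PZ by blast+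
  show "ble (wedge (h (g x)) (h (g y))) (h (g (wedge x y)))"
  proof (cases "g x = Zero \<or> g y = Zero")
    case True
    then show ?thesis using tame_0[OF h] by auto
  next
    case False
    then have "g x \<in> Pset" "g y \<in> Pset" using PZ PZ_cases by blast+
    then have "ble (wedge (h (g x)) (h (g y))) (h (wedge (g x) (g y)))" by (rule tame_meet[OF h])
    moreover have "ble (h (wedge (g x) (g y))) (h (g (wedge x y)))"
      by (rule tame_mono[OF h tame_meet[OF g xy]])
    ultimately show ?thesis by (rule ble_trans)
  qed
next
  show "h (g Zero) = Zero" using tame_0[OF g] tame_0[OF h] by simp
  show "ble x y \<Longrightarrow> ble (h (g x)) (h (g y))" for x y using tame_mono[OF h] tame_mono[OF g] by blast
  show "h (g x) \<in> Pset \<Longrightarrow> x \<in> Pset" for x using tame_P[OF h] tame_P[OF g] by blast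
  show "h (g x) \<notin> PZ \<Longrightarrow> x \<notin> PZ" for x using tame_nP[OF h] tame_nP[OF g] by blast
  show "h (g p') \<in> Pset" if "p \<in> Pset" "h (g p) \<in> Pset" "p' \<in> Pset" for p p'
    using tame_PP[OF g] tame_PP[OF h] tame_P[OF h] that by meson
qed

lemma ble_cases: "ble x y \<Longrightarrow> x = Zero \<or> x = y \<or> x = P2 \<and> y \<in> {P0, P1}"
  by (simp add: ble_def)

text \<open>Covers the translations that fix P pointwise or annihilate it, as the machine operations
  do. Those that move elements inside P fall under \<open>tame_total\<close>.\<close>

lemma tame_flat:
  assumes "g Zero = Zero" "(\<forall>p\<in>Pset. g p = p) \<or> (\<forall>p\<in>Pset. g p = Zero)"
    "\<And>x. x \<notin> PZ \<Longrightarrow> g x \<notin> Pset"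
  shows "tame g"
proof (rule tameI)
  show "ble (g x) (g y)" if "ble x y" for x y
    using ble_cases[OF that]
  proof (elim disjE)
    assume *: "x = P2 \<and> y \<in> {P0, P1}"
    then have "x \<in> Pset" "y \<in> Pset" by auto
    then have "g x = x \<and> g y = y \<or> g x = Zero" using assms(2) by blast
    then show ?thesis using that by auto
  qed (use assms(1) in auto)
  show "ble (wedge (g x) (g y)) (g (wedge x y))" if "x \<in> Pset" "y \<in> Pset" for x y
    using assms(2)
  proof
    assume *: "\<forall>p\<in>Pset. g p = p"
    have "wedge x y \<in> Pset" using that by (simp add: wedge_eq)
    then show ?thesis using * that by simp
  qed (use that in auto)
  show "g x \<in> Pset \<Longrightarrow> x \<in> Pset" for x
    using assms(1,3) PZ_cases[of x] by (cases "x \<in> PZ") auto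
  show "g x \<notin> PZ \<Longrightarrow> x \<notin> PZ" for x
    using assms(1,2) PZ_cases[of x] PZ_simps(1) Pset_PZ by metis
  show "g p' \<in> Pset" if "p \<in> Pset" "g p \<in> Pset" "p' \<in> Pset" for p p'
    using assms(2) that Pset_simps(4) by metis
qed (rule assms(1))

lemma tame_total:
  assumes "g Zero = Zero" "\<And>x. x \<in> Pset \<Longrightarrow> g x \<in> Pset" "\<And>x. x \<notin> PZ \<Longrightarrow> g x \<notin> Pset"
    "ble (g P2) (g P0)" "ble (g P2) (g P1)" "ble (wedge (g P0) (g P1)) (g P2)"
  shows "tame g"
proof (rule tameI)
  show "ble (g x) (g y)" if "ble x y" for x y
    using ble_cases[OF that] assms(1,4,5) by auto
  show "ble (wedge (g x) (g y)) (g (wedge x y))" if "x \<in> Pset" "y \<in> Pset" for x y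
  proof -
    have w: "wedge (g P1) (g P0) = wedge (g P0) (g P1)" by (rule wedge_commute)
    have "x = y \<or> x = P2 \<and> wedge x y = x \<or> y = P2 \<and> wedge x y = y \<or>
        x = P0 \<and> y = P1 \<and> wedge x y = P2 \<or> x = P1 \<and> y = P0 \<and> wedge x y = P2"
      using that by (auto simp: Pset_def wedge_eq)
    then show ?thesis
      using assms(6) w wedge_le[of "g x" "g y"] by (elim disjE conjE) simp_all
  qed
  show "g x \<in> Pset \<Longrightarrow> x \<in> Pset" for x
    using assms(1,3) PZ_cases[of x] by (cases "x \<in> PZ") auto
  show "g x \<notin> PZ \<Longrightarrow> x \<notin> PZ" for x
    using assms(1,2) PZ_cases[of x] PZ_simps(1) Pset_PZ by metis
qed (use assms in auto)

lemma tame_wedge: "tame (\<lambda>x. if x \<in> Pset then wedge x s else Zero)" if "s \<in> Pset"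
  using that by (intro tame_total) (auto simp: wedge_eq Pset_def ble_def)

lemma tame_wedge2: "tame (\<lambda>x. wedge x s)"
proof (cases "s \<in> Pset")
  case True
  then have "(\<lambda>x. wedge x s) = (\<lambda>x. if x \<in> Pset then wedge x s else Zero)"
    by (auto simp: wedge_eq fun_eq_iff)
  then show ?thesis using tame_wedge[OF True] by simp
next
  case False
  then show ?thesis by (intro tame_flat) (auto simp: wedge_eq PZ_def)
qed

lemma tame_T0: "tame T0"
  by (rule tame_total) (auto simp: T0_def Pset_def PZ_def V0_def ble_def wedge_eq)

lemma T1_commute: "T1 x y = T1 y x"
  by (auto simp: T1_def insert_commute)

text \<open>In one variable T1 preserves meets like everything else. Only jointly is it a join:
  \<open>T1 P0 P1\<close> and \<open>T1 P1 P0\<close> are both \<open>P1\<close>, while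
  \<open>T1 P1 P1\<close> is the smaller \<open>P2\<close>.\<close>

lemma tame_T1: "tame (\<lambda>x. T1 x s)"
proof (cases "s \<in> Pset")
  case True
  then have "(\<lambda>x. T1 x s) = (\<lambda>x. if x \<in> Pset then if x = P0 \<or> s = P0 then P1 else P2 else Zero)"
    using V10_VB VB_not_Pset by (auto simp: T1_eq T1_outside fun_eq_iff)
  moreover have "tame (\<lambda>x. if x \<in> Pset then if x = P0 \<or> s = P0 then P1 else P2 else Zero)"
    by (rule tame_total) (auto simp: PZ_def wedge_eq ble_def)
  ultimately show ?thesis by simp
next
  case False
  then show ?thesis using V10_VB VB_not_Pset
    by (intro tame_flat) (auto simp: T1_outside PZ_def)
qed

lemma tame_J': "tame (\<lambda>x. J' T x y z)"
proof (cases "y \<in> Pset \<and> z \<in> Pset")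
  case True
  then have "(\<lambda>x. J' T x y z) = (\<lambda>x. if x \<in> Pset then wedge x z else Zero)"
    by (cases y) (auto simp: J'_def fun_eq_iff VVbar_eq)
  then show ?thesis using tame_wedge True by simp
next
  case False
  have "J' T x y z \<noteq> Zero \<Longrightarrow> x \<notin> PZ \<and> J' T x y z = x" for x
    using J'_nonzero[of T x y z] False by blast
  then have "J' T x y z = Zero \<or> x \<notin> PZ \<and> J' T x y z = x" for x by blast
  then show ?thesis
    by (intro tame_flat) (metis PZ_simps(1), metis PZ_def insertCI, metis PZ_def insertCI Pset_simps(4))
qed

text \<open>The hypothesis excludes an opposite pair a, b, for which the third argument would be
  ignored.\<close>

lemma J'_third_form:
  assumes "J' T a b Zero = Zero"
  shows "(\<lambda>x. J' T a b x) = (\<lambda>x. Zero) \<or> (\<lambda>x. J' T a b x) = (\<lambda>x. wedge x a)"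
  using assms by (auto simp: J'_def wedge_commute fun_eq_iff VVbar_eq split: if_splits)

lemma tame_Zero: "tame (\<lambda>x. Zero)"
  by (rule tame_flat) auto

lemma mop_P:
  assumes "F \<in> Mset T" "p \<in> Pset"
  shows "mop_fun T F x y p = (if x = One \<and> y = One then p else Zero)"
  using mop_Pset[OF assms] mop_nonzero[OF assms(1) refl, of x y p] assms(2) VB_not_Pset[of p]
  by (auto simp del: mop_fun.simps)

lemma mop_notP:
  assumes "F \<in> Mset T" "u \<notin> PZ"
  shows "mop_fun T F x y u \<notin> Pset"
  using mop_nonzero[OF assms(1) refl, of x y u] assms(2) VB_not_Pset Pset_PZ Pset_simps(4) by metis

lemma mop_Zero:
  assumes "F \<in> Mset T"
  shows "mop_fun T F x y Zero = Zero"
  using mop_nonzero[OF assms refl, of x y Zero] by (auto simp del: mop_fun.simps)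

lemma Uone_P:
  assumes "F \<in> Mset T" "p \<in> Pset"
  shows "Uone T F x y z p = (if x = One \<and> y = One \<and> z = One then p else Zero)"
proof (cases "x = One \<and> y = One \<and> z = One")
  case True
  then show ?thesis using assms by (simp add: Uone_def prec_One mop_Pset del: mop_fun.simps)
next
  case False
  then show ?thesis using Uone_nonzero[OF assms(1), of x y z p] assms(2) VB_not_Pset[of p] by auto
qed

lemma Utwo_P:
  assumes "F \<in> Mset T" "p \<in> Pset"
  shows "Utwo T F x y z p = (if x = One \<and> y = One \<and> z = One then p else Zero)"
proof (cases "x = One \<and> y = One \<and> z = One")
  case True
  then show ?thesis using assms by (simp add: Utwo_def prec_One mop_Pset del: mop_fun.simps)
next
  case False
  then show ?thesis using Utwo_nonzero[OF assms(1), of x y z p] assms(2) VB_not_Pset[of p] by auto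
qed

lemma Uone_notP:
  assumes "F \<in> Mset T" "u \<notin> PZ"
  shows "Uone T F x y z u \<notin> Pset"
  using Uone_nonzero[OF assms(1), of x y z u] assms(2) VB_not_Pset Pset_PZ Pset_simps(4) by metis

lemma Utwo_notP:
  assumes "F \<in> Mset T" "u \<notin> PZ"
  shows "Utwo T F x y z u \<notin> Pset"
  using Utwo_nonzero[OF assms(1), of x y z u] assms(2) VB_not_Pset Pset_PZ Pset_simps(4) by metis

lemma Uone_Zero: "F \<in> Mset T \<Longrightarrow> Uone T F x y z Zero = Zero"
  and Utwo_Zero: "F \<in> Mset T \<Longrightarrow> Utwo T F x y z Zero = Zero"
  using Uone_args[of F T x y z Zero] Utwo_args[of F T x y z Zero] by auto

text \<open>The positions through which a separating path can run. The missing ones either turn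
  every difference into a drop to \<open>Zero\<close> (\<open>bad_pos\<close>) or belong to S1 and
  S2, which are excluded by the complement they would produce.\<close>

fun ok_pos :: "opsym \<Rightarrow> nat \<Rightarrow> bool" where
  "ok_pos WedgeOp j = True"
| "ok_pos T0Op j = True"
| "ok_pos T1Op j = True"
| "ok_pos JOp j = (j \<noteq> 1)"
| "ok_pos (MOp F) j = (j = 2)"
| "ok_pos (U1Op F) j = (j = 3)"
| "ok_pos (U2Op F) j = (j = 3)"
| "ok_pos f j = False"

lemma ok_step_cases:
  assumes f: "f \<in> ops T" and len: "length xs = op_arity f" and j: "j < op_arity f" and ok: "ok_pos f j"
    and strict: "op_fun T f (xs[j := Zero]) = Zero"
  obtains s where "f = WedgeOp" "(\<lambda>x. op_fun T f (xs[j := x])) = (\<lambda>x. wedge x s)"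
  | "f = T0Op" "(\<lambda>x. op_fun T f (xs[j := x])) = T0"
  | s where "f = T1Op" "(\<lambda>x. op_fun T f (xs[j := x])) = (\<lambda>x. T1 x s)"
  | "f = JOp" "j = 0" "(\<lambda>x. op_fun T f (xs[j := x])) = (\<lambda>x. J' T x (xs ! 1) (xs ! 2))"
  | "f = JOp" "j = 2" "(\<lambda>x. op_fun T f (xs[j := x])) = (\<lambda>x. Zero) \<or>
       (\<lambda>x. op_fun T f (xs[j := x])) = (\<lambda>x. wedge x (xs ! 0))"
  | F where "f = MOp F" "j = 2" "F \<in> Mset T"
      "(\<lambda>x. op_fun T f (xs[j := x])) = (\<lambda>x. mop_fun T F (xs ! 0) (xs ! 1) x)"
  | F where "f = U1Op F" "j = 3" "F \<in> Mset T"
      "(\<lambda>x. op_fun T f (xs[j := x])) = (\<lambda>x. Uone T F (xs ! 0) (xs ! 1) (xs ! 2) x)"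
  | F where "f = U2Op F" "j = 3" "F \<in> Mset T"
      "(\<lambda>x. op_fun T f (xs[j := x])) = (\<lambda>x. Utwo T F (xs ! 0) (xs ! 1) (xs ! 2) x)"
proof (cases f)
  case WedgeOp
  then have "j = 0 \<or> j = 1" using j by auto
  then have "(\<lambda>x. op_fun T f (xs[j := x])) = (\<lambda>x. wedge x (xs ! (1 - j)))"
    using WedgeOp len by (auto simp: wedge_commute)
  then show ?thesis using that WedgeOp by blast
next
  case T1Op
  then have "j = 0 \<or> j = 1" using j by auto
  then have "(\<lambda>x. op_fun T f (xs[j := x])) = (\<lambda>x. T1 x (xs ! (1 - j)))"
    using T1Op len by (auto simp: T1_commute)
  then show ?thesis using that T1Op by blast
next
  case JOp
  then have "j = 0 \<or> j = 2" using j ok by auto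
  then show ?thesis
  proof
    assume "j = 0" then show ?thesis using that(4) JOp len by auto
  next
    assume j: "j = 2"
    show ?thesis using that(5)[OF JOp j] J'_third_form[of T "xs ! 0" "xs ! 1"] JOp len j strict by simp
  qed
next
  case T0Op
  then show ?thesis using that(2) j len by (simp add: fun_eq_iff)
next
  case (MOp F)
  then show ?thesis using that(6)[of F] ok len f by (simp add: fun_eq_iff del: mop_fun.simps)
next
  case (U1Op F)
  then show ?thesis using that(7)[of F] ok len f by (simp add: fun_eq_iff)
next
  case (U2Op F)
  then show ?thesis using that(8)[of F] ok len f by (simp add: fun_eq_iff)
qed (use ok in auto)

lemma tame_step:
  assumes f: "f \<in> ops T" and len: "length xs = op_arity f" and j: "j < op_arity f" and ok: "ok_pos f j"
    and strict: "op_fun T f (xs[j := Zero]) = Zero"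
  shows "tame (\<lambda>x. op_fun T f (xs[j := x]))"
  using assms
proof (cases rule: ok_step_cases)
  case (6 F)
  show ?thesis unfolding 6(4)
    by (rule tame_flat) (use 6(3) in \<open>simp_all add: mop_P mop_notP mop_Zero del: mop_fun.simps\<close>)
next
  case (7 F)
  show ?thesis unfolding 7(4)
    by (rule tame_flat) (use 7(3) in \<open>simp_all add: Uone_P Uone_notP Uone_Zero\<close>)
next
  case (8 F)
  show ?thesis unfolding 8(4)
    by (rule tame_flat) (use 8(3) in \<open>simp_all add: Utwo_P Utwo_notP Utwo_Zero\<close>)
next
  case 5
  then show ?thesis using tame_wedge2 tame_Zero by metis
qed (simp_all add: tame_wedge2 tame_T0 tame_T1 tame_J')

text \<open>On the part of the tape where the true value lies in \<open>{P0, P1}\<close> and the false value is \<open>P2\<close>,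
  only \<open>T1\<close> (from \<open>P0\<close> to \<open>P1\<close>) and \<open>T0\<close> (back) change the true value.\<close>

lemma toggle_step:
  assumes f: "f \<in> ops T" and len: "length xs = op_arity f" and j: "j < op_arity f" and ok: "ok_pos f j"
    and strict: "op_fun T f (xs[j := Zero]) = Zero"
    and g: "\<And>x. g x = op_fun T f (xs[j := x])"
    and p: "p \<in> {P0, P1}" "g p \<in> Pset" "g p \<noteq> g P2"
  shows "g P2 = P2 \<and> (f = T1Op \<and> p = P0 \<and> g p = P1 \<or> f = T0Op \<and> p = P1 \<and> g p = P0 \<or>
    f \<noteq> T0Op \<and> f \<noteq> T1Op \<and> g p = p)"
proof -
  have g: "(\<lambda>x. op_fun T f (xs[j := x])) = g" using g by auto
  have w: "wedge P2 s = P2 \<and> wedge p s = p"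
    if "wedge p s \<in> Pset" "wedge p s \<noteq> wedge P2 s" for s
    using that p(1) by (auto simp: wedge_eq split: if_splits)
  have pP: "p \<in> Pset" using p(1) by auto
  show ?thesis
    using f len j ok strict
  proof (cases rule: ok_step_cases)
    case (1 s)
    then show ?thesis using w[of s] p unfolding g by auto
  next
    case 2
    then show ?thesis using p unfolding g by (auto simp: T0_def)
  next
    case (3 s)
    have gT: "g x = T1 x s" for x using 3(2) unfolding g by metis
    have "s \<in> Pset"
    proof (rule ccontr)
      assume "s \<notin> Pset"
      then have "T1 p s = Zero" using pP by (auto simp: T1_outside)
      then show False using p(2) gT by simp
    qed
    then show ?thesis using 3(1) p pP by (auto simp: T1_eq gT split: if_splits)
  next
    case 4
    have *: "J' T p a b = wedge p b \<and> J' T P2 a b = wedge P2 b" if "J' T p a b \<in> Pset" for a b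
    proof -
      have "J' T p a b \<noteq> Zero" using that by auto
      then have "a \<in> Pset" "J' T p a b = wedge p b" using J'_nonzero[of T p a b] pP Pset_PZ by blast+
      then show ?thesis by (simp add: J'_def)
    qed
    have gJ: "g x = J' T x (xs ! 1) (xs ! 2)" for x using 4(3) unfolding g by metis
    have "g p = wedge p (xs ! 2) \<and> g P2 = wedge P2 (xs ! 2)" using * p(2) unfolding gJ by blast
    then show ?thesis using 4(1) w[of "xs ! 2"] p(2,3) by simp
  next
    case 5
    then have "g = (\<lambda>x. Zero) \<or> g = (\<lambda>x. wedge x (xs ! 0))" unfolding g by simp
    then show ?thesis using 5(1) w[of "xs ! 0"] p by auto
  next
    case (6 F)
    then have gx: "g x = mop_fun T F (xs ! 0) (xs ! 1) x" for x unfolding g by metis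
    show ?thesis using 6(1,3) p pP by (auto simp: gx mop_P split: if_splits simp del: mop_fun.simps)
  next
    case (7 F)
    then have gx: "g x = Uone T F (xs ! 0) (xs ! 1) (xs ! 2) x" for x unfolding g by metis
    show ?thesis using 7(1,3) p pP by (auto simp: gx Uone_P split: if_splits)
  next
    case (8 F)
    then have gx: "g x = Utwo T F (xs ! 0) (xs ! 1) (xs ! 2) x" for x unfolding g by metis
    show ?thesis using 8(1,3) p pP by (auto simp: gx Utwo_P split: if_splits)
  qed
qed

section \<open>Polynomial values\<close>

text \<open>Polynomials evaluated along a family of arguments indexed by 'v. The index type is
  \<open>bool\<close> for polynomials at c and b, pairs of booleans for joins, the elements
  themselves for unary polynomials, and lists for n-ary ones.\<close>

inductive_set gen_by :: "('f, 'a) ualg \<Rightarrow> ('v \<Rightarrow> 'a) set \<Rightarrow> ('v \<Rightarrow> 'a) set"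
  for A :: "('f, 'a) ualg" and G :: "('v \<Rightarrow> 'a) set" where
  const: "c \<in> univ A \<Longrightarrow> (\<lambda>_. c) \<in> gen_by A G"
| gen: "g \<in> G \<Longrightarrow> g \<in> gen_by A G"
| op: "f \<in> syms A \<Longrightarrow> length gs = arity A f \<Longrightarrow> \<forall>g\<in>set gs. g \<in> gen_by A G \<Longrightarrow>
    (\<lambda>v. oper A f (map (\<lambda>g. g v) gs)) \<in> gen_by A G"

lemma gen_by_subst:
  assumes "t \<in> gen_by A G" and G: "\<And>g. g \<in> G \<Longrightarrow> (\<lambda>v. g (\<phi> v)) \<in> gen_by A G'"
  shows "(\<lambda>v. t (\<phi> v)) \<in> gen_by A G'"
  using assms(1)
proof induction
  case (op f gs)
  have "(\<lambda>v. oper A f (map (\<lambda>g. g v) (map (\<lambda>g v. g (\<phi> v)) gs))) \<in> gen_by A G'"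
    using op by (intro gen_by.op) auto
  then show ?case by (simp add: comp_def)
qed (auto intro: gen_by.const G)

lemma gen_by_closed:
  assumes "t \<in> gen_by A G" and A: "is_algebra A" and G: "\<And>g. g \<in> G \<Longrightarrow> g v \<in> univ A"
  shows "t v \<in> univ A"
  using assms(1)
proof induction
  case (op f gs)
  then have "map (\<lambda>g. g v) gs \<in> tuples (arity A f) (univ A)" by (auto simp: tuples_def)
  then show ?case using A op(1) by (simp add: is_algebra_def)
qed (use G in auto)

lemma gen_by_rel:
  assumes "t \<in> gen_by A G" and c: "\<And>c. c \<in> univ A \<Longrightarrow> P c c" and G: "\<And>g. g \<in> G \<Longrightarrow> P (g v) (g w)"
    and o: "\<And>f xs ys. f \<in> syms A \<Longrightarrow> length xs = arity A f \<Longrightarrow> list_all2 P xs ys \<Longrightarrow>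
      P (oper A f xs) (oper A f ys)"
  shows "P (t v) (t w)"
  using assms(1)
proof induction
  case (op f gs)
  then show ?case by (intro o) (auto simp: list_all2_conv_all_nth)
qed (use c G in auto)

lemma gen_by_upd:
  assumes "f \<in> syms A" "length xs = arity A f" "set xs \<subseteq> univ A" "w \<in> gen_by A G"
  shows "(\<lambda>v. oper A f (xs[j := w v])) \<in> gen_by A G"
proof -
  have "(\<lambda>v. oper A f (map (\<lambda>g. g v) ((map (\<lambda>x _. x) xs)[j := w]))) \<in> gen_by A G"
    using assms set_update_subset_insert[of "map (\<lambda>x _. x) xs" j w] gen_by.const[of _ A G]
    by (intro gen_by.op) auto
  then show ?thesis by (simp add: map_update comp_def)
qed

text \<open>Z is a maximal set on which \<open>Pr\<close> fails: it contains neither X nor Y, and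
  any further element makes \<open>Pr\<close> true. This singles out two elementary changes, each
  sufficient alone.\<close>

lemma critical_pair:
  fixes Pr :: "'a set \<Rightarrow> bool"
  assumes fin: "finite X" "finite Y" and mono: "\<And>Z z. Z \<subseteq> X \<union> Y \<Longrightarrow> z \<in> X \<union> Y \<Longrightarrow> Pr Z \<Longrightarrow> Pr (insert z Z)"
    and e: "\<not> Pr {}" and XY: "Pr X" "Pr Y"
  shows "\<exists>Z x y. Z \<subseteq> X \<union> Y \<and> x \<in> X - Z \<and> y \<in> Y - Z \<and> \<not> Pr Z \<and> Pr (insert x Z) \<and> Pr (insert y Z)"
proof -
  have mono': "Pr Z'" if "Z \<subseteq> Z'" "Z' \<subseteq> X \<union> Y" "Pr Z" for Z Z'
  proof -
    have "finite (Z' - Z)" using that fin by (meson finite_Diff finite_UnI finite_subset)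
    moreover have "Pr (Z \<union> W)" if "finite W" "W \<subseteq> Z' - Z" for W
      using that
    proof (induction W)
      case (insert w W)
      have "Pr (insert w (Z \<union> W))"
        by (rule mono) (use insert \<open>Z' \<subseteq> X \<union> Y\<close> \<open>Z \<subseteq> Z'\<close> in auto)
      then show ?case by simp
    qed (use \<open>Pr Z\<close> in simp)
    ultimately have "Pr (Z \<union> (Z' - Z))" by blast
    then show ?thesis using that(1) by (simp add: Un_absorb1)
  qed
  define \<Z> where "\<Z> = {Z. Z \<subseteq> X \<union> Y \<and> \<not> Pr Z}"
  have "finite \<Z>" "\<Z> \<noteq> {}" using fin e by (auto simp: \<Z>_def)
  from finite_has_maximal[OF this] obtain Z where "Z \<in> \<Z>" and max: "\<forall>Z'\<in>\<Z>. Z \<subseteq> Z' \<longrightarrow> Z = Z'"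
    by (elim bexE)
  then have Z: "Z \<subseteq> X \<union> Y" "\<not> Pr Z" by (simp_all add: \<Z>_def)
  obtain x where x: "x \<in> X - Z" using mono'[of X Z] Z XY by blast
  obtain y where y: "y \<in> Y - Z" using mono'[of Y Z] Z XY by blast
  have "Pr (insert z Z)" if "z \<in> X \<union> Y - Z" for z
  proof (rule ccontr)
    assume "\<not> Pr (insert z Z)"
    then have "insert z Z \<in> \<Z>" using that Z(1) by (auto simp: \<Z>_def)
    then have "Z = insert z Z" using max by blast
    then show False using that by blast
  qed
  then show ?thesis using x y Z by blast
qed

section \<open>The coordinatewise analysis\<close>

text \<open>A basic translation: the symbol, its arguments, and the position of the hole; the list
  entry at the hole is a dummy that gets overwritten.\<close>

type_synonym 'i vstep = "opsym \<times> ('i \<Rightarrow> elt) list \<times> nat"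

text \<open>What is left of a type 4 quotient once congruences are forgotten. Truth is lying above
  b, and F consists of the false vectors. \<open>mono\<close> excludes complements,
  \<open>join\<close> comes from the lattice, \<open>below\<close> returns false values of a
  polynomial to F, and \<open>F_equiv\<close> reflects that F lies in one class of the lower
  congruence.\<close>

locale core =
  fixes T :: turing and I :: "'i set" and S :: "('i \<Rightarrow> elt) set" and b :: "'i \<Rightarrow> elt"
    and F :: "('i \<Rightarrow> elt) set"
  assumes finI: "finite I"
    and S: "subuniverse (power_alg (BT T) I) S"
    and bS: "b \<in> S"
    and F_ne: "F \<noteq> {}"
    and F_S: "F \<subseteq> S"
    and F_le: "c \<in> F \<Longrightarrow> i \<in> I \<Longrightarrow> ble (c i) (b i)"
    and F_not: "c \<in> F \<Longrightarrow> \<exists>i\<in>I. \<not> ble (b i) (c i)"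
    and mono: "c \<in> F \<Longrightarrow> t \<in> gen_by (subalgebra (power_alg (BT T) I) S) {\<lambda>v. if v then b else c} \<Longrightarrow>
      \<forall>i\<in>I. ble (b i) (t False i) \<Longrightarrow> \<forall>i\<in>I. ble (b i) (t True i)"
    and join: "c \<in> F \<Longrightarrow> \<exists>q\<in>gen_by (subalgebra (power_alg (BT T) I) S)
        {\<lambda>(x, y). if x then b else c, \<lambda>(x, y). if y then b else c}.
        q (False, False) \<in> F \<and> q (False, True) = b \<and> q (True, False) = b"
    and below: "c \<in> F \<Longrightarrow> t \<in> gen_by (subalgebra (power_alg (BT T) I) S) {\<lambda>v. if v then b else c} \<Longrightarrow>
      \<forall>i\<in>I. ble (b i) (t True i) \<Longrightarrow> \<not> (\<forall>i\<in>I. ble (b i) (t False i)) \<Longrightarrow>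
      (\<lambda>i\<in>I. wedge (t False i) (b i)) \<in> F"
    and F_equiv: "c \<in> F \<Longrightarrow> c' \<in> F \<Longrightarrow> u \<in> gen_by (subalgebra (power_alg (BT T) I) S) {\<lambda>x. x} \<Longrightarrow>
      (\<forall>i\<in>I. ble (b i) (u c i)) \<longleftrightarrow> (\<forall>i\<in>I. ble (b i) (u c' i))"
begin

abbreviation "A \<equiv> subalgebra (power_alg (BT T) I) S"

definition vop :: "opsym \<Rightarrow> ('i \<Rightarrow> elt) list \<Rightarrow> 'i \<Rightarrow> elt" where
  "vop f xs = (\<lambda>i\<in>I. op_fun T f (map (\<lambda>x. x i) xs))"

lemma A_simps [simp]: "univ A = S" "syms A = ops T" "arity A = op_arity" "oper A = vop"
  by (auto simp: subalgebra_def power_alg_def BT_def vop_def fun_eq_iff)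

lemma vop_S: "f \<in> ops T \<Longrightarrow> length xs = op_arity f \<Longrightarrow> set xs \<subseteq> S \<Longrightarrow> vop f xs \<in> S"
  using S by (auto simp: subuniverse_def power_alg_def BT_def vop_def tuples_def)

lemma vop_at [simp]: "i \<in> I \<Longrightarrow> vop f xs i = op_fun T f (map (\<lambda>x. x i) xs)"
  by (simp add: vop_def)

lemma S_ext: "s \<in> S \<Longrightarrow> s \<in> I \<rightarrow>\<^sub>E Bset T"
  using S by (auto simp: subuniverse_def power_alg_def BT_def)

lemma S_Bset: "s \<in> S \<Longrightarrow> i \<in> I \<Longrightarrow> s i \<in> Bset T"
  using S_ext by blast

lemma alg: "is_algebra A"
  unfolding is_algebra_def using bS by (auto simp: tuples_def intro: vop_S)

definition tr :: "('i \<Rightarrow> elt) \<Rightarrow> bool" where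
  "tr v \<longleftrightarrow> (\<forall>i\<in>I. ble (b i) (v i))"

definition \<Gamma> :: "('i \<Rightarrow> elt) \<Rightarrow> (bool \<Rightarrow> 'i \<Rightarrow> elt) set" where
  "\<Gamma> c = gen_by A {\<lambda>v. if v then b else c}"

definition \<Gamma>\<^sub>2 :: "('i \<Rightarrow> elt) \<Rightarrow> (bool \<times> bool \<Rightarrow> 'i \<Rightarrow> elt) set" where
  "\<Gamma>\<^sub>2 c = gen_by A {\<lambda>(x, y). if x then b else c, \<lambda>(x, y). if y then b else c}"

lemma gen_by_const_at:
  assumes "t \<in> gen_by A G" "i \<in> I" "\<And>g. g \<in> G \<Longrightarrow> g v i = g w i"
  shows "t v i = t w i"
  using assms(1)
proof (rule gen_by_rel)
  fix f xs ys assume "list_all2 (\<lambda>x y. x i = y i) xs (ys :: ('i \<Rightarrow> elt) list)"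
  then have "map (\<lambda>x. x i) xs = map (\<lambda>x. x i) ys"
    by (auto simp: list_all2_conv_all_nth intro!: nth_equalityI)
  then show "oper A f xs i = oper A f ys i" using assms(2) by simp
qed (use assms in auto)

text \<open>Where c is \<open>Zero\<close>, strictness rules out a proper join: if both one-sided
  values are nonzero, every argument that matters is already present without switching on either
  variable.\<close>

lemma \<Gamma>\<^sub>2_strict:
  assumes q: "q \<in> \<Gamma>\<^sub>2 c" and i: "i \<in> I" and c: "c i = Zero"
    and nz: "q (False, True) i \<noteq> Zero" "q (True, False) i \<noteq> Zero"
  shows "q (False, False) i = q (False, True) i"
proof -
  have "q (False, True) i \<noteq> Zero \<longrightarrow> q (True, False) i \<noteq> Zero \<longrightarrow>
      q (True, False) i = q (False, True) i \<and> q (False, False) i = q (False, True) i"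
    using q unfolding \<Gamma>\<^sub>2_def
  proof induction
    case (op f gs)
    show ?case
    proof (intro impI)
      assume nz: "oper A f (map (\<lambda>g. g (False, True)) gs) i \<noteq> Zero"
        "oper A f (map (\<lambda>g. g (True, False)) gs) i \<noteq> Zero"
      have IH: "(gs ! l) (False, True) i = (gs ! l) (True, False) i \<and>
          (gs ! l) (False, False) i = (gs ! l) (False, True) i"
        if "l < op_arity f" "(gs ! l) (False, True) i \<noteq> Zero" "(gs ! l) (True, False) i \<noteq> Zero" for l
      proof -
        have "gs ! l \<in> set gs" using op(2) that(1) by simp
        then show ?thesis using op(3) that(2,3) by auto
      qed
      have len: "length gs = op_arity f" using op(2) by simp
      have "op_fun T f (map (\<lambda>g. g (True, False) i) gs) = op_fun T f (map (\<lambda>g. g (False, True) i) gs) \<and>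
        op_fun T f (map (\<lambda>g. g (False, False) i) gs) = op_fun T f (map (\<lambda>g. g (False, True) i) gs)"
      proof (rule op_strict_join)
        show "f \<in> ops T" using op(1) by simp
        show "op_fun T f (map (\<lambda>g. g (False, True) i) gs) \<noteq> Zero"
          "op_fun T f (map (\<lambda>g. g (True, False) i) gs) \<noteq> Zero"
          using nz i by (simp_all add: comp_def)
        fix l assume "l < op_arity f"
          "map (\<lambda>g. g (False, True) i) gs ! l \<noteq> Zero" "map (\<lambda>g. g (True, False) i) gs ! l \<noteq> Zero"
        then show "map (\<lambda>g. g (False, True) i) gs ! l = map (\<lambda>g. g (True, False) i) gs ! l \<and>
            map (\<lambda>g. g (False, False) i) gs ! l = map (\<lambda>g. g (False, True) i) gs ! l"
          using IH[of l] len by simp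
      qed (simp_all add: len)
      then show "oper A f (map (\<lambda>g. g (True, False)) gs) i = oper A f (map (\<lambda>g. g (False, True)) gs) i \<and>
        oper A f (map (\<lambda>g. g (False, False)) gs) i = oper A f (map (\<lambda>g. g (False, True)) gs) i"
        using i by (simp add: comp_def)
    qed
  qed (use c in auto)
  then show ?thesis using nz by blast
qed

text \<open>If c had only the values \<open>Zero\<close> and those of b,
  \<open>\<Gamma>\<^sub>2_strict\<close> would make the join polynomial true already at (False,
  False).\<close>

lemma zero_or_b:
  assumes c: "c \<in> F" shows "\<exists>i\<in>I. c i \<noteq> Zero \<and> c i \<noteq> b i"
proof (rule ccontr)
  assume *: "\<not> ?thesis"
  obtain q where q: "q \<in> \<Gamma>\<^sub>2 c" "q (False, False) \<in> F" "q (False, True) = b" "q (True, False) = b"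
    using join[OF c] unfolding \<Gamma>\<^sub>2_def by blast
  have "ble (b i) (q (False, False) i)" if i: "i \<in> I" for i
  proof (cases "c i = b i")
    case True
    have "q (False, False) i = q (False, True) i"
      using q(1) unfolding \<Gamma>\<^sub>2_def by (rule gen_by_const_at) (use i True in auto)
    then show ?thesis using q(3) by simp
  next
    case False
    then have "c i = Zero" "b i \<noteq> Zero" using * i by auto
    then show ?thesis using \<Gamma>\<^sub>2_strict[OF q(1) i] q(3,4) by simp
  qed
  then show False using F_not[OF q(2)] by auto
qed

text \<open>Replacing c by the value of the join polynomial at (c, c) stays in F, keeps the
  coordinates where c equals b, and moves to b those where c is \<open>Zero\<close>. A c that cannot
  be improved has no \<open>Zero\<close> below a nonzero value of b.\<close>

lemma normal_ex:
  "\<exists>c\<in>F. \<forall>i\<in>I. c i = b i \<or> c i = P2 \<and> b i \<in> {P0, P1}"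
proof -
  \<comment> \<open>The weight 2 is the largest, so a coordinate with c = \<open>P2\<close> below b
    cannot increase it whatever becomes of it.\<close>
  define w :: "('i \<Rightarrow> elt) \<Rightarrow> 'i \<Rightarrow> nat" where
    "w c i = (if c i = b i then 0 else if c i = Zero then 1 else 2)" for c i
  define pot where "pot c = (\<Sum>i\<in>I. w c i)" for c
  obtain c where c: "c \<in> F" and min: "\<And>d. d \<in> F \<Longrightarrow> pot c \<le> pot d"
    using exists_least_iff[of "\<lambda>n. \<exists>c\<in>F. pot c = n"] F_ne
    by (metis (mono_tags, lifting) all_not_in_conv not_le)
  obtain q where q: "q \<in> \<Gamma>\<^sub>2 c" "q (False, False) \<in> F" "q (False, True) = b" "q (True, False) = b"
    using join[OF c] unfolding \<Gamma>\<^sub>2_def by blast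
  let ?d = "q (False, False)"
  have d1: "?d i = b i" if "i \<in> I" "c i = b i" for i
  proof -
    have "q (False, False) i = q (False, True) i"
      using q(1) unfolding \<Gamma>\<^sub>2_def by (rule gen_by_const_at) (use that in auto)
    then show ?thesis using q(3) by simp
  qed
  have d2: "?d i = b i" if "i \<in> I" "c i = Zero" for i
    using that \<Gamma>\<^sub>2_strict[OF q(1) that] q(3,4) d1 by (cases "b i = Zero") auto
  have le: "w ?d i \<le> w c i" if "i \<in> I" for i
    using d1[OF that] d2[OF that] by (auto simp: w_def)
  have "c i = b i \<or> c i = P2 \<and> b i \<in> {P0, P1}" if i: "i \<in> I" for i
  proof (rule ccontr)
    assume *: "\<not> ?thesis"
    then have "c i = Zero" using F_le[OF c i] by (auto simp: ble_def)
    then have "w ?d i < w c i" using d2[OF i] * by (auto simp: w_def)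
    then have "pot ?d < pot c" unfolding pot_def using le i finI by (intro sum_strict_mono_ex1) auto
    then show False using min[OF q(2)] by simp
  qed
  then show ?thesis using c by blast
qed

end

text \<open>In a control position of a machine operation, U1 or U2, two nonzero values need two
  elements of U, which \<open>NP\<close> makes equal. For J' and the operations
  \<open>wedge_i\<close> the nonzero value does not depend on the argument in question.\<close>

lemma bad_pos:
  assumes f: "f \<in> ops T" and len: "length xs = op_arity f" and j: "j < op_arity f" and bad: "\<not> ok_pos f j"
    and notS: "f \<noteq> S1Op" "f \<noteq> S2Op" and NP: "NP x0 x1" and nz: "op_fun T f (xs[j := x1]) \<noteq> Zero"
  shows "op_fun T f (xs[j := x0]) \<in> {Zero, op_fun T f (xs[j := x1])}"
proof (cases "f = JOp \<or> (\<exists>i. f = WedgeIOp i)")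
  case False
  have U: "x1 \<in> Uset \<and> (op_fun T f (xs[j := x0]) \<noteq> Zero \<longrightarrow> x0 \<in> Uset)"
  proof (cases f)
    case (MOp G)
    then have "j = 0 \<or> j = 1" "G \<in> Mset T" using j bad f by auto
    then show ?thesis using MOp len nz
        mop_nonzero[OF _ refl, of G T "xs[j := x1] ! 0" "xs[j := x1] ! 1" "xs ! 2"]
        mop_nonzero[OF _ refl, of G T "xs[j := x0] ! 0" "xs[j := x0] ! 1" "xs ! 2"] prec_Uset
      by (simp del: mop_fun.simps) (elim disjE; simp del: mop_fun.simps; blast)
  next
    case (U1Op G)
    then have "j = 0 \<or> j = 1 \<or> j = 2" "G \<in> Mset T" using j bad f by auto
    then show ?thesis using U1Op len nz
        Uone_nonzero[of G T "xs[j := x1] ! 0" "xs[j := x1] ! 1" "xs[j := x1] ! 2" "xs ! 3"]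
        Uone_nonzero[of G T "xs[j := x0] ! 0" "xs[j := x0] ! 1" "xs[j := x0] ! 2" "xs ! 3"] prec_Uset
      by simp (elim disjE; simp; blast)
  next
    case (U2Op G)
    then have "j = 0 \<or> j = 1 \<or> j = 2" "G \<in> Mset T" using j bad f by auto
    then show ?thesis using U2Op len nz
        Utwo_nonzero[of G T "xs[j := x1] ! 0" "xs[j := x1] ! 1" "xs[j := x1] ! 2" "xs ! 3"]
        Utwo_nonzero[of G T "xs[j := x0] ! 0" "xs[j := x0] ! 1" "xs[j := x0] ! 2" "xs ! 3"] prec_Uset
      by simp (elim disjE; simp; blast)
  qed (use False bad notS j in auto)
  show ?thesis
  proof (cases "op_fun T f (xs[j := x0]) = Zero")
    case False
    then have "x0 \<in> Uset" "x1 \<in> Uset" using U by auto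
    then have "x0 \<notin> PZ" "x1 \<notin> PZ" using UV_notPZ by blast+
    then show ?thesis using NP by (simp add: NP_def)
  qed simp
next
  case True
  then show ?thesis
  proof
    assume fJ: "f = JOp"
    then have j1: "j = 1" using bad by simp
    have "J' T x y z = J' T x y' z" if "J' T x y z \<noteq> Zero" "J' T x y' z \<noteq> Zero" for x y y' z
      using J'_nonzero[OF that(1)] J'_nonzero[OF that(2)] Pset_PZ by metis
    then show ?thesis using nz fJ j1 len by auto
  next
    assume "\<exists>i. f = WedgeIOp i"
    then obtain i where fi: "f = WedgeIOp i" ..
    then have "j = 0 \<or> j = 1" using j by auto
    then show ?thesis using nz fi len by (auto simp: wedge_i_def split: if_splits)
  qed
qed

locale core_n = core T I S b F for T and I :: "'i set" and S b F +
  fixes c :: "'i \<Rightarrow> elt"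
  assumes cF: "c \<in> F" and cn: "i \<in> I \<Longrightarrow> c i = b i \<or> c i = P2 \<and> b i \<in> {P0, P1}"
begin

abbreviation "Gam \<equiv> \<Gamma> c"

lemma cS: "c \<in> S" using cF F_S by blast

lemma Gam_const: "s \<in> S \<Longrightarrow> (\<lambda>_. s) \<in> Gam"
  unfolding \<Gamma>_def by (rule gen_by.const) simp

lemma Gam_gen: "(\<lambda>v. if v then b else c) \<in> Gam"
  unfolding \<Gamma>_def by (rule gen_by.gen) simp

lemma Gam_op: "f \<in> ops T \<Longrightarrow> length gs = op_arity f \<Longrightarrow> set gs \<subseteq> Gam \<Longrightarrow>
    (\<lambda>v. vop f (map (\<lambda>g. g v) gs)) \<in> Gam"
  unfolding \<Gamma>_def using gen_by.op[of f A gs] by auto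

lemma Gam_S: "w \<in> Gam \<Longrightarrow> w v \<in> S"
  unfolding \<Gamma>_def
  using gen_by_closed[OF _ alg, of w "{\<lambda>v. if v then b else c}" v] bS cS by (cases v) auto

lemma gen_upd:
  "f \<in> ops T \<Longrightarrow> length xs = op_arity f \<Longrightarrow> set xs \<subseteq> S \<Longrightarrow> w \<in> gen_by A G \<Longrightarrow>
    (\<lambda>v. vop f (xs[j := w v])) \<in> gen_by A G"
  using gen_by_upd[of f A xs w G j] by simp

lemma Gam_upd:
  "f \<in> ops T \<Longrightarrow> length xs = op_arity f \<Longrightarrow> set xs \<subseteq> S \<Longrightarrow> w \<in> Gam \<Longrightarrow> (\<lambda>v. vop f (xs[j := w v])) \<in> Gam"
  unfolding \<Gamma>_def by (rule gen_upd)

lemma Gam_mono: "w \<in> Gam \<Longrightarrow> tr (w False) \<Longrightarrow> tr (w True)"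
  using mono[OF cF] unfolding \<Gamma>_def tr_def by blast

lemma Gam_const_at: "w \<in> Gam \<Longrightarrow> i \<in> I \<Longrightarrow> c i = b i \<Longrightarrow> w v i = w v' i"
  unfolding \<Gamma>_def by (rule gen_by_const_at) auto

lemma Gam_NP:
  assumes w: "w \<in> Gam" and i: "i \<in> I"
  shows "NP (w v i) (w v' i)"
  using w unfolding \<Gamma>_def
proof (rule gen_by_rel[where P = "\<lambda>x y. NP (x i) (y i)"])
  fix f xs ys assume f: "f \<in> syms A" "length xs = arity A f"
    and l: "list_all2 (\<lambda>x y. NP (x i) (y i)) xs ys"
  show "NP (oper A f xs i) (oper A f ys i)"
    using f l i by (simp, intro op_NP) (auto simp: list_all2_conv_all_nth)
qed (use cn[OF i] in \<open>auto simp: NP_def\<close>)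

section \<open>Paths of basic translations and their live coordinates\<close>

definition wf_step :: "'i vstep \<Rightarrow> bool" where
  "wf_step st \<longleftrightarrow> (case st of (f, xs, j) \<Rightarrow> f \<in> ops T \<and> length xs = op_arity f \<and> set xs \<subseteq> S \<and> j < op_arity f)"

text \<open>Every step and path exists in two forms, at a single coordinate and on vectors
  (\<open>vap\<close>, \<open>vrun\<close>); \<open>vrun_at\<close> relates them on I.\<close>

definition ap :: "'i \<Rightarrow> 'i vstep \<Rightarrow> elt \<Rightarrow> elt" where
  "ap i st x = (case st of (f, xs, j) \<Rightarrow> op_fun T f ((map (\<lambda>s. s i) xs)[j := x]))"

definition vap :: "'i vstep \<Rightarrow> ('i \<Rightarrow> elt) \<Rightarrow> 'i \<Rightarrow> elt" where
  "vap st v = (case st of (f, xs, j) \<Rightarrow> vop f (xs[j := v]))"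

fun run :: "'i \<Rightarrow> 'i vstep list \<Rightarrow> elt \<Rightarrow> elt" where
  "run i [] x = x"
| "run i (st # \<sigma>) x = run i \<sigma> (ap i st x)"

fun vrun :: "'i vstep list \<Rightarrow> ('i \<Rightarrow> elt) \<Rightarrow> 'i \<Rightarrow> elt" where
  "vrun [] v = v"
| "vrun (st # \<sigma>) v = vrun \<sigma> (vap st v)"

lemma run_append: "run i (\<sigma> @ \<tau>) x = run i \<tau> (run i \<sigma> x)"
  by (induction \<sigma> arbitrary: x) auto

lemma vrun_append: "vrun (\<sigma> @ \<tau>) x = vrun \<tau> (vrun \<sigma> x)"
  by (induction \<sigma> arbitrary: x) auto

abbreviation wf :: "'i vstep list \<Rightarrow> bool" where
  "wf \<sigma> \<equiv> \<forall>st\<in>set \<sigma>. wf_step st"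

lemma vap_at: "i \<in> I \<Longrightarrow> vap st v i = ap i st (v i)"
  by (cases st) (simp add: vap_def ap_def map_update)

lemma vrun_at: "i \<in> I \<Longrightarrow> vrun \<sigma> v i = run i \<sigma> (v i)"
  by (induction \<sigma> arbitrary: v) (auto simp: vap_at)

lemma gen_vap: "wf_step st \<Longrightarrow> w \<in> gen_by A G \<Longrightarrow> (\<lambda>v. vap st (w v)) \<in> gen_by A G"
  by (cases st) (auto simp: wf_step_def vap_def intro: gen_upd)

lemma gen_vrun: "wf \<sigma> \<Longrightarrow> w \<in> gen_by A G \<Longrightarrow> (\<lambda>v. vrun \<sigma> (w v)) \<in> gen_by A G"
  by (induction \<sigma> arbitrary: w) (auto simp: gen_vap)

lemma Gam_vap: "wf_step st \<Longrightarrow> w \<in> Gam \<Longrightarrow> (\<lambda>v. vap st (w v)) \<in> Gam"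
  unfolding \<Gamma>_def by (rule gen_vap)

lemma Gam_vrun: "wf \<sigma> \<Longrightarrow> w \<in> Gam \<Longrightarrow> (\<lambda>v. vrun \<sigma> (w v)) \<in> Gam"
  unfolding \<Gamma>_def by (rule gen_vrun)

lemma ap_const: "wf_step st \<Longrightarrow> ap i st Zero \<noteq> Zero \<Longrightarrow> ap i st x = ap i st Zero"
  by (cases st) (auto simp: wf_step_def ap_def intro: op_const)

lemma run_const: "wf \<sigma> \<Longrightarrow> run i \<sigma> Zero \<noteq> Zero \<Longrightarrow> run i \<sigma> x = run i \<sigma> Zero"
proof (induction \<sigma> arbitrary: x)
  case (Cons st \<sigma>)
  show ?case
  proof (cases "ap i st Zero = Zero")
    case True
    then have "run i \<sigma> Zero \<noteq> Zero" "wf \<sigma>" using Cons.prems by auto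
    then show ?thesis using Cons.IH True by simp
  next
    case False
    have "ap i st x = ap i st Zero" by (rule ap_const) (use False Cons.prems in auto)
    then show ?thesis by simp
  qed
qed simp

lemma run_live:
  assumes "wf (st # \<sigma>)" "run i (st # \<sigma>) Zero = Zero" "run i (st # \<sigma>) x \<noteq> Zero"
  shows "ap i st Zero = Zero \<and> run i \<sigma> Zero = Zero"
proof -
  have "ap i st Zero = Zero"
  proof (rule ccontr)
    assume *: "ap i st Zero \<noteq> Zero"
    have "ap i st x = ap i st Zero" by (rule ap_const) (use * assms in auto)
    then show False using assms by simp
  qed
  then show ?thesis using assms by simp
qed

text \<open>The live coordinates of a path. At any other coordinate the path is constant by
  \<open>run_const\<close>, or truth is automatic because b is \<open>Zero\<close> there.\<close>

definition Q :: "'i vstep list \<Rightarrow> 'i set" where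
  "Q \<sigma> = {i \<in> I. b i \<noteq> Zero \<and> run i \<sigma> Zero = Zero}"

lemma Q_I: "i \<in> Q \<sigma> \<Longrightarrow> i \<in> I" by (simp add: Q_def)

lemma tr_run: "tr (vrun \<sigma> v) \<Longrightarrow> i \<in> I \<Longrightarrow> ble (b i) (run i \<sigma> (v i))"
  by (auto simp: tr_def vrun_at)

lemma tr_Q: "tr (vrun \<sigma> v) \<Longrightarrow> i \<in> Q \<sigma> \<Longrightarrow> run i \<sigma> (v i) \<noteq> Zero"
  using tr_run[of \<sigma> v i] by (auto simp: Q_def)

text \<open>The vector w only certifies the coordinates that are not live, where the path cannot
  distinguish it from v.\<close>

lemma trI_Q:
  assumes "wf \<sigma>" "tr (vrun \<sigma> w)" "\<And>i. i \<in> Q \<sigma> \<Longrightarrow> ble (b i) (run i \<sigma> (v i))"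
  shows "tr (vrun \<sigma> v)"
  unfolding tr_def
proof
  fix i assume i: "i \<in> I"
  show "ble (b i) (vrun \<sigma> v i)"
  proof (cases "i \<in> Q \<sigma> \<or> b i = Zero")
    case True
    then show ?thesis using assms(3) i by (auto simp: vrun_at)
  next
    case False
    then have nz: "run i \<sigma> Zero \<noteq> Zero" using i by (auto simp: Q_def)
    have "run i \<sigma> (v i) = run i \<sigma> (w i)"
      using run_const[OF assms(1) nz, of "v i"] run_const[OF assms(1) nz, of "w i"] by simp
    then show ?thesis using tr_run[OF assms(2) i] i by (simp add: vrun_at)
  qed
qed

text \<open>Otherwise the false value met with b would belong to F by \<open>below\<close>, yet have
  only the values \<open>Zero\<close> and those of b, against \<open>zero_or_b\<close>.\<close>

lemma zero_lemma:
  assumes w: "w \<in> Gam" and \<sigma>: "wf \<sigma>" and t: "tr (vrun \<sigma> (w True))"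
    and z: "\<And>i. i \<in> Q \<sigma> \<Longrightarrow> w False i = Zero \<or> w False i = w True i"
  shows "tr (vrun \<sigma> (w False))"
proof (rule ccontr)
  assume nt: "\<not> ?thesis"
  define d where "d = (\<lambda>i\<in>I. wedge (vrun \<sigma> (w False) i) (b i))"
  have d: "d \<in> F"
    unfolding d_def using below[OF cF, of "\<lambda>v. vrun \<sigma> (w v)"] Gam_vrun[OF \<sigma> w] t nt
    unfolding \<Gamma>_def tr_def by blast
  obtain i where i: "i \<in> I" "d i \<noteq> Zero" "d i \<noteq> b i" using zero_or_b[OF d] by blast
  show False
  proof (cases "i \<in> Q \<sigma>")
    case True
    then have "run i \<sigma> Zero = Zero" by (simp add: Q_def)
    moreover have "wedge (run i \<sigma> (w True i)) (b i) = b i"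
      using tr_run[OF t i(1)] by (simp add: ble_iff_wedge wedge_commute)
    ultimately show False using i z[OF True] by (auto simp: d_def vrun_at)
  next
    case False
    then have "b i \<noteq> Zero" "run i \<sigma> Zero \<noteq> Zero" using i by (auto simp: Q_def d_def)
    then have "run i \<sigma> (w False i) = run i \<sigma> (w True i)"
      using run_const[OF \<sigma>, of i "w False i"] run_const[OF \<sigma>, of i "w True i"] by simp
    then show False using tr_run[OF t i(1)] i by (simp add: d_def vrun_at ble_iff_wedge wedge_commute)
  qed
qed

text \<open>A discriminator-like polynomial on the live coordinates would yield a complement.\<close>

lemma no_discriminator:
  fixes s :: "('i \<Rightarrow> elt) \<Rightarrow> ('i \<Rightarrow> elt) \<Rightarrow> ('i \<Rightarrow> elt) \<Rightarrow> 'i \<Rightarrow> elt"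
  assumes w: "w \<in> Gam" and \<sigma>: "wf \<sigma>" and t: "tr (vrun \<sigma> (w True))"
    and s_gen: "\<And>p q r. p \<in> Gam \<Longrightarrow> q \<in> Gam \<Longrightarrow> r \<in> Gam \<Longrightarrow> (\<lambda>v. s (p v) (q v) (r v)) \<in> Gam"
    and s_at: "\<And>i x y z. i \<in> I \<Longrightarrow> s x y z i =
      (if P i \<and> x i = y i \<and> y i = z i \<and> x i \<in> Uset \<union> VVbar T then x i
       else if x i \<in> Pset \<and> y i \<in> Pset \<and> z i \<in> Pset then tt (x i) (y i) (z i) else Zero)"
    and P: "\<And>i. i \<in> Q \<sigma> \<Longrightarrow> w True i \<in> Uset \<union> VVbar T \<Longrightarrow> P i"
  shows "tr (vrun \<sigma> (w False))"
proof -
  note UVP = UV_not[of _ T]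
  have nz: "w True i \<noteq> Zero" if "i \<in> Q \<sigma>" for i
    using tr_Q[OF t that] that by (auto simp: Q_def)
  have cases: "w True i \<in> Pset \<or> w True i \<in> Uset \<union> VVbar T" if "i \<in> Q \<sigma>" for i
    using Bset_cases[OF S_Bset[OF Gam_S[OF w] Q_I[OF that]], of True] nz[OF that] by blast
  \<comment> \<open>Tests agreement with the true value: on the live coordinates the result is the
    true value if both values agree or both lie in P, and \<open>Zero\<close> if not. By
    \<open>zero_lemma\<close> the second case does not occur for \<open>w False\<close>.\<close>
  define w1 where "w1 v = s (w True) (w v) (w v)" for v
  have w1: "w1 \<in> Gam" unfolding w1_def by (intro s_gen w Gam_const Gam_S)
  have w1_at: "w1 v i = (if w v i = w True i then w True i else if w True i \<in> Pset \<and> w v i \<in> Pset then w True i else Zero)"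
    if "i \<in> Q \<sigma>" for i v
    using cases[OF that]
  proof
    assume "w True i \<in> Pset"
    moreover from this have "w True i \<notin> Uset \<union> VVbar T" using UVP by blast
    ultimately show ?thesis unfolding w1_def s_at[OF Q_I[OF that]] by (simp add: tt_def)
  next
    assume u: "w True i \<in> Uset \<union> VVbar T"
    then have "w True i \<notin> Pset" "P i" using UVP P[OF that] by blast+
    then show ?thesis using u unfolding w1_def s_at[OF Q_I[OF that]] by simp
  qed
  have t1: "tr (vrun \<sigma> (w1 True))"
  proof (rule trI_Q[OF \<sigma> t])
    fix i assume i: "i \<in> Q \<sigma>"
    show "ble (b i) (run i \<sigma> (w1 True i))"
      using tr_run[OF t Q_I[OF i]] w1_at[OF i, of True] by simp
  qed
  have t1': "tr (vrun \<sigma> (w1 False))"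
  proof (rule zero_lemma[OF w1 \<sigma> t1])
    fix i assume i: "i \<in> Q \<sigma>"
    show "w1 False i = Zero \<or> w1 False i = w1 True i"
      using w1_at[OF i, of True] w1_at[OF i, of False] by presburger
  qed
  have eq: "w False i = w True i \<or> w False i \<in> Pset \<and> w True i \<in> Pset" if i: "i \<in> Q \<sigma>" for i
  proof (rule ccontr)
    assume "\<not> ?thesis"
    then have "w1 False i = Zero" using w1_at[OF i, of False] by presburger
    then show False using tr_Q[OF t1' i] i by (simp add: Q_def)
  qed
  \<comment> \<open>The complement: on the live coordinates w2 exchanges the two values of w,
    because the discriminator-like term returns its third argument where the first two
    agree.\<close>
  define w2 where "w2 v = s (w False) (w v) (w True)" for v
  have w2: "w2 \<in> Gam" unfolding w2_def by (intro s_gen w Gam_const Gam_S)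
  have w2_at: "w2 False i = w True i \<and> w2 True i = w False i" if "i \<in> Q \<sigma>" for i
    using cases[OF that]
  proof
    assume p: "w True i \<in> Pset"
    then have "w True i \<notin> Uset \<union> VVbar T" using UVP by blast
    moreover have "w False i \<in> Pset" using p eq[OF that] by auto
    moreover from this have "w False i \<notin> Uset \<union> VVbar T" using UVP by blast
    ultimately show ?thesis using p unfolding w2_def s_at[OF Q_I[OF that]] by (simp add: tt_def)
  next
    assume u: "w True i \<in> Uset \<union> VVbar T"
    then have "w True i \<notin> Pset" "P i" using UVP P[OF that] by blast+
    then show ?thesis using u eq[OF that] unfolding w2_def s_at[OF Q_I[OF that]] by simp
  qed
  have "tr (vrun \<sigma> (w2 False))"
  proof (rule trI_Q[OF \<sigma> t])
    fix i assume i: "i \<in> Q \<sigma>"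
    show "ble (b i) (run i \<sigma> (w2 False i))"
      using tr_run[OF t Q_I[OF i]] w2_at[OF i] by simp
  qed
  then have t2: "tr (vrun \<sigma> (w2 True))" using Gam_mono[OF Gam_vrun[OF \<sigma> w2]] by simp
  show ?thesis
  proof (rule trI_Q[OF \<sigma> t])
    fix i assume i: "i \<in> Q \<sigma>"
    show "ble (b i) (run i \<sigma> (w False i))"
      using tr_run[OF t2 Q_I[OF i]] w2_at[OF i] by simp
  qed
qed

lemma Sone_eq: "Sone T u x y z =
    (if u \<in> {One, Two} \<and> x = y \<and> y = z \<and> x \<in> Uset \<union> VVbar T then x
     else if x \<in> Pset \<and> y \<in> Pset \<and> z \<in> Pset then tt x y z else Zero)"
  by (simp only: Sone_def insert_subset empty_subsetI simp_thms)

lemma Stwo_eq: "Stwo T u v x y z =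
    (if (u = bar v \<and> u \<in> VVbar T) \<and> x = y \<and> y = z \<and> x \<in> Uset \<union> VVbar T then x
     else if x \<in> Pset \<and> y \<in> Pset \<and> z \<in> Pset then tt x y z else Zero)"
  by (simp only: Stwo_def insert_subset empty_subsetI simp_thms conj_assoc)

lemma no_S1:
  assumes w: "w \<in> Gam" and \<sigma>: "wf \<sigma>" and t: "tr (vrun \<sigma> (w True))" and u: "u \<in> S"
    and P: "\<And>i. i \<in> Q \<sigma> \<Longrightarrow> w True i \<in> Uset \<union> VVbar T \<Longrightarrow> u i \<in> {One, Two}"
  shows "tr (vrun \<sigma> (w False))"
proof (rule no_discriminator[OF w \<sigma> t, where s = "\<lambda>x y z. vop S1Op [u, x, y, z]" and P = "\<lambda>i. u i \<in> {One, Two}"])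
  fix p q r assume "p \<in> Gam" "q \<in> Gam" "r \<in> Gam"
  then show "(\<lambda>v. vop S1Op [u, p v, q v, r v]) \<in> Gam"
    using Gam_op[of S1Op "[\<lambda>_. u, p, q, r]"] Gam_const[OF u] by simp
next
  show "u i \<in> {One, Two}" if "i \<in> Q \<sigma>" "w True i \<in> Uset \<union> VVbar T" for i
    using P that by blast
next
  fix i x y z assume "i \<in> I"
  then have "vop S1Op [u, x, y, z] i = Sone T (u i) (x i) (y i) (z i)" by simp
  then show "vop S1Op [u, x, y, z] i =
      (if u i \<in> {One, Two} \<and> x i = y i \<and> y i = z i \<and> x i \<in> Uset \<union> VVbar T then x i
       else if x i \<in> Pset \<and> y i \<in> Pset \<and> z i \<in> Pset then tt (x i) (y i) (z i) else Zero)"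
    by (simp only: Sone_eq)
qed

lemma no_S2:
  assumes w: "w \<in> Gam" and \<sigma>: "wf \<sigma>" and t: "tr (vrun \<sigma> (w True))" and u: "u \<in> S" "u' \<in> S"
    and P: "\<And>i. i \<in> Q \<sigma> \<Longrightarrow> w True i \<in> Uset \<union> VVbar T \<Longrightarrow> u i = bar (u' i) \<and> u i \<in> VVbar T"
  shows "tr (vrun \<sigma> (w False))"
proof (rule no_discriminator[OF w \<sigma> t, where s = "\<lambda>x y z. vop S2Op [u, u', x, y, z]"
        and P = "\<lambda>i. u i = bar (u' i) \<and> u i \<in> VVbar T"])
  fix p q r assume "p \<in> Gam" "q \<in> Gam" "r \<in> Gam"
  then show "(\<lambda>v. vop S2Op [u, u', p v, q v, r v]) \<in> Gam"
    using Gam_op[of S2Op "[\<lambda>_. u, \<lambda>_. u', p, q, r]"] Gam_const[OF u(1)] Gam_const[OF u(2)] by simp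
next
  show "u i = bar (u' i) \<and> u i \<in> VVbar T" if "i \<in> Q \<sigma>" "w True i \<in> Uset \<union> VVbar T" for i
    using P that by blast
next
  fix i x y z assume "i \<in> I"
  then have "vop S2Op [u, u', x, y, z] i = Stwo T (u i) (u' i) (x i) (y i) (z i)" by simp
  then show "vop S2Op [u, u', x, y, z] i =
      (if (u i = bar (u' i) \<and> u i \<in> VVbar T) \<and> x i = y i \<and> y i = z i \<and> x i \<in> Uset \<union> VVbar T then x i
       else if x i \<in> Pset \<and> y i \<in> Pset \<and> z i \<in> Pset then tt (x i) (y i) (z i) else Zero)"
    by (simp only: Stwo_eq)
qed

end

section \<open>Admissible positions along a separating path\<close>

context core_n
begin

text \<open>In an inadmissible position \<open>bad_pos\<close> leads to \<open>zero_lemma\<close>.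
  For S1 and S2 the controls of the step itself serve as the controls of the discriminator-like
  polynomial.\<close>

lemma sep_ok_step:
  assumes w: "w \<in> Gam" and wf: "wf ((f, xs, j) # \<sigma>)"
    and t: "tr (vrun ((f, xs, j) # \<sigma>) (w True))" and nt: "\<not> tr (vrun ((f, xs, j) # \<sigma>) (w False))"
  shows "ok_pos f j"
proof (rule ccontr)
  assume bad: "\<not> ok_pos f j"
  have st: "f \<in> ops T" "length xs = op_arity f" "set xs \<subseteq> S" "j < op_arity f" and \<sigma>: "wf \<sigma>"
    using wf by (auto simp: wf_step_def)
  define w2 where "w2 v = vop f (xs[j := w v])" for v
  have w2: "w2 \<in> Gam" unfolding w2_def by (intro Gam_upd st w)
  have t2: "tr (vrun \<sigma> (w2 True))" and nt2: "\<not> tr (vrun \<sigma> (w2 False))"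
    using t nt by (simp_all add: w2_def vap_def)
  \<comment> \<open>If the hole is itself a control, it is frozen at its true value.\<close>
  define ys where "ys = xs[j := w True]"
  have ys: "set ys \<subseteq> S" "length ys = op_arity f"
    using st set_update_subset_insert[of xs j "w True"] Gam_S[OF w] by (auto simp: ys_def)
  have at: "w2 v i = op_fun T f ((map (\<lambda>s. s i) xs)[j := w v i])" if "i \<in> I" for v i
    using that by (simp add: w2_def map_update)
  have at1: "w2 True i = op_fun T f (map (\<lambda>s. s i) ys)" if "i \<in> I" for i
    using that by (simp add: w2_def ys_def)
  have nz: "w2 True i \<noteq> Zero" if "i \<in> Q \<sigma>" for i
    using tr_Q[OF t2 that] that by (auto simp: Q_def)
  show False
  proof (cases "f = S1Op \<or> f = S2Op")
    case False
    have "tr (vrun \<sigma> (w2 False))"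
    proof (rule zero_lemma[OF w2 \<sigma> t2])
      fix i assume i: "i \<in> Q \<sigma>"
      then have iI: "i \<in> I" by (rule Q_I)
      have "w2 False i \<in> {Zero, w2 True i}"
        unfolding at[OF iI] using st bad False Gam_NP[OF w iI] nz[OF i, unfolded at[OF iI]]
        by (intro bad_pos[of f]) auto
      then show "w2 False i = Zero \<or> w2 False i = w2 True i" by simp
    qed
    then show False using nt2 by blast
  next
    case True
    then show False
    proof
      assume f: "f = S1Op"
      have "tr (vrun \<sigma> (w2 False))"
      proof (rule no_S1[OF w2 \<sigma> t2, of "ys ! 0"])
        show "ys ! 0 \<in> S" using ys f by (auto simp: subset_code(1))
        fix i assume i: "i \<in> Q \<sigma>" "w2 True i \<in> Uset \<union> VVbar T"
        then have iI: "i \<in> I" by (auto intro: Q_I)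
        have "w2 True i = Sone T ((ys ! 0) i) ((ys ! 1) i) ((ys ! 2) i) ((ys ! 3) i)"
          using at1[OF iI] f ys by simp
        then show "(ys ! 0) i \<in> {One, Two}"
          using Sone_nonzero[of T "(ys ! 0) i" "(ys ! 1) i" "(ys ! 2) i" "(ys ! 3) i"] i(2) nz[OF i(1)]
            UV_not[OF i(2)] tt_Pset by metis
      qed
      then show False using nt2 by blast
    next
      assume f: "f = S2Op"
      have "tr (vrun \<sigma> (w2 False))"
      proof (rule no_S2[OF w2 \<sigma> t2, of "ys ! 0" "ys ! 1"])
        show "ys ! 0 \<in> S" "ys ! 1 \<in> S" using ys f by (auto simp: subset_code(1))
        fix i assume i: "i \<in> Q \<sigma>" "w2 True i \<in> Uset \<union> VVbar T"
        then have iI: "i \<in> I" by (auto intro: Q_I)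
        have "w2 True i = Stwo T ((ys ! 0) i) ((ys ! 1) i) ((ys ! 2) i) ((ys ! 3) i) ((ys ! 4) i)"
          using at1[OF iI] f ys by simp
        then show "(ys ! 0) i = bar ((ys ! 1) i) \<and> (ys ! 0) i \<in> VVbar T"
          using Stwo_nonzero[of T "(ys ! 0) i" "(ys ! 1) i" "(ys ! 2) i" "(ys ! 3) i" "(ys ! 4) i"]
            i(2) nz[OF i(1)] UV_not[OF i(2)] tt_Pset by metis
      qed
      then show False using nt2 by blast
    qed
  qed
qed

definition okp :: "'i vstep list \<Rightarrow> bool" where
  "okp \<sigma> \<longleftrightarrow> (\<forall>(f, xs, j)\<in>set \<sigma>. ok_pos f j)"

lemma sep_okp:
  "w \<in> Gam \<Longrightarrow> wf \<sigma> \<Longrightarrow> tr (vrun \<sigma> (w True)) \<Longrightarrow> \<not> tr (vrun \<sigma> (w False)) \<Longrightarrow> okp \<sigma>"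
proof (induction \<sigma> arbitrary: w)
  case (Cons st \<sigma>)
  obtain f xs j where st: "st = (f, xs, j)" by (cases st)
  have "ok_pos f j" using sep_ok_step[of w f xs j \<sigma>] Cons.prems st by blast
  moreover have "okp \<sigma>"
    by (rule Cons.IH[of "\<lambda>v. vap st (w v)"]) (use Cons.prems Gam_vap in auto)
  ultimately show ?case by (auto simp: okp_def st)
qed (simp add: okp_def)

lemma ap_tame: "wf_step (f, xs, j) \<Longrightarrow> ok_pos f j \<Longrightarrow> ap i (f, xs, j) Zero = Zero \<Longrightarrow> tame (ap i (f, xs, j))"
  using tame_step[of f T "map (\<lambda>s. s i) xs" j] by (simp add: ap_def[abs_def] wf_step_def)

lemma run_tame:
  "wf \<sigma> \<Longrightarrow> okp \<sigma> \<Longrightarrow> run i \<sigma> Zero = Zero \<Longrightarrow> run i \<sigma> x \<noteq> Zero \<Longrightarrow> tame (run i \<sigma>)"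
proof (induction \<sigma> arbitrary: x)
  case Nil
  then show ?case using tame_id by simp
next
  case (Cons st \<sigma>)
  obtain f xs j where st: "st = (f, xs, j)" by (cases st)
  have *: "ap i st Zero = Zero \<and> run i \<sigma> Zero = Zero" using run_live Cons.prems by blast
  have "tame (ap i st)" using ap_tame[of f xs j i] Cons.prems * by (auto simp: st okp_def)
  moreover have "tame (run i \<sigma>)"
    using Cons.IH[of "ap i st x"] Cons.prems * by (auto simp: okp_def)
  ultimately show ?case using tame_comp[of "ap i st" "run i \<sigma>"] by simp
qed

lemma bad_coord:
  assumes w: "w \<in> Gam" and \<sigma>: "wf \<sigma>" and t: "tr (vrun \<sigma> (w True))" and nt: "\<not> tr (vrun \<sigma> (w False))"
  obtains i where "i \<in> Q \<sigma>" "\<not> ble (b i) (run i \<sigma> (w False i))"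
  using trI_Q[OF \<sigma> t, of "w False"] nt by blast

text \<open>A coordinate where truth fails is one where c and b differ, so b is \<open>P0\<close> or
  \<open>P1\<close> there. These are maximal, so a true value equals b exactly, and tameness pulls
  it back into P along the path.\<close>

lemma bad_coordD:
  assumes w: "w \<in> Gam" "w' \<in> Gam" and \<sigma>: "wf \<sigma>" and t: "tr (vrun \<sigma> (w True))" and nt: "\<not> tr (vrun \<sigma> (w False))"
    and i: "i \<in> Q \<sigma>" "\<not> ble (b i) (run i \<sigma> (w False i))"
  shows "i \<in> I" "c i = P2" "b i \<in> {P0, P1}" "tame (run i \<sigma>)"
    "run i \<sigma> (w True i) = b i" "w True i \<in> Pset"
proof -
  show iI: "i \<in> I" using i by (rule_tac Q_I)
  have bt: "ble (b i) (run i \<sigma> (w True i))" by (rule tr_run[OF t iI])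
  then have "c i \<noteq> b i" using Gam_const_at[OF w(1) iI, of False True] i(2) by auto
  then show c: "c i = P2" "b i \<in> {P0, P1}" using cn[OF iI] by auto
  show "run i \<sigma> (w True i) = b i" using bt c(2) by (auto simp: ble_def)
  then have "run i \<sigma> (w True i) \<in> Pset" using c(2) by auto
  moreover show ta: "tame (run i \<sigma>)"
    using run_tame[OF \<sigma> sep_okp[OF w(1) \<sigma> t nt]] tr_Q[OF t i(1)] i(1) by (auto simp: Q_def)
  ultimately show "w True i \<in> Pset" using tame_P[OF ta] by blast
qed

section \<open>Locating the join at a single operation\<close>

text \<open>Each argument of an operation gets private copies of the two variables. Z lists the
  copies set to True: (l, False) is the first variable of argument l, (l, True) the second.\<close>

definition args :: "(bool \<times> bool \<Rightarrow> 'i \<Rightarrow> elt) list \<Rightarrow> (nat \<times> bool) set \<Rightarrow> ('i \<Rightarrow> elt) list" where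
  "args gs Z = map (\<lambda>l. (gs ! l) ((l, False) \<in> Z, (l, True) \<in> Z)) [0..<length gs]"

lemma \<Gamma>\<^sub>2_left: "q \<in> \<Gamma>\<^sub>2 c \<Longrightarrow> (\<lambda>v. q (v, y)) \<in> Gam"
  unfolding \<Gamma>\<^sub>2_def \<Gamma>_def
  by (rule gen_by_subst[of q A _ "\<lambda>v. (v, y)"]) (use bS cS in \<open>auto intro: gen_by.gen gen_by.const\<close>)

lemma \<Gamma>\<^sub>2_right: "q \<in> \<Gamma>\<^sub>2 c \<Longrightarrow> (\<lambda>v. q (x, v)) \<in> Gam"
  unfolding \<Gamma>\<^sub>2_def \<Gamma>_def
  by (rule gen_by_subst[of q A _ "\<lambda>v. (x, v)"]) (use bS cS in \<open>auto intro: gen_by.gen gen_by.const\<close>)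

lemma \<Gamma>\<^sub>2_S: "q \<in> \<Gamma>\<^sub>2 c \<Longrightarrow> q v \<in> S"
  using Gam_S[OF \<Gamma>\<^sub>2_left[of q "snd v"], of "fst v"] by simp

lemma args_S:
  assumes "set gs \<subseteq> \<Gamma>\<^sub>2 c"
  shows "set (args gs Z) \<subseteq> S"
proof
  fix x assume "x \<in> set (args gs Z)"
  then obtain l where l: "l < length gs" "x = (gs ! l) ((l, False) \<in> Z, (l, True) \<in> Z)"
    by (auto simp: args_def)
  then have "gs ! l \<in> \<Gamma>\<^sub>2 c" using assms by auto
  then show "x \<in> S" using l(2) \<Gamma>\<^sub>2_S by simp
qed

lemma length_args [simp]: "length (args gs Z) = length gs"
  by (simp add: args_def)

lemma args_insert:
  "j < length gs \<Longrightarrow> args gs (insert (j, False) Z) = (args gs Z)[j := (gs ! j) (True, (j, True) \<in> Z)]"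
  "j < length gs \<Longrightarrow> args gs (insert (j, True) Z) = (args gs Z)[j := (gs ! j) ((j, False) \<in> Z, True)]"
  by (auto simp: args_def nth_list_update intro!: nth_equalityI)

lemma args_same:
  "j < length gs \<Longrightarrow> (args gs Z)[j := (gs ! j) ((j, False) \<in> Z, (j, True) \<in> Z)] = args gs Z"
  by (auto simp: args_def nth_list_update intro!: nth_equalityI)

text \<open>With the copies of the variables made independent, \<open>critical_pair\<close> finds
  two of them that each make the value true. If they sit in the same argument, the join is sought
  inside that argument; otherwise the operation itself acts as a join in two different
  positions.\<close>

lemma join_descent:
  assumes "q \<in> \<Gamma>\<^sub>2 c" "wf \<sigma>" "tr (vrun \<sigma> (q (False, True)))" "tr (vrun \<sigma> (q (True, False)))"
    "\<not> tr (vrun \<sigma> (q (False, False)))"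
  shows "\<exists>\<sigma> f xs j k a a'. wf \<sigma> \<and> f \<in> ops T \<and> length xs = op_arity f \<and> set xs \<subseteq> S \<and>
    j < op_arity f \<and> k < op_arity f \<and> j \<noteq> k \<and> a \<in> Gam \<and> a' \<in> Gam \<and>
    (\<forall>x y. tr (vrun \<sigma> (vop f (xs[j := a x, k := a' y]))) \<longleftrightarrow> x \<or> y)"
  using assms unfolding \<Gamma>\<^sub>2_def
proof (induction arbitrary: \<sigma>)
  case (op f gs)
  let ?n = "op_arity f"
  have f: "f \<in> ops T" and len: "length gs = ?n" and gs: "set gs \<subseteq> \<Gamma>\<^sub>2 c"
    using op unfolding \<Gamma>\<^sub>2_def by auto
  have g: "gs ! l \<in> \<Gamma>\<^sub>2 c" if "l < ?n" for l using gs that len by auto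
  have aS: "set (args gs Z) \<subseteq> S" for Z by (rule args_S[OF gs])
  define Pr where "Pr Z \<longleftrightarrow> tr (vrun \<sigma> (vop f (args gs Z)))" for Z
  \<comment> \<open>Switching on all of X gives the value at (True, False), all of Y the value at
    (False, True).\<close>
  define X where "X = {..<?n} \<times> {False}"
  define Y where "Y = {..<?n} \<times> {True}"
  have aX: "args gs X = map (\<lambda>g. g (True, False)) gs" and aY: "args gs Y = map (\<lambda>g. g (False, True)) gs"
    and a0: "args gs {} = map (\<lambda>g. g (False, False)) gs"
    using len by (auto simp: args_def X_def Y_def intro!: nth_equalityI)
  have gamw: "(\<lambda>v. vrun \<sigma> (vop f ((args gs Z)[j := w v]))) \<in> Gam" if "w \<in> Gam" for w Z j
    using Gam_vrun[OF \<open>wf \<sigma>\<close> Gam_upd[OF f _ aS that]] len by simp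
  have mono: "Pr (insert z Z)" if zXY: "z \<in> X \<union> Y" and PrZ: "Pr Z" for z Z
  proof -
    obtain l e where z: "z = (l, e)" "l < ?n" using zXY by (auto simp: X_def Y_def)
    show ?thesis
    proof (cases "z \<in> Z")
      case True
      then show ?thesis using PrZ by (simp add: insert_absorb)
    next
      case False
      define w where "w = (if e then (\<lambda>v. (gs ! l) ((l, False) \<in> Z, v)) else (\<lambda>v. (gs ! l) (v, (l, True) \<in> Z)))"
      have w: "w \<in> Gam" unfolding w_def using \<Gamma>\<^sub>2_left \<Gamma>\<^sub>2_right g[OF z(2)] by auto
      have 1: "args gs (insert z Z) = (args gs Z)[l := w True]"
        using args_insert[of l gs Z] z len by (auto simp: w_def)
      have 0: "args gs Z = (args gs Z)[l := w False]"
        using args_same[of l gs Z] z len False by (auto simp: w_def)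
      have "tr (vrun \<sigma> (vop f ((args gs Z)[l := w False])))" using PrZ 0 by (simp add: Pr_def)
      then have "tr (vrun \<sigma> (vop f ((args gs Z)[l := w True])))" by (rule Gam_mono[OF gamw[OF w]])
      then show ?thesis unfolding Pr_def 1 .
    qed
  qed
  have "\<exists>Z x y. Z \<subseteq> X \<union> Y \<and> x \<in> X - Z \<and> y \<in> Y - Z \<and> \<not> Pr Z \<and> Pr (insert x Z) \<and> Pr (insert y Z)"
    by (rule critical_pair) (use mono op.prems in \<open>auto simp: X_def Y_def Pr_def aX[unfolded X_def] aY[unfolded Y_def] a0\<close>)
  then obtain Z x y where Z: "x \<in> X - Z" "y \<in> Y - Z" "\<not> Pr Z" "Pr (insert x Z)" "Pr (insert y Z)" by blast
  obtain j k where jk: "x = (j, False)" "j < ?n" "y = (k, True)" "k < ?n" using Z by (auto simp: X_def Y_def)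
  have jZ: "(j, False) \<notin> Z" and kZ: "(k, True) \<notin> Z" using Z jk by auto
  show ?case
  proof (cases "j = k")
    \<comment> \<open>The rest of the operation becomes one more translation in front of the path,
      and the induction continues in argument j.\<close>
    case True
    have 0: "(args gs Z)[j := (gs ! j) (False, False)] = args gs Z"
      using args_same[of j gs Z] jZ kZ True len jk by simp
    have 1: "(args gs Z)[j := (gs ! j) (True, False)] = args gs (insert x Z)"
      using args_insert(1)[of j gs Z] kZ True len jk by simp
    have 2: "(args gs Z)[j := (gs ! j) (False, True)] = args gs (insert y Z)"
      using args_insert(2)[of j gs Z] jZ True len jk by simp
    let ?st = "(f, args gs Z, j)"
    have wf: "wf (?st # \<sigma>)" using op.prems(1) f len aS jk by (simp add: wf_step_def)
    have *: "tr (vrun (?st # \<sigma>) ((gs ! j) (False, True)))" "tr (vrun (?st # \<sigma>) ((gs ! j) (True, False)))"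
      "\<not> tr (vrun (?st # \<sigma>) ((gs ! j) (False, False)))"
      using Z(3-5) 0 1 2 by (simp_all add: vap_def Pr_def)
    have "gs ! j \<in> set gs" using jk len by simp
    with op.IH have "\<forall>\<sigma>. wf \<sigma> \<longrightarrow> tr (vrun \<sigma> ((gs ! j) (False, True))) \<longrightarrow>
        tr (vrun \<sigma> ((gs ! j) (True, False))) \<longrightarrow> \<not> tr (vrun \<sigma> ((gs ! j) (False, False))) \<longrightarrow> ?thesis"
      by blast
    then show ?thesis using wf * by blast
  next
    case False
    define a where "a v = (gs ! j) (v, (j, True) \<in> Z)" for v
    define a' where "a' v = (gs ! k) ((k, False) \<in> Z, v)" for v
    have a: "a \<in> Gam" "a' \<in> Gam" unfolding a_def a'_def using \<Gamma>\<^sub>2_left \<Gamma>\<^sub>2_right g jk by auto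
    have F: "(args gs Z)[j := a False] = args gs Z" "(args gs Z)[k := a' False] = args gs Z"
      using args_same[of j gs Z] args_same[of k gs Z] jZ kZ len jk by (auto simp: a_def a'_def)
    have T: "(args gs Z)[j := a True] = args gs (insert x Z)" "(args gs Z)[k := a' True] = args gs (insert y Z)"
      using args_insert[of j gs Z] args_insert[of k gs Z] len jk by (auto simp: a_def a'_def)
    have "(args gs (insert x Z))[k := a' False] = args gs (insert x Z)"
      using T(1) F(2) False by (metis list_update_swap)
    then have TF: "(args gs Z)[j := a True, k := a' False] = args gs (insert x Z)" using T(1) by simp
    have "(\<lambda>v. vrun \<sigma> (vop f ((args gs (insert x Z))[k := a' v]))) \<in> Gam" by (rule gamw[OF a(2)])
    from Gam_mono[OF this] have TT: "tr (vrun \<sigma> (vop f ((args gs Z)[j := a True, k := a' True])))"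
      using TF T(1) Z(4) by (simp add: Pr_def)
    have "tr (vrun \<sigma> (vop f ((args gs Z)[j := a u, k := a' v]))) \<longleftrightarrow> u \<or> v" for u v
      using TT TF F T Z(3-5) by (cases u; cases v) (simp_all add: Pr_def)
    then show ?thesis
      using op.prems(1) f len aS[of Z] jk False a by (metis length_args)
  qed
qed auto

definition args1 :: "(bool \<Rightarrow> 'i \<Rightarrow> elt) list \<Rightarrow> nat set \<Rightarrow> ('i \<Rightarrow> elt) list" where
  "args1 gs Z = map (\<lambda>l. (gs ! l) (l \<in> Z)) [0..<length gs]"

text \<open>The one-variable counterpart of \<open>join_descent\<close>:
  \<open>critical_pair\<close> with equal sets isolates one argument to follow at every level of the
  polynomial.\<close>

lemma path_descent:
  assumes "w \<in> Gam" "wf \<sigma>" "tr (vrun \<sigma> (w True))" "\<not> tr (vrun \<sigma> (w False))"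
  shows "\<exists>\<sigma>'. wf \<sigma>' \<and> tr (vrun (\<sigma>' @ \<sigma>) b) \<and> \<not> tr (vrun (\<sigma>' @ \<sigma>) c)"
  using assms unfolding \<Gamma>_def
proof (induction arbitrary: \<sigma>)
  case (gen g)
  then show ?case by (intro exI[of _ "[]"]) auto
next
  case (op f gs)
  let ?n = "op_arity f"
  have f: "f \<in> ops T" and len: "length gs = ?n" and gs: "set gs \<subseteq> Gam"
    using op unfolding \<Gamma>_def by auto
  have g: "gs ! l \<in> Gam" if "l < ?n" for l using gs that len by auto
  have aS: "set (args1 gs Z) \<subseteq> S" for Z
  proof
    fix x assume "x \<in> set (args1 gs Z)"
    then obtain l where l: "l < length gs" "x = (gs ! l) (l \<in> Z)" by (auto simp: args1_def)
    then show "x \<in> S" using Gam_S g len by simp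
  qed
  have la: "length (args1 gs Z) = ?n" for Z by (simp add: args1_def len)
  define Pr where "Pr Z \<longleftrightarrow> tr (vrun \<sigma> (vop f (args1 gs Z)))" for Z
  have aX: "args1 gs {..<?n} = map (\<lambda>g. g True) gs" and a0: "args1 gs {} = map (\<lambda>g. g False) gs"
    using len by (auto simp: args1_def intro!: nth_equalityI)
  have T: "(args1 gs Z)[l := (gs ! l) True] = args1 gs (insert l Z)" if "l < ?n" for l Z
    using that len by (auto simp: args1_def nth_list_update intro!: nth_equalityI)
  have F: "(args1 gs Z)[l := (gs ! l) False] = args1 gs Z" if "l < ?n" "l \<notin> Z" for l Z
    using that len by (auto simp: args1_def nth_list_update intro!: nth_equalityI)
  have mono: "Pr (insert l Z)" if "l < ?n" "Pr Z" for l Z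
  proof (cases "l \<in> Z")
    case False
    have "(\<lambda>v. vrun \<sigma> (vop f ((args1 gs Z)[l := (gs ! l) v]))) \<in> Gam"
      using Gam_vrun[OF op.prems(1) Gam_upd[OF f la aS g[OF that(1)]]] .
    from Gam_mono[OF this] show ?thesis using that T F False by (simp add: Pr_def)
  qed (use that in \<open>simp add: insert_absorb\<close>)
  have "\<exists>Z x y. Z \<subseteq> {..<?n} \<union> {..<?n} \<and> x \<in> {..<?n} - Z \<and> y \<in> {..<?n} - Z \<and> \<not> Pr Z \<and>
      Pr (insert x Z) \<and> Pr (insert y Z)"
    by (rule critical_pair) (use mono op.prems in \<open>auto simp: Pr_def aX a0\<close>)
  then obtain Z j where Z: "j < ?n" "j \<notin> Z" "\<not> Pr Z" "Pr (insert j Z)" by auto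
  let ?st = "(f, args1 gs Z, j)"
  have wf: "wf (?st # \<sigma>)" using op.prems(1) f la aS Z by (auto simp: wf_step_def)
  have "gs ! j \<in> set gs" using Z len by simp
  moreover have "tr (vrun (?st # \<sigma>) ((gs ! j) True))" "\<not> tr (vrun (?st # \<sigma>) ((gs ! j) False))"
    using Z T F by (auto simp: vap_def Pr_def)
  ultimately obtain \<sigma>' where "wf \<sigma>'" "tr (vrun (\<sigma>' @ ?st # \<sigma>) b)" "\<not> tr (vrun (\<sigma>' @ ?st # \<sigma>) c)"
    using op.IH wf by blast
  then show ?case using wf by (intro exI[of _ "\<sigma>' @ [?st]"]) auto
qed auto

end

lemma ok_two_pos:
  assumes "f \<in> ops T" "ok_pos f j" "ok_pos f k" "j \<noteq> k" "j < op_arity f" "k < op_arity f"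
  shows "f = T1Op \<or> f = WedgeOp \<and> {j, k} = {0, 1} \<or> f = JOp \<and> {j, k} = {0, 2}"
  using assms by (cases f) auto

lemma wedge_greatest: "ble z x \<Longrightarrow> ble z y \<Longrightarrow> ble z (wedge x y)"
  by (metis ble_iff_wedge wedge_assoc)

lemma wedge_mono2:
  "ble (wedge (wedge a d) (wedge a' d')) (wedge a d')" "ble (wedge (wedge a d) (wedge a' d')) (wedge a' d)"
  by (meson wedge_greatest wedge_le ble_trans)+

context core_n
begin

text \<open>The other operations with two admissible positions, wedge and J', are meets at a bad
  coordinate. There the meet of the values at (True, False) and (False, True) lies below the value
  at (False, False), and a tame continuation preserves this, so the last value would be true as
  well.\<close>

lemma join_is_T1:
  assumes \<sigma>: "wf \<sigma>" and f: "f \<in> ops T" and xs: "length xs = op_arity f" "set xs \<subseteq> S"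
    and j: "j < op_arity f" and k: "k < op_arity f" and jk: "j \<noteq> k" and a: "a \<in> Gam" and a': "a' \<in> Gam"
    and join: "\<And>x y. tr (vrun \<sigma> (vop f (xs[j := a x, k := a' y]))) \<longleftrightarrow> x \<or> y"
  shows "f = T1Op \<and> wf_step (f, xs[k := a' False], j) \<and>
    tr (vrun ((f, xs[k := a' False], j) # \<sigma>) (a True)) \<and>
    \<not> tr (vrun ((f, xs[k := a' False], j) # \<sigma>) (a False))"
proof -
  have xsS: "set (xs[l := w v]) \<subseteq> S" if "w \<in> Gam" for l w v
    using set_update_subset_insert[of xs l "w v"] xs Gam_S[OF that] by blast
  have step: "wf_step (f, xs[k := a' False], j)" "wf_step (f, xs[j := a False], k)"
    using f xs j k xsS[OF a] xsS[OF a'] by (auto simp: wf_step_def)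
  have swap: "xs[k := u, j := v] = xs[j := v, k := u]" for u v
    using jk by (simp add: list_update_swap)
  have s1: "tr (vrun ((f, xs[k := a' False], j) # \<sigma>) (a True))"
    "\<not> tr (vrun ((f, xs[k := a' False], j) # \<sigma>) (a False))"
    using join[of True False] join[of False False] by (simp_all add: vap_def swap)
  have okj: "ok_pos f j" by (rule sep_ok_step[OF a _ s1]) (use \<sigma> step in auto)
  have okk: "ok_pos f k"
    by (rule sep_ok_step[OF a', of f "xs[j := a False]" k \<sigma>])
      (use \<sigma> step join[of False True] join[of False False] in \<open>auto simp: vap_def\<close>)
  have "f = T1Op"
  proof (rule ccontr)
    assume "f \<noteq> T1Op"
    then have f2: "f = WedgeOp \<and> {j, k} = {0, 1} \<or> f = JOp \<and> {j, k} = {0, 2}"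
      using ok_two_pos[OF f okj okk jk j k] by satx
    define m where "m x y = vop f (xs[j := a x, k := a' y])" for x y
    have m: "(\<lambda>v. m v False) \<in> Gam"
      unfolding m_def swap[symmetric] by (rule Gam_upd) (use f xs xsS[OF a'] a in auto)
    have t: "tr (vrun \<sigma> (m True False))" "\<not> tr (vrun \<sigma> (m False False))" "tr (vrun \<sigma> (m False True))"
      using join by (simp_all add: m_def)
    obtain i where i: "i \<in> Q \<sigma>" "\<not> ble (b i) (run i \<sigma> (m False False i))"
      using bad_coord[OF m \<sigma> t(1,2)] by blast
    note D = bad_coordD[OF m m \<sigma> t(1,2) i]
    have iI: "i \<in> I" by (rule D)
    have r01: "run i \<sigma> (m False True i) = b i"
      using tr_run[OF t(3) iI] D(3) by (auto simp: ble_def)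
    then have "run i \<sigma> (m False True i) \<in> Pset" using D(3) by auto
    then have P01: "m False True i \<in> Pset" by (rule tame_P[OF D(4)])
    have at: "m x y i = op_fun T f ((map (\<lambda>s. s i) xs)[j := a x i, k := a' y i])" for x y
      using iI by (simp add: m_def map_update)
    have "ble (wedge (m True False i) (m False True i)) (m False False i)"
      using f2
    proof
      assume w: "f = WedgeOp \<and> {j, k} = {0, 1}"
      then have "j = 0 \<and> k = 1 \<or> j = 1 \<and> k = 0" by (auto simp: doubleton_eq_iff)
      then show ?thesis unfolding at using w xs wedge_mono2 by auto
    next
      assume w: "f = JOp \<and> {j, k} = {0, 2}"
      have P: "wedge x z = J' T x y z \<and> x \<in> Pset \<and> y \<in> Pset \<and> z \<in> Pset" if "J' T x y z \<in> Pset" for x y z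
      proof -
        have "J' T x y z \<noteq> Zero" using that by auto
        then show ?thesis using J'_nonzero[of T x y z] that Pset_PZ by metis
      qed
      have PJ: "J' T x y z = wedge x z" if "x \<in> Pset" "y \<in> Pset" for x y z
        using that by (simp add: J'_def)
      have "j = 0 \<and> k = 2 \<or> j = 2 \<and> k = 0" using w by (auto simp: doubleton_eq_iff)
      then show ?thesis
      proof
        assume jk: "j = 0 \<and> k = 2"
        have mJ: "m x y i = J' T (a x i) ((xs ! 1) i) (a' y i)" for x y
          unfolding at using w xs jk by simp
        note p1 = P[OF D(6)[unfolded mJ]] and p2 = P[OF P01[unfolded mJ]]
        show ?thesis unfolding mJ using p1 p2 PJ wedge_mono2 by metis
      next
        assume jk: "j = 2 \<and> k = 0"
        have mJ: "m x y i = J' T (a' y i) ((xs ! 1) i) (a x i)" for x y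
          unfolding at using w xs jk by simp
        note p1 = P[OF D(6)[unfolded mJ]] and p2 = P[OF P01[unfolded mJ]]
        show ?thesis unfolding mJ using p1 p2 PJ wedge_mono2 by metis
      qed
    qed
    then have "ble (run i \<sigma> (wedge (m True False i) (m False True i))) (run i \<sigma> (m False False i))"
      by (rule tame_mono[OF D(4)])
    moreover have "ble (wedge (run i \<sigma> (m True False i)) (run i \<sigma> (m False True i)))
        (run i \<sigma> (wedge (m True False i) (m False True i)))"
      by (rule tame_meet[OF D(4) D(6) P01])
    ultimately show False using i(2) D(5) r01 ble_trans by auto
  qed
  then show ?thesis using step s1 by blast
qed

section \<open>Separating paths from T1 to T0\<close>

definition sep :: "'i vstep list \<Rightarrow> bool" where
  "sep \<sigma> \<longleftrightarrow> wf \<sigma> \<and> tr (vrun \<sigma> b) \<and> \<not> tr (vrun \<sigma> c)"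

lemma sep_T1_ex: "\<exists>\<sigma> st \<tau>. sep (\<sigma> @ st # \<tau>) \<and> fst st = T1Op"
proof -
  obtain q where q: "q \<in> \<Gamma>\<^sub>2 c" "q (False, False) \<in> F" "q (False, True) = b" "q (True, False) = b"
    using join[OF cF] unfolding \<Gamma>\<^sub>2_def by blast
  have "tr b" by (simp add: tr_def)
  moreover have "\<not> tr (q (False, False))" using F_not[OF q(2)] by (auto simp: tr_def)
  ultimately have "\<exists>\<sigma> f xs j k a a'. wf \<sigma> \<and> f \<in> ops T \<and> length xs = op_arity f \<and> set xs \<subseteq> S \<and>
    j < op_arity f \<and> k < op_arity f \<and> j \<noteq> k \<and> a \<in> Gam \<and> a' \<in> Gam \<and>
    (\<forall>x y. tr (vrun \<sigma> (vop f (xs[j := a x, k := a' y]))) \<longleftrightarrow> x \<or> y)"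
    using q by (intro join_descent[of q "[]"]) auto
  then obtain \<sigma> f xs j k a a' where *: "wf \<sigma>" "f \<in> ops T" "length xs = op_arity f" "set xs \<subseteq> S"
    "j < op_arity f" "k < op_arity f" "j \<noteq> k" "a \<in> Gam" "a' \<in> Gam"
    "\<And>x y. tr (vrun \<sigma> (vop f (xs[j := a x, k := a' y]))) \<longleftrightarrow> x \<or> y" by blast
  let ?st = "(f, xs[k := a' False], j)"
  have st: "f = T1Op" "wf_step ?st" "tr (vrun (?st # \<sigma>) (a True))" "\<not> tr (vrun (?st # \<sigma>) (a False))"
    using join_is_T1[OF *] by blast+
  have "wf (?st # \<sigma>)" using st *(1) by simp
  then obtain \<sigma>' where "wf \<sigma>'" "tr (vrun (\<sigma>' @ ?st # \<sigma>) b)" "\<not> tr (vrun (\<sigma>' @ ?st # \<sigma>) c)"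
    using path_descent[OF *(8) _ st(3,4)] by blast
  then have "sep (\<sigma>' @ ?st # \<sigma>) \<and> fst ?st = T1Op" using st(1,2) *(1) by (auto simp: sep_def)
  then show ?thesis by blast
qed

text \<open>Met with b, the output of the path is b in the true case and a member of F in the false
  case; by \<open>F_equiv\<close> the path treats that member like c.\<close>

lemma sep_double:
  assumes \<sigma>: "sep \<sigma>"
  shows "sep (\<sigma> @ (WedgeOp, [b, b], 0) # \<sigma>)"
proof -
  let ?st = "(WedgeOp, [b, b], 0)"
  have wf: "wf \<sigma>" "wf_step ?st" and t: "tr (vrun \<sigma> b)" "\<not> tr (vrun \<sigma> c)"
    using \<sigma> bS by (auto simp: sep_def wf_step_def)
  have st: "vap ?st v = (\<lambda>i\<in>I. wedge (v i) (b i))" for v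
    by (simp add: vap_def vop_def)
  have "vap ?st (vrun \<sigma> b) i = b i" for i
    using t(1) S_ext[OF bS] by (cases "i \<in> I") (auto simp: st tr_def ble_iff_wedge wedge_commute)
  then have 1: "vap ?st (vrun \<sigma> b) = b" by (rule ext)
  have 2: "vap ?st (vrun \<sigma> c) \<in> F"
    unfolding st using below[OF cF, of "\<lambda>v. vrun \<sigma> (if v then b else c)"] Gam_vrun[OF wf(1) Gam_gen] t
    unfolding \<Gamma>_def tr_def by simp
  have "(\<lambda>v. vrun \<sigma> v) \<in> gen_by A {\<lambda>x. x}"
    using gen_vrun[OF wf(1), of "\<lambda>x. x" "{\<lambda>x. x}"] by (simp add: gen_by.gen)
  then have "tr (vrun \<sigma> (vap ?st (vrun \<sigma> c))) \<longleftrightarrow> tr (vrun \<sigma> c)"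
    using F_equiv[OF 2 cF] unfolding tr_def by blast
  then show ?thesis using 1 wf t by (simp add: sep_def vrun_append)
qed

definition plain :: "'i vstep list \<Rightarrow> bool" where
  "plain \<pi> \<longleftrightarrow> (\<forall>st\<in>set \<pi>. fst st \<noteq> T0Op \<and> fst st \<noteq> T1Op)"

text \<open>The pair (true value, false value) of a separating path at a bad coordinate is
  \<open>(P0, P2)\<close> or \<open>(P1, P2)\<close> throughout.\<close>

definition sep_at :: "'i \<Rightarrow> 'i vstep list \<Rightarrow> elt \<Rightarrow> bool" where
  "sep_at i \<sigma> p \<longleftrightarrow> wf \<sigma> \<and> okp \<sigma> \<and> run i \<sigma> Zero = Zero \<and> p \<in> {P0, P1} \<and> run i \<sigma> p \<in> Pset \<and>
     run i \<sigma> p \<noteq> run i \<sigma> P2"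

lemma sep_at_step:
  assumes "sep_at i (st # \<sigma>) p"
  shows "sep_at i \<sigma> (ap i st p) \<and> (fst st = T1Op \<and> p = P0 \<and> ap i st p = P1 \<or>
    fst st = T0Op \<and> p = P1 \<and> ap i st p = P0 \<or> fst st \<noteq> T0Op \<and> fst st \<noteq> T1Op \<and> ap i st p = p)"
proof -
  obtain f xs j where st: "st = (f, xs, j)" by (cases st)
  have wf: "wf (st # \<sigma>)" and ok: "okp (st # \<sigma>)" and r0: "run i (st # \<sigma>) Zero = Zero" and p: "p \<in> {P0, P1}"
    and rP: "run i (st # \<sigma>) p \<in> Pset" and ne: "run i (st # \<sigma>) p \<noteq> run i (st # \<sigma>) P2"
    using assms unfolding sep_at_def by blast+
  have "run i (st # \<sigma>) p \<noteq> Zero" using rP by auto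
  then have live: "ap i st Zero = Zero" "run i \<sigma> Zero = Zero" using run_live[OF wf r0] by blast+
  have ok': "ok_pos f j" "okp \<sigma>" using ok by (auto simp: okp_def st)
  have nz: "run i \<sigma> (ap i st p) \<noteq> Zero" using rP by auto
  have "tame (run i \<sigma>)" by (rule run_tame[OF _ ok'(2) live(2) nz]) (use wf in simp)
  then have aP: "ap i st p \<in> Pset" using tame_P rP by fastforce
  have wfs: "f \<in> ops T" "length (map (\<lambda>s. s i) xs) = op_arity f" "j < op_arity f"
    using wf by (auto simp: wf_step_def st)
  have "ap i st P2 = P2 \<and> (f = T1Op \<and> p = P0 \<and> ap i st p = P1 \<or>
    f = T0Op \<and> p = P1 \<and> ap i st p = P0 \<or> f \<noteq> T0Op \<and> f \<noteq> T1Op \<and> ap i st p = p)"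
  proof (rule toggle_step[OF wfs(1,2,3) ok'(1)])
    show "op_fun T f ((map (\<lambda>s. s i) xs)[j := Zero]) = Zero" using live(1) by (simp add: ap_def st)
    show "ap i st x = op_fun T f ((map (\<lambda>s. s i) xs)[j := x])" for x by (simp add: ap_def st)
    show "ap i st p \<noteq> ap i st P2" using ne by auto
  qed (use p aP in auto)
  then show ?thesis using live ok'(2) wf rP ne p unfolding sep_at_def by (auto simp: st)
qed

lemma sep_at_append: "sep_at i (\<sigma> @ \<tau>) p \<Longrightarrow> sep_at i \<tau> (run i \<sigma> p)"
proof (induction \<sigma> arbitrary: p)
  case (Cons st \<sigma>)
  then show ?case using sep_at_step[of i st "\<sigma> @ \<tau>" p] by simp
qed simp

text \<open>A T1 step requires the true value \<open>P0\<close> at this coordinate, and only T0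
  turns \<open>P1\<close> into \<open>P0\<close>, so some T0 precedes the first T1.\<close>

lemma sep_at_T0:
  "sep_at i \<sigma> P1 \<Longrightarrow> \<exists>st\<in>set \<sigma>. fst st = T1Op \<Longrightarrow>
    \<exists>\<pi> st \<tau>. \<sigma> = \<pi> @ st # \<tau> \<and> plain \<pi> \<and> fst st = T0Op"
proof (induction \<sigma>)
  case (Cons st \<sigma>)
  note s = sep_at_step[OF Cons.prems(1)]
  show ?case
  proof (cases "fst st = T0Op")
    case True
    then show ?thesis by (intro exI[of _ "[]"]) (auto simp: plain_def)
  next
    case False
    then have st: "fst st \<noteq> T0Op" "fst st \<noteq> T1Op" "sep_at i \<sigma> P1" using s by auto
    then obtain \<pi> st' \<tau> where "\<sigma> = \<pi> @ st' # \<tau>" "plain \<pi>" "fst st' = T0Op"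
      using Cons by auto
    then show ?thesis using st by (intro exI[of _ "st # \<pi>"]) (auto simp: plain_def)
  qed
qed simp

text \<open>The data over which the live set is minimised. Of the T1 step inside w only its effect
  on the live true values is remembered, in the last clause; \<pi> is the stretch without toggles up
  to the T0 step st.\<close>

definition cand :: "(bool \<Rightarrow> 'i \<Rightarrow> elt) \<Rightarrow> 'i vstep list \<Rightarrow> 'i vstep \<Rightarrow> 'i vstep list \<Rightarrow> bool" where
  "cand w \<pi> st \<tau> \<longleftrightarrow> w \<in> Gam \<and> wf (\<pi> @ st # \<tau>) \<and> plain \<pi> \<and> fst st = T0Op \<and>
    tr (vrun (\<pi> @ st # \<tau>) (w True)) \<and> \<not> tr (vrun (\<pi> @ st # \<tau>) (w False)) \<and>
    (\<forall>i\<in>Q (\<pi> @ st # \<tau>). w True i \<in> Pset \<union> V10)"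

text \<open>A doubled path still contains a T1 after its first T1. At a bad coordinate the true
  value is \<open>P1\<close> in between, so a T0 must come first; w is the part up to and including
  the first T1.\<close>

lemma cand_ex: "\<exists>w \<pi> st \<tau>. cand w \<pi> st \<tau>"
proof -
  obtain \<sigma> st1 \<tau> where 1: "sep (\<sigma> @ st1 # \<tau>)" "fst st1 = T1Op" using sep_T1_ex by blast
  \<comment> \<open>The remainder after the first occurrence of \<open>st1\<close>; it contains the
    second occurrence.\<close>
  define \<rho> where "\<rho> = \<tau> @ (WedgeOp, [b, b], 0) # \<sigma> @ st1 # \<tau>"
  have s: "sep (\<sigma> @ st1 # \<rho>)" using sep_double[OF 1(1)] by (simp add: \<rho>_def)
  then have wf: "wf (\<sigma> @ st1 # \<rho>)" and t: "tr (vrun (\<sigma> @ st1 # \<rho>) b)" "\<not> tr (vrun (\<sigma> @ st1 # \<rho>) c)"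
    by (auto simp: sep_def)
  let ?g = "\<lambda>v. if v then b else c"
  have t': "tr (vrun (\<sigma> @ st1 # \<rho>) (?g True))" "\<not> tr (vrun (\<sigma> @ st1 # \<rho>) (?g False))" using t by auto
  have ok: "okp (\<sigma> @ st1 # \<rho>)" by (rule sep_okp[OF Gam_gen wf t'])
  obtain i where i: "i \<in> Q (\<sigma> @ st1 # \<rho>)" "\<not> ble (b i) (run i (\<sigma> @ st1 # \<rho>) (?g False i))"
    using bad_coord[OF Gam_gen wf t'] by blast
  note D = bad_coordD[OF Gam_gen Gam_gen wf t' i]
  have "sep_at i (\<sigma> @ st1 # \<rho>) (b i)"
    unfolding sep_at_def using wf ok i D by (auto simp: Q_def)
  then have sa: "sep_at i (st1 # \<rho>) (run i \<sigma> (b i))" by (rule sep_at_append)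
  then have "sep_at i \<rho> P1" using sep_at_step[OF sa] 1(2) by auto
  then obtain \<pi> st0 \<tau>0 where r: "\<rho> = \<pi> @ st0 # \<tau>0" "plain \<pi>" "fst st0 = T0Op"
    using sep_at_T0[of i \<rho>] 1(2) by (auto simp: \<rho>_def)
  define w where "w v = vrun (\<sigma> @ [st1]) (?g v)" for v
  have wG: "w \<in> Gam" unfolding w_def by (rule Gam_vrun[OF _ Gam_gen]) (use wf in auto)
  have w': "vrun \<rho> (w v) = vrun (\<sigma> @ st1 # \<rho>) (?g v)" for v by (simp add: w_def vrun_append)
  have "w True i \<in> Pset \<union> V10" if i: "i \<in> Q \<rho>" for i
  proof -
    have iI: "i \<in> I" using i by (rule Q_I)
    have "run i \<rho> (w True i) \<noteq> Zero" using tr_Q[of \<rho> "w True" i] t i w'[of True] by simp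
    then have nz: "w True i \<noteq> Zero" using i by (auto simp: Q_def)
    obtain xs j where st1: "st1 = (T1Op, xs, j)" using 1(2) by (cases st1) auto
    have "w True i = op_fun T T1Op ((map (\<lambda>s. s i) xs)[j := vrun \<sigma> b i])"
      using iI by (simp add: w_def vrun_append st1 vap_def map_update)
    then show ?thesis using nz T1_nonzero by fastforce
  qed
  then have "cand w \<pi> st0 \<tau>0"
    unfolding cand_def using wG wf r t w'[of True] w'[of False] by auto
  then show ?thesis by blast
qed

lemma min_cand_ex:
  "\<exists>w \<pi> st \<tau>. cand w \<pi> st \<tau> \<and> (\<forall>w' \<pi>' st' \<tau>'. cand w' \<pi>' st' \<tau>' \<longrightarrow>
     card (Q (\<pi> @ st # \<tau>)) \<le> card (Q (\<pi>' @ st' # \<tau>')))"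
proof -
  let ?P = "\<lambda>(w, \<pi>, st, \<tau>). cand w \<pi> st \<tau>" and ?m = "\<lambda>(w, \<pi>, st, \<tau>). card (Q (\<pi> @ st # \<tau>))"
  obtain x0 where "?P x0" using cand_ex by auto
  from ex_has_least_nat[of ?P, OF this, of ?m] show ?thesis by auto
qed

end

section \<open>Consequences of a minimal live set\<close>

locale core_c = core_n T I S b F c for T and I :: "'i set" and S b F c +
  fixes w :: "bool \<Rightarrow> 'i \<Rightarrow> elt" and \<pi> :: "'i vstep list" and st :: "'i vstep" and \<tau> :: "'i vstep list"
  assumes cand: "cand w \<pi> st \<tau>"
    and cand_min: "cand w' \<pi>' st' \<tau>' \<Longrightarrow> card (Q (\<pi> @ st # \<tau>)) \<le> card (Q (\<pi>' @ st' # \<tau>'))"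
begin

definition "\<rho> = \<pi> @ st # \<tau>"
definition "z = w True"
definition "QQ = Q \<rho>"
text \<open>The live coordinates that carry letters and will be assigned to tape squares; on the
  rest of \<open>QQ\<close> the true value lies in P.\<close>

definition "RR = {i \<in> QQ. z i \<in> V10}"

lemma wG: "w \<in> Gam" and wf\<rho>: "wf \<rho>" and plain\<pi>: "plain \<pi>" and st0: "fst st = T0Op"
  and trz: "tr (vrun \<rho> z)" and ntr: "\<not> tr (vrun \<rho> (w False))"
  and zPV: "i \<in> QQ \<Longrightarrow> z i \<in> Pset \<union> V10"
  using cand unfolding cand_def \<rho>_def z_def QQ_def by blast+

lemma zS: "z \<in> S" unfolding z_def by (rule Gam_S[OF wG])

lemma ok\<rho>: "okp \<rho>"
  using sep_okp[OF wG wf\<rho>] trz ntr by (simp add: z_def)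

lemma QQ_I: "i \<in> QQ \<Longrightarrow> i \<in> I" unfolding QQ_def by (rule Q_I)

lemma RR_QQ: "i \<in> RR \<Longrightarrow> i \<in> QQ" by (simp add: RR_def)

lemma run_z_nz: "i \<in> QQ \<Longrightarrow> run i \<rho> (z i) \<noteq> Zero"
  using tr_Q[OF trz] by (simp add: QQ_def)

lemma run_0: "i \<in> QQ \<Longrightarrow> run i \<rho> Zero = Zero"
  by (auto simp: QQ_def Q_def)

lemma VB_VVbar: "v \<in> S \<Longrightarrow> i \<in> I \<Longrightarrow> v i \<in> VB \<Longrightarrow> v i \<in> VVbar T"
  using S_Bset by (simp add: VVbar_eq)

lemma bad_ex: obtains i where "i \<in> QQ" "\<not> ble (b i) (run i \<rho> (w False i))" "z i \<in> Pset"
    "tame (run i \<rho>)"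
proof -
  have t: "tr (vrun \<rho> (w True))" using trz by (simp add: z_def)
  obtain i where i: "i \<in> Q \<rho>" "\<not> ble (b i) (run i \<rho> (w False i))" using bad_coord[OF wG wf\<rho> t ntr] .
  show ?thesis
    using that[of i] i bad_coordD[OF wG wG wf\<rho> t ntr i] by (auto simp: QQ_def z_def)
qed

text \<open>The translation x to J'(z, v, x) fixes z on the live coordinates and is constant where v
  is the bar of z. Put in front of the path, it gives a candidate with fewer live
  coordinates.\<close>

lemma MIN0:
  assumes v: "v \<in> S" and vz: "\<And>i. i \<in> QQ \<Longrightarrow> v i = z i \<or> z i \<in> VB \<and> v i = bar (z i)" and i: "i \<in> QQ"
  shows "v i = z i"
proof (rule ccontr)
  assume ne: "v i \<noteq> z i"
  define s :: "'i vstep" where "s = (JOp, [z, v, z], 2)"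
  have ap: "ap l s x = J' T (z l) (v l) x" for l x by (simp add: ap_def s_def)
  have wfs: "wf_step s" using v zS by (simp add: s_def wf_step_def)
  have apz: "ap l s (z l) = z l" if "l \<in> QQ" for l
    using vz[OF that]
  proof
    assume "v l = z l" then show ?thesis unfolding ap by (simp add: J'_def)
  next
    assume *: "z l \<in> VB \<and> v l = bar (z l)"
    then have "z l \<in> VVbar T" "z l \<noteq> v l" "z l \<notin> Pset"
      using VB_VVbar[OF zS QQ_I[OF that]] bar_neq VB_not_Pset by metis+
    then show ?thesis unfolding ap using * by (simp add: J'_def)
  qed
  have bar0: "ap l s Zero = z l" if "l \<in> QQ" "v l \<noteq> z l" for l
  proof -
    have *: "z l \<in> VB \<and> v l = bar (z l)" using vz[OF that(1)] that(2) by blast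
    then have "z l \<in> VVbar T" "z l \<notin> Pset"
      using VB_VVbar[OF zS QQ_I[OF that(1)]] VB_not_Pset by metis+
    then show ?thesis unfolding ap using * that(2) by (simp add: J'_def)
  qed
  have t1: "tr (vrun (s # \<rho>) z)"
  proof -
    have "tr (vrun \<rho> (vap s z))"
    proof (rule trI_Q[OF wf\<rho> trz])
      fix l assume "l \<in> Q \<rho>"
      then have l: "l \<in> QQ" by (simp add: QQ_def)
      show "ble (b l) (run l \<rho> (vap s z l))"
        using tr_run[OF trz QQ_I[OF l]] apz[OF l] QQ_I[OF l] by (simp add: vap_at)
    qed
    then show ?thesis by simp
  qed
  \<comment> \<open>At a bad coordinate z lies in P, hence v = z there and the new step is a meet
    with z, which only lowers the false value.\<close>
  have t0: "\<not> tr (vrun (s # \<rho>) (w False))"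
  proof
    assume t: "tr (vrun (s # \<rho>) (w False))"
    obtain l where l: "l \<in> QQ" "\<not> ble (b l) (run l \<rho> (w False l))" "z l \<in> Pset" and ta: "tame (run l \<rho>)"
      by (rule bad_ex)
    then have "v l = z l" using vz[OF l(1)] VB_not_Pset by blast
    then have "ap l s (w False l) = wedge (z l) (w False l)" unfolding ap by (simp add: J'_def)
    then have "ble (run l \<rho> (ap l s (w False l))) (run l \<rho> (w False l))"
      using tame_mono[OF ta] wedge_le(2) by simp
    moreover have "ble (b l) (run l \<rho> (ap l s (w False l)))"
      using tr_run[OF t QQ_I[OF l(1)]] by simp
    ultimately show False using l(2) ble_trans by blast
  qed
  have sub: "Q (s # \<rho>) \<subseteq> QQ - {i}"
  proof
    fix l assume l: "l \<in> Q (s # \<rho>)"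
    then have l': "l \<in> I" "b l \<noteq> Zero" "run l \<rho> (ap l s Zero) = Zero" by (auto simp: Q_def)
    have lQ: "l \<in> QQ"
    proof (rule ccontr)
      assume "l \<notin> QQ"
      then have *: "run l \<rho> Zero \<noteq> Zero" using l' by (auto simp: QQ_def Q_def)
      have "run l \<rho> (ap l s Zero) = run l \<rho> Zero" by (rule run_const[OF wf\<rho> *])
      then show False using * l' by simp
    qed
    moreover have "l \<noteq> i" using bar0[of l] run_z_nz[OF lQ] l'(3) ne lQ by auto
    ultimately show "l \<in> QQ - {i}" by simp
  qed
  have "cand w (s # \<pi>) st \<tau>"
    unfolding cand_def
  proof (intro conjI)
    show "plain (s # \<pi>)" using plain\<pi> by (simp add: plain_def s_def)
    show "wf ((s # \<pi>) @ st # \<tau>)" using wf\<rho> wfs by (simp add: \<rho>_def)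
    show "tr (vrun ((s # \<pi>) @ st # \<tau>) (w True))" using t1 by (simp add: \<rho>_def z_def)
    show "\<not> tr (vrun ((s # \<pi>) @ st # \<tau>) (w False))" using t0 by (simp add: \<rho>_def)
    show "\<forall>i\<in>Q ((s # \<pi>) @ st # \<tau>). w True i \<in> Pset \<union> V10"
      using sub zPV by (auto simp: \<rho>_def z_def)
  qed (use wG st0 in auto)
  from cand_min[OF this] have "card QQ \<le> card (Q (s # \<rho>))" by (simp add: QQ_def \<rho>_def)
  moreover have fin: "finite QQ" using finI by (simp add: QQ_def Q_def)
  moreover have "Q (s # \<rho>) \<subset> QQ" using sub i by blast
  ultimately show False using psubset_card_mono[OF fin, of "Q (s # \<rho>)"] by linarith
qed

text \<open>Otherwise u would be a control of S1 on all live letters, which \<open>no_S1\<close>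
  forbids. For a vector with values in U this yields a coordinate with value \<open>H\<close>, so
  every tape square is represented.\<close>

lemma N1:
  assumes "u \<in> S" shows "\<exists>i\<in>RR. u i \<notin> {One, Two}"
proof (rule ccontr)
  assume *: "\<not> ?thesis"
  have "tr (vrun \<rho> (w False))"
  proof (rule no_S1[OF wG wf\<rho> trz[unfolded z_def] assms])
    fix i assume i: "i \<in> Q \<rho>" "w True i \<in> Uset \<union> VVbar T"
    then have "i \<in> RR" using zPV[of i] UV_not[OF i(2)] by (auto simp: RR_def QQ_def z_def)
    then show "u i \<in> {One, Two}" using * by blast
  qed
  then show False using ntr by blast
qed

text \<open>The operation \<open>wedge_i I1\<close> rejects no element of P or \<open>V10\<close>
  except M with indices 1 and 0. If z avoided that letter, applying it to w and z would replace
  every difference on live coordinates by \<open>Zero\<close>, against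
  \<open>zero_lemma\<close>.\<close>

lemma N3: "\<exists>i\<in>RR. z i = Vel (M 1 S0)"
proof (rule ccontr)
  assume *: "\<not> ?thesis"
  define w' where "w' v = vop (WedgeIOp I1) [w v, z]" for v
  have w': "w' \<in> Gam"
    using Gam_op[of "WedgeIOp I1" "[w, \<lambda>_. z]"] wG Gam_const[OF zS] by (simp add: w'_def[abs_def])
  have at: "w' v i = (if w v i = z i then z i else Zero)" if i: "i \<in> QQ" for i v
  proof -
    have "z i \<noteq> Vel (M 1 S0)"
    proof
      assume "z i = Vel (M 1 S0)"
      then have "i \<in> RR" using i by (simp add: RR_def V10_def)
      then show False using * \<open>z i = _\<close> by blast
    qed
    then have "z i \<in> (Pset \<union> V10) - {s_elt I1}" using zPV[OF i] by simp
    then show ?thesis using QQ_I[OF i] by (simp add: w'_def wedge_i_def)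
  qed
  have t: "tr (vrun \<rho> (w' True))"
  proof (rule trI_Q[OF wf\<rho> trz])
    fix i assume "i \<in> Q \<rho>"
    then have i: "i \<in> QQ" by (simp add: QQ_def)
    show "ble (b i) (run i \<rho> (w' True i))"
      using at[OF i, of True] tr_run[OF trz QQ_I[OF i]] by (simp add: z_def)
  qed
  have t': "tr (vrun \<rho> (w' False))"
  proof (rule zero_lemma[OF w' wf\<rho> t])
    fix i assume "i \<in> Q \<rho>"
    then have i: "i \<in> QQ" by (simp add: QQ_def)
    show "w' False i = Zero \<or> w' False i = w' True i"
      using at[OF i, of True] at[OF i, of False] by (simp add: z_def)
  qed
  obtain i where i: "i \<in> QQ" "\<not> ble (b i) (run i \<rho> (w False i))" by (rule bad_ex)
  then have "w False i \<noteq> z i" using tr_run[OF trz QQ_I[OF i(1)]] by auto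
  then have "w' False i = Zero" using at[OF i(1)] by simp
  then have "run i \<rho> (w' False i) = Zero" using run_0[OF i(1)] by simp
  then show False using tr_Q[OF t'] i(1) by (simp add: QQ_def)
qed

text \<open>The vectors that will encode configurations. Only machine operations generate them, with
  arguments from S and no loss on a live coordinate; the U1 and U2 steps of the path are reduced to
  these in \<open>path_reach\<close>.\<close>

inductive reach :: "('i \<Rightarrow> elt) \<Rightarrow> bool" where
  start: "reach z"
| move: "reach u \<Longrightarrow> G \<in> Mset T \<Longrightarrow> x \<in> S \<Longrightarrow> y \<in> S \<Longrightarrow>
    (\<And>i. i \<in> QQ \<Longrightarrow> mop_fun T G (x i) (y i) (u i) \<noteq> Zero) \<Longrightarrow> reach (vop (MOp G) [x, y, u])"

lemma vop3 [simp]: "i \<in> I \<Longrightarrow> vop (MOp G) [x, y, u] i = mop_fun T G (x i) (y i) (u i)"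
  by simp

lemma reach_S: "reach u \<Longrightarrow> u \<in> S"
  by (induction rule: reach.induct) (auto intro!: zS vop_S)

lemma reach_type:
  "reach u \<Longrightarrow> i \<in> QQ \<Longrightarrow> (if i \<in> RR then u i \<in> VB else u i \<in> Pset)"
proof (induction rule: reach.induct)
  case start
  then show ?case using zPV[of i] V10_VB by (auto simp: RR_def)
next
  case (move u G x y)
  have nz: "mop_fun T G (x i) (y i) (u i) \<noteq> Zero" by (rule move.hyps(5)[OF move.prems])
  show ?case
    using mop_nonzero[OF move.hyps(2) refl nz] move.IH[OF move.prems] QQ_I[OF move.prems] VB_not_Pset
    by (auto simp del: mop_fun.simps split: if_splits)
qed

text \<open>Inverse operations commute with the bar, so they carry e back along the chain to a
  vector that is z up to bars, where \<open>MIN0\<close> applies.\<close>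

lemma MIN:
  assumes "reach u" "e \<in> S" "\<And>i. i \<in> QQ \<Longrightarrow> e i = u i \<or> u i \<in> VB \<and> e i = bar (u i)" "i \<in> QQ"
  shows "e i = u i"
  using assms
proof (induction arbitrary: e i rule: reach.induct)
  case start
  then show ?case using MIN0 by blast
next
  case (move u G x y)
  let ?u' = "vop (MOp G) [x, y, u]"
  define e' where "e' = vop (MOp (inv_mop G)) [x, y, e]"
  have e'S: "e' \<in> S" unfolding e'_def using move.hyps(2-4) move.prems(1) inv_mop_Mset[OF move.hyps(2)] by (intro vop_S) auto
  have inv: "mop_fun T (inv_mop G) (x l) (y l) (?u' l) = u l" if "l \<in> QQ" for l
    using mop_inv[OF move.hyps(2) refl move.hyps(5)[OF that]] QQ_I[OF that] by (simp del: mop_fun.simps)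
  have e'1: "e' l = u l" if "l \<in> QQ" "e l = ?u' l" for l
    using inv[OF that(1)] that(2) QQ_I[OF that(1)] by (simp add: e'_def del: vop_at)
  have e'2: "u l \<in> VB \<and> e' l = bar (u l)" if "l \<in> QQ" "?u' l \<in> VB" "e l = bar (?u' l)" for l
  proof -
    have "e' l = mop_fun T (inv_mop G) (x l) (y l) (bar (?u' l))"
      using that QQ_I[OF that(1)] by (simp add: e'_def del: vop_at)
    also have "\<dots> = bar (u l)"
      using mop_bar[OF inv_mop_Mset[OF move.hyps(2)] that(2)] inv[OF that(1)] by simp
    finally have "e' l = bar (u l)" .
    moreover have "u l \<in> VB"
      using mop_nonzero[OF move.hyps(2) refl move.hyps(5)[OF that(1)]] that(2) QQ_I[OF that(1)] VB_not_Pset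
      by (auto simp del: mop_fun.simps)
    ultimately show ?thesis by simp
  qed
  have "e' l = u l \<or> u l \<in> VB \<and> e' l = bar (u l)" if "l \<in> QQ" for l
    using move.prems(2)[OF that] e'1[OF that] e'2[OF that] by blast
  then have eq: "e' i = u i" using move.IH[OF e'S _ move.prems(3)] by blast
  show ?case
  proof (rule ccontr)
    assume "e i \<noteq> ?u' i"
    then have "u i \<in> VB \<and> e' i = bar (u i)" using move.prems(2)[OF move.prems(3)] e'2[OF move.prems(3)] by blast
    then show False using eq bar_neq by metis
  qed
qed

text \<open>The operation U1 applied to x, y, y', u returns the next vector barred exactly where y
  and y' differ, so \<open>MIN\<close> makes them agree: the square to the right is
  determined.\<close>

lemma uniq_right:
  assumes u: "reach u" and G: "G \<in> Mset T" and x: "x \<in> S" and y: "y \<in> S" and y': "y' \<in> S"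
    and nz: "\<And>i. i \<in> QQ \<Longrightarrow> mop_fun T G (x i) (y i) (u i) \<noteq> Zero"
    and p: "\<And>i. i \<in> QQ \<Longrightarrow> prec (x i) (y' i)" and i: "i \<in> QQ"
  shows "y' i = y i"
proof (rule ccontr)
  assume ne: "y' i \<noteq> y i"
  let ?u' = "vop (MOp G) [x, y, u]"
  have r: "reach ?u'" by (rule reach.move[OF u G x y nz])
  define e where "e = vop (U1Op G) [x, y, y', u]"
  have eS: "e \<in> S" unfolding e_def using G x y y' reach_S[OF u] by (intro vop_S) auto
  have e: "if y' l = y l then e l = ?u' l else ?u' l \<in> VB \<and> e l = bar (?u' l)" if l: "l \<in> QQ" for l
  proof -
    have lI: "l \<in> I" by (rule QQ_I[OF l])
    note m = mop_nonzero[OF G refl nz[OF l]]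
    have el: "e l = Uone T G (x l) (y l) (y' l) (u l)" using lI by (simp add: e_def)
    have ul: "?u' l = mop_fun T G (x l) (y l) (u l)" using lI by (simp del: mop_fun.simps)
    show ?thesis
    proof (cases "y' l = y l")
      case True
      then show ?thesis using el m ul by (simp add: Uone_def del: mop_fun.simps)
    next
      case False
      have "u l \<notin> Pset"
      proof
        assume "u l \<in> Pset"
        then have "x l = One \<and> y l = One" using m VB_not_Pset by blast
        then show False using p[OF l] False by (simp add: prec_One)
      qed
      then have V: "?u' l \<in> VB" using m ul by simp
      then have "?u' l \<in> VVbar T" by (rule VB_VVbar[OF reach_S[OF r] lI])
      then have "e l = bar (?u' l)"
        unfolding el ul Uone_def using False m p[OF l] by (simp del: mop_fun.simps)
      then show ?thesis using False V by simp
    qed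
  qed
  have "e i = ?u' i" by (rule MIN[OF r eS _ i]) (use e in metis)
  then show False using e[OF i] ne bar_neq by metis
qed

text \<open>The mirror image with U2. The extra hypothesis is due to \<open>H\<close> and
  \<open>One\<close> both preceding \<open>One\<close>: on the coordinates carrying P,
  \<open>prec\<close> does not determine the left neighbour.\<close>

lemma uniq_left:
  assumes u: "reach u" and G: "G \<in> Mset T" and x: "x \<in> S" and y: "y \<in> S" and x': "x' \<in> S"
    and nz: "\<And>i. i \<in> QQ \<Longrightarrow> mop_fun T G (x i) (y i) (u i) \<noteq> Zero"
    and p: "\<And>i. i \<in> QQ \<Longrightarrow> prec (x' i) (y i)" and p1: "\<And>i. i \<in> QQ - RR \<Longrightarrow> x' i = One" and i: "i \<in> QQ"
  shows "x' i = x i"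
proof (rule ccontr)
  assume ne: "x' i \<noteq> x i"
  let ?u' = "vop (MOp G) [x, y, u]"
  have r: "reach ?u'" by (rule reach.move[OF u G x y nz])
  define e where "e = vop (U2Op G) [x', x, y, u]"
  have eS: "e \<in> S" unfolding e_def using G x y x' reach_S[OF u] by (intro vop_S) auto
  have e: "if x' l = x l then e l = ?u' l else ?u' l \<in> VB \<and> e l = bar (?u' l)" if l: "l \<in> QQ" for l
  proof -
    have lI: "l \<in> I" by (rule QQ_I[OF l])
    note m = mop_nonzero[OF G refl nz[OF l]]
    have el: "e l = Utwo T G (x' l) (x l) (y l) (u l)" using lI by (simp add: e_def)
    have ul: "?u' l = mop_fun T G (x l) (y l) (u l)" using lI by (simp del: mop_fun.simps)
    show ?thesis
    proof (cases "x' l = x l")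
      case True
      then show ?thesis using el m ul by (simp add: Utwo_def del: mop_fun.simps)
    next
      case False
      have "u l \<notin> Pset"
      proof
        assume P: "u l \<in> Pset"
        then have "x l = One" using m VB_not_Pset by blast
        moreover have "l \<notin> RR" using reach_type[OF u l] P VB_not_Pset by auto
        ultimately show False using p1[of l] False l by simp
      qed
      then have V: "?u' l \<in> VB" using m ul by simp
      then have "?u' l \<in> VVbar T" by (rule VB_VVbar[OF reach_S[OF r] lI])
      then have "e l = bar (?u' l)"
        unfolding el ul Utwo_def using False m p[OF l] by (simp del: mop_fun.simps)
      then show ?thesis using False V by simp
    qed
  qed
  have "e i = ?u' i" by (rule MIN[OF r eS _ i]) (use e in metis)
  then show False using e[OF i] ne bar_neq by metis
qed

lemma live_append:
  "wf (\<sigma> @ \<theta>) \<Longrightarrow> run i (\<sigma> @ \<theta>) Zero = Zero \<Longrightarrow> run i (\<sigma> @ \<theta>) x \<noteq> Zero \<Longrightarrow> run i \<theta> Zero = Zero"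
proof (induction \<sigma> arbitrary: x)
  case (Cons s \<sigma>)
  have "run i (\<sigma> @ \<theta>) Zero = Zero" using run_live[of s "\<sigma> @ \<theta>" i x] Cons.prems by simp
  then show ?case using Cons.IH[of "ap i s x"] Cons.prems by simp
qed simp

lemma live_step:
  assumes \<rho>: "\<rho> = \<pi>1 @ s # \<theta>" and i: "i \<in> QQ"
  shows "ap i s Zero = Zero \<and> ap i s (run i \<pi>1 (z i)) \<noteq> Zero"
proof -
  have wf: "wf (\<pi>1 @ s # \<theta>)" using wf\<rho> \<rho> by simp
  have nz: "run i (\<pi>1 @ s # \<theta>) (z i) \<noteq> Zero" using run_z_nz[OF i] \<rho> by simp
  have "run i (\<pi>1 @ s # \<theta>) Zero = Zero" using run_0[OF i] \<rho> by simp
  then have r0: "run i (s # \<theta>) Zero = Zero" by (rule live_append[OF wf _ nz])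
  have nz': "run i (s # \<theta>) (run i \<pi>1 (z i)) \<noteq> Zero" using nz by (simp add: run_append)
  have "ap i s Zero = Zero \<and> run i \<theta> Zero = Zero"
    using run_live[OF _ r0 nz'] wf by simp
  then show ?thesis using nz' by auto
qed

text \<open>On a live letter, a wedge or J' step that is not zero changes nothing, and a U1 or U2
  step has coinciding competitors by uniqueness, hence is a machine step. On \<open>QQ - RR\<close>
  the run and u may differ inside P, so only membership in P is recorded.\<close>

lemma path_reach:
  "\<pi> = \<pi>1 @ \<pi>2 \<Longrightarrow> \<exists>u. reach u \<and> (\<forall>i\<in>RR. run i \<pi>1 (z i) = u i) \<and> (\<forall>i\<in>QQ - RR. run i \<pi>1 (z i) \<in> Pset)"
proof (induction \<pi>1 arbitrary: \<pi>2 rule: rev_induct)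
  case Nil
  show ?case
    using zPV by (intro exI[of _ z]) (auto simp: reach.start RR_def)
next
  case (snoc s \<pi>1)
  then obtain u where u: "reach u" "\<And>i. i \<in> RR \<Longrightarrow> run i \<pi>1 (z i) = u i"
    "\<And>i. i \<in> QQ - RR \<Longrightarrow> run i \<pi>1 (z i) \<in> Pset" by fastforce
  obtain f xs j where s: "s = (f, xs, j)" by (cases s)
  have \<rho>s: "\<rho> = \<pi>1 @ s # (\<pi>2 @ st # \<tau>)" unfolding \<rho>_def using snoc.prems by simp
  have wfs: "f \<in> ops T" "length xs = op_arity f" "set xs \<subseteq> S" "j < op_arity f"
    using wf\<rho> by (auto simp: \<rho>s s wf_step_def)
  have ok: "ok_pos f j" using ok\<rho> by (auto simp: okp_def \<rho>s s)
  have nT: "f \<noteq> T0Op" "f \<noteq> T1Op" using plain\<pi> snoc.prems by (auto simp: plain_def s)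
  define a where "a i = run i \<pi>1 (z i)" for i
  have live: "ap i s Zero = Zero" "ap i s (a i) \<noteq> Zero" if "i \<in> QQ" for i
    using live_step[OF \<rho>s that] by (auto simp: a_def)
  have aR: "a i = u i" "a i \<in> VB" if "i \<in> RR" for i
    using u(2)[OF that] reach_type[OF u(1) RR_QQ[OF that]] that by (auto simp: a_def)
  have aP: "a i \<in> Pset" if "i \<in> QQ - RR" for i using u(3)[OF that] by (simp add: a_def)
  have tame: "tame (ap i s)" if "i \<in> QQ" for i
    using ap_tame[of f xs j i] wfs ok live(1)[OF that] by (simp add: s wf_step_def)
  have P': "ap i s (a i) \<in> Pset" if "i \<in> QQ - RR" for i
    using aP[OF that] tame_nP[OF tame, of i "a i"] live(2)[of i] that PZ_cases Pset_PZ by blast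
  have run': "run i (\<pi>1 @ [s]) (z i) = ap i s (a i)" for i by (simp add: run_append a_def)
  have xsS: "xs ! l \<in> S" if "l < op_arity f" for l using wfs that by (metis nth_mem subsetD)
  have at: "ap i s x = op_fun T f ((map (\<lambda>s. s i) xs)[j := x])" for i x by (simp add: ap_def s)
  show ?case
  proof (cases "\<exists>G. f = MOp G \<or> f = U1Op G \<or> f = U2Op G")
    case False
    have "ap i s (a i) = a i" if i: "i \<in> RR" for i
    proof -
      have len: "length (map (\<lambda>s. s i) xs) = op_arity f" using wfs by simp
      have str: "op_fun T f ((map (\<lambda>s. s i) xs)[j := Zero]) = Zero"
        using live(1)[OF RR_QQ[OF i]] by (simp add: at)
      have aV: "a i \<notin> PZ" "a i \<noteq> Zero" using aR(2)[OF i] by (auto simp: VB_def)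
      have wd: "wedge (a i) v = a i" if "wedge (a i) v \<noteq> Zero" for v
        using that aV by (auto simp: wedge_eq PZ_def split: if_splits)
      have nz: "ap i s (a i) \<noteq> Zero" using live(2)[OF RR_QQ[OF i]] .
      show ?thesis
        using wfs(1) len wfs(4) ok str
      proof (cases rule: ok_step_cases)
        case (1 v)
        then have "ap i s (a i) = wedge (a i) v" unfolding at by metis
        then show ?thesis using wd nz by simp
      next
        case 4
        then have "ap i s (a i) = J' T (a i) (map (\<lambda>s. s i) xs ! 1) (map (\<lambda>s. s i) xs ! 2)"
          unfolding at by metis
        then show ?thesis using nz J'_nonzero[of T "a i" "map (\<lambda>s. s i) xs ! 1" "map (\<lambda>s. s i) xs ! 2"]
          aV Pset_PZ by metis
      next
        case 5
        then have "ap i s (a i) = Zero \<or> ap i s (a i) = wedge (a i) (map (\<lambda>s. s i) xs ! 0)"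
          unfolding at by metis
        then show ?thesis using wd nz by auto
      qed (use nT False in auto)
    qed
    then show ?thesis using u(1) aR P' run' by (intro exI[of _ u]) auto
  next
    case True
    then obtain G where G: "f = MOp G \<or> f = U1Op G \<or> f = U2Op G" by blast
    then have GM: "G \<in> Mset T" using wfs(1) by auto
    obtain x y where xy: "x \<in> S" "y \<in> S" and nz: "\<And>i. i \<in> QQ \<Longrightarrow> mop_fun T G (x i) (y i) (u i) \<noteq> Zero"
      and val: "\<And>i. i \<in> RR \<Longrightarrow> ap i s (a i) = mop_fun T G (x i) (y i) (u i)"
      using G
    proof (elim disjE)
      assume f: "f = MOp G"
      then have ap: "ap i s v = mop_fun T G ((xs ! 0) i) ((xs ! 1) i) v" for i v
        unfolding at using ok wfs by (simp del: mop_fun.simps)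
      show ?thesis
      proof (rule that)
        show "xs ! 0 \<in> S" "xs ! 1 \<in> S" using xsS f by auto
        fix i assume i: "i \<in> QQ"
        show "mop_fun T G ((xs ! 0) i) ((xs ! 1) i) (u i) \<noteq> Zero"
        proof (cases "i \<in> RR")
          case True
          then show ?thesis using live(2)[OF i] ap aR by simp
        next
          case False
          then have "(xs ! 0) i = One \<and> (xs ! 1) i = One"
            using live(2)[OF i] aP[of i] i mop_P[OF GM] unfolding ap by (auto split: if_splits)
          moreover have "u i \<in> Pset" using reach_type[OF u(1) i] False by simp
          ultimately show ?thesis using mop_P[OF GM] by auto
        qed
      qed (use ap aR in auto)
    next
      assume f: "f = U1Op G"
      then have ap: "ap i s v = Uone T G ((xs ! 0) i) ((xs ! 1) i) ((xs ! 2) i) v" for i v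
        unfolding at using ok wfs by (simp del: mop_fun.simps)
      have S3: "xs ! 0 \<in> S" "xs ! 1 \<in> S" "xs ! 2 \<in> S" using xsS f by auto
      have un: "Uone T G ((xs ! 0) i) ((xs ! 1) i) ((xs ! 2) i) (a i) \<noteq> Zero" if "i \<in> QQ" for i
        using live(2)[OF that] by (simp add: ap)
      have nz: "mop_fun T G ((xs ! 0) i) ((xs ! 1) i) (u i) \<noteq> Zero" if i: "i \<in> QQ" for i
      proof (cases "i \<in> RR")
        case True
        then show ?thesis using Uone_nonzero[OF GM un[OF i]] aR by simp
      next
        case False
        then have "(xs ! 0) i = One \<and> (xs ! 1) i = One"
          using un[OF i] aP[of i] i Uone_P[OF GM] by (auto split: if_splits)
        moreover have "u i \<in> Pset" using reach_type[OF u(1) i] False by simp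
        ultimately show ?thesis using mop_P[OF GM] by auto
      qed
      have pr: "prec ((xs ! 0) i) ((xs ! 2) i)" if "i \<in> QQ" for i
        using Uone_nonzero[OF GM un[OF that]] by simp
      \<comment> \<open>Both competitors succeed x on the live coordinates, so U1 never takes its
        barred branch there.\<close>
      have eq: "(xs ! 2) i = (xs ! 1) i" if "i \<in> QQ" for i
        by (rule uniq_right[OF u(1) GM S3 nz pr that])
      show ?thesis
      proof (rule that[OF S3(1,2) nz])
        fix i assume i: "i \<in> RR"
        show "ap i s (a i) = mop_fun T G ((xs ! 0) i) ((xs ! 1) i) (u i)"
          using Uone_nonzero[OF GM un[OF RR_QQ[OF i]]] eq[OF RR_QQ[OF i]] aR[OF i] VB_not_Pset unfolding ap by auto
      qed
    next
      assume f: "f = U2Op G"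
      then have ap: "ap i s v = Utwo T G ((xs ! 0) i) ((xs ! 1) i) ((xs ! 2) i) v" for i v
        unfolding at using ok wfs by (simp del: mop_fun.simps)
      have S3: "xs ! 1 \<in> S" "xs ! 2 \<in> S" "xs ! 0 \<in> S" using xsS f by auto
      have un: "Utwo T G ((xs ! 0) i) ((xs ! 1) i) ((xs ! 2) i) (a i) \<noteq> Zero" if "i \<in> QQ" for i
        using live(2)[OF that] by (simp add: ap)
      have one: "(xs ! 0) i = One \<and> (xs ! 1) i = One \<and> (xs ! 2) i = One" if i: "i \<in> QQ - RR" for i
        using un[of i] aP[of i] i Utwo_P[OF GM] by (auto split: if_splits)
      have nz: "mop_fun T G ((xs ! 1) i) ((xs ! 2) i) (u i) \<noteq> Zero" if i: "i \<in> QQ" for i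
      proof (cases "i \<in> RR")
        case True
        then show ?thesis using Utwo_nonzero[OF GM un[OF i]] aR by simp
      next
        case False
        then have "u i \<in> Pset" using reach_type[OF u(1) i] by simp
        then show ?thesis using mop_P[OF GM] one[of i] False i by auto
      qed
      have pr: "prec ((xs ! 0) i) ((xs ! 2) i)" if "i \<in> QQ" for i
        using Utwo_nonzero[OF GM un[OF that]] by simp
      have one0: "(xs ! 0) i = One" if "i \<in> QQ - RR" for i
        using one[OF that] by simp
      have eq: "(xs ! 0) i = (xs ! 1) i" if "i \<in> QQ" for i
        by (rule uniq_left[OF u(1) GM S3 nz pr one0 that])
      show ?thesis
      proof (rule that[OF S3(1,2) nz])
        fix i assume i: "i \<in> RR"
        show "ap i s (a i) = mop_fun T G ((xs ! 1) i) ((xs ! 2) i) (u i)"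
          using Utwo_nonzero[OF GM un[OF RR_QQ[OF i]]] eq[OF RR_QQ[OF i]] aR[OF i] VB_not_Pset unfolding ap by auto
      qed
    qed
    have "reach (vop (MOp G) [x, y, u])" by (rule reach.move[OF u(1) GM xy nz])
    then show ?thesis
      using val P' run' QQ_I RR_QQ by (intro exI[of _ "vop (MOp G) [x, y, u]"]) (auto simp del: mop_fun.simps)
  qed
qed

text \<open>The path continues with T0, which sends every letter outside \<open>V0\<close> to
  \<open>Zero\<close>; that would be a loss on a live coordinate.\<close>

lemma reach_V0: "\<exists>u. reach u \<and> (\<forall>i\<in>RR. u i \<in> V0)"
proof -
  obtain u where u: "reach u" "\<forall>i\<in>RR. run i \<pi> (z i) = u i" using path_reach[of \<pi> "[]"] by auto
  have "u i \<in> V0" if i: "i \<in> RR" for i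
  proof -
    obtain xs j where st: "st = (T0Op, xs, j)" using st0 by (cases st) auto
    have "wf_step st" using wf\<rho> by (simp add: \<rho>_def)
    then have "j = 0" "length xs = 1" by (auto simp: wf_step_def st)
    then have "ap i st x = T0 x" for x by (simp add: ap_def st)
    then have "T0 (u i) \<noteq> Zero" using live_step[OF \<rho>_def RR_QQ[OF i]] u(2) i by auto
    moreover have "u i \<in> VB" using reach_type[OF u(1) RR_QQ[OF i]] i by simp
    ultimately show ?thesis using T0_nonzero[of "u i"] VB_not_Pset by blast
  qed
  then show ?thesis using u(1) by blast
qed

end

section \<open>Simulating the Turing machine\<close>

lemma step_det: "step T x y \<Longrightarrow> step T x y' \<Longrightarrow> y = y'"
  by (auto elim!: step.cases)

lemma no_step_halted: "\<not> step T (0, h, tape) y"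
  by (auto elim!: step.cases)

text \<open>Reverse operations allow a chain to undo steps, so a chain yields only a path in the
  symmetric closure of \<open>step\<close>.\<close>

definition conn :: "turing \<Rightarrow> config \<Rightarrow> config \<Rightarrow> bool" where
  "conn T = (\<lambda>x y. step T x y \<or> step T y x)\<^sup>*\<^sup>*"

text \<open>For a backward step from x to y, the forward run of y to the halted configuration is not
  empty, and by determinism its first step leads to x.\<close>

lemma conn_halted:
  assumes "conn T x (0, h, tape)"
  shows "(step T)\<^sup>*\<^sup>* x (0, h, tape)"
  using assms unfolding conn_def
proof (induction rule: converse_rtranclp_induct)
  case (step x y)
  from step.hyps(1) show ?case
  proof
    assume "step T x y"
    then show ?thesis using step.IH by (rule converse_rtranclp_into_rtranclp)
  next
    assume yx: "step T y x"
    from step.IH show ?thesis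
    proof (cases rule: converse_rtranclpE)
      case base
      then show ?thesis using yx no_step_halted by blast
    next
      case (step y')
      then show ?thesis using step_det[OF yx] by simp
    qed
  qed
qed simp

text \<open>Under the head the letter is M, which carries no content of its own, so c is recovered
  only at the other two locations.\<close>

lemma enc_inject:
  "q \<in> Uset \<Longrightarrow> enc j r c q = enc j' r' c' q' \<Longrightarrow> q' \<in> Uset \<Longrightarrow>
    j = j' \<and> r = r' \<and> q = q' \<and> (q \<noteq> H \<longrightarrow> c = c')"
  by (auto simp: enc_def Uset_def split: if_splits)

lemma mop_Vel:
  assumes "G \<in> Mset T" "mop_fun T G x y (Vel v) \<noteq> Zero"
  obtains i r t v' where "i \<in> {1..num_states T}" "mop_fun T G x y (Vel v) = Vel v'"
    "G = Fwd i r t \<and> move_V T i r t x y v = Some v' \<or> G = Rev i r t \<and> move_V T i r t x y v' = Some v"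
proof (cases G)
  case (Fwd i r t)
  then have "i \<in> {1..num_states T}" using assms by (auto simp: Mset_def)
  moreover obtain v' where "move_V T i r t x y v = Some v'"
    using assms Fwd by (auto simp: move_def split: option.splits)
  ultimately show ?thesis using that[of i v' r t] Fwd by (auto simp: move_def)
next
  case (Rev i r t)
  then have i: "i \<in> {1..num_states T}" using assms by (auto simp: Mset_def)
  have "move T i r t x y (mop_fun T G x y (Vel v)) = Vel v"
    using rev_iff[OF i assms(2), of r t x y "Vel v"] Rev by blast
  moreover obtain v' where "mop_fun T G x y (Vel v) = Vel v'" "move_V T i r t x y v' = Some v"
    using calculation mop_nonzero[OF assms(1) refl assms(2)]
    by (cases "mop_fun T G x y (Vel v)") (auto simp: move_def split: option.splits if_splits)
  ultimately show ?thesis using that[of i v' r t] i Rev by blast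
qed

section \<open>The tape formed by the live coordinates\<close>

context core_c
begin

text \<open>The vectors \<open>p lo, \<dots>, p hi\<close> are the visited tape squares: the coordinates where \<open>p q\<close> is
  \<open>H\<close> stand for square \<open>q\<close>, and \<open>p q\<close> is \<open>One\<close> to the left of it and \<open>Two\<close> to the right.\<close>

definition track :: "int \<Rightarrow> int \<Rightarrow> (int \<Rightarrow> 'i \<Rightarrow> elt) \<Rightarrow> bool" where
  "track lo hi p \<longleftrightarrow>
    (\<forall>q\<in>{lo..hi}. (\<forall>i\<in>QQ. p q i \<in> Uset) \<and> (\<forall>i\<in>QQ - RR. p q i = One) \<and> (\<exists>i\<in>RR. p q i = H)) \<and>
    (\<forall>q\<in>{lo..<hi}. \<forall>i\<in>QQ. prec (p q i) (p (q + 1) i)) \<and>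
    (lo < hi \<longrightarrow> (\<forall>q\<in>{lo..hi}. \<exists>x\<in>S. \<forall>i\<in>QQ. x i = p q i))"

text \<open>The function ct gives the content of the square to which a coordinate belongs. A
  coordinate whose square has not been visited has content \<open>S0\<close>, in accordance with the
  blank rest of the tape.\<close>

definition repr :: "('i \<Rightarrow> elt) \<Rightarrow> nat \<Rightarrow> int \<Rightarrow> (int \<Rightarrow> tsym) \<Rightarrow> int \<Rightarrow> int \<Rightarrow> (int \<Rightarrow> 'i \<Rightarrow> elt) \<Rightarrow>
    ('i \<Rightarrow> tsym) \<Rightarrow> bool" where
  "repr u s h tape lo hi p ct \<longleftrightarrow> h \<in> {lo..hi} \<and> track lo hi p \<and>
    (\<forall>q. q \<notin> {lo..hi} \<longrightarrow> tape q = S0) \<and>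
    (\<forall>i\<in>RR. u i = Vel (enc s (tape h) (ct i) (p h i))) \<and>
    (\<forall>i\<in>RR. \<forall>q\<in>{lo..hi}. p q i = H \<longrightarrow> ct i = tape q) \<and>
    (\<forall>i\<in>RR. (\<forall>q\<in>{lo..hi}. p q i \<noteq> H) \<longrightarrow> ct i = S0)"

lemma trackD:
  assumes "track lo hi p" "q \<in> {lo..hi}"
  shows track_U: "i \<in> QQ \<Longrightarrow> p q i \<in> Uset" and track_One: "i \<in> QQ - RR \<Longrightarrow> p q i = One"
    and track_H: "\<exists>i\<in>RR. p q i = H" and track_S: "lo < hi \<Longrightarrow> \<exists>x\<in>S. \<forall>i\<in>QQ. x i = p q i"
  using assms unfolding track_def by blast+

lemma track_prec: "track lo hi p \<Longrightarrow> lo \<le> q \<Longrightarrow> q < hi \<Longrightarrow> i \<in> QQ \<Longrightarrow> prec (p q i) (p (q + 1) i)"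
  unfolding track_def by simp

text \<open>From left to right \<open>prec\<close> allows only a run of \<open>Two\<close>, then one
  \<open>H\<close>, then a run of \<open>One\<close>. So a coordinate belongs to at most one
  square.\<close>

lemma track_right:
  assumes "track lo hi p" "i \<in> QQ" "lo \<le> q" "p q i = H \<or> p q i = One"
  shows "q < q' \<Longrightarrow> q' \<le> hi \<Longrightarrow> p q' i = One"
proof (induction rule: int_gr_induct)
  case base
  then have "prec (p q i) (p (q + 1) i)" using track_prec[OF assms(1,3) _ assms(2)] by simp
  then show ?case using assms(4) by (auto simp: prec_def)
next
  case (step q')
  then have "prec (p q' i) (p (q' + 1) i)" using track_prec[OF assms(1) _ _ assms(2), of q'] assms(3) by simp
  then show ?case using step by (auto simp: prec_def)
qed

lemma track_unique:
  assumes "track lo hi p" "i \<in> QQ" "q \<in> {lo..hi}" "q' \<in> {lo..hi}" "p q i = H" "p q' i = H"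
  shows "q = q'"
proof (rule ccontr)
  assume "q \<noteq> q'"
  then consider "q < q'" | "q' < q" by linarith
  then show False
    using track_right[OF assms(1,2), of q q'] track_right[OF assms(1,2), of q' q] assms(3-6) by cases auto
qed

text \<open>Inside the visited range the right neighbour of the head lies in S, and uniqueness
  identifies it with y. At the right end, y becomes a new square, blank so far.\<close>

lemma repr_extend_right:
  assumes r: "repr u s h tape lo hi p ct" and x: "x \<in> S" and y: "y \<in> S"
    and xy: "\<And>i. i \<in> QQ \<Longrightarrow> prec (x i) (y i)" and y1: "\<And>i. i \<in> QQ - RR \<Longrightarrow> y i = One"
    and px: "\<And>i. i \<in> QQ \<Longrightarrow> x i = p h i"
    and un: "\<And>y' i. y' \<in> S \<Longrightarrow> (\<And>i. i \<in> QQ \<Longrightarrow> prec (x i) (y' i)) \<Longrightarrow> i \<in> QQ \<Longrightarrow> y' i = y i"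
  shows "\<exists>hi' p'. repr u s h tape lo hi' p' ct \<and> h + 1 \<in> {lo..hi'} \<and> (\<forall>i\<in>QQ. p' (h + 1) i = y i) \<and>
    (\<forall>i\<in>QQ. p' h i = x i)"
proof (cases "h < hi")
  case True
  have tk: "track lo hi p" and h: "h \<in> {lo..hi}" using r by (auto simp: repr_def)
  then obtain y' where y': "y' \<in> S" "\<forall>i\<in>QQ. y' i = p (h + 1) i"
    using track_S[OF tk, of "h + 1"] True by auto
  have "prec (x i) (y' i)" if "i \<in> QQ" for i
    using track_prec[OF tk _ True that] h px[OF that] y'(2) that by simp
  then have "y' i = y i" if "i \<in> QQ" for i using un[OF y'(1) _ that] by blast
  then show ?thesis using r h True y' px by (intro exI[of _ hi] exI[of _ p]) auto
next
  case False
  have tk: "track lo hi p" and h: "h = hi" "lo \<le> hi" using r False by (auto simp: repr_def)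
  define p' where "p' = p(hi + 1 := y)"
  have p'old: "p' q = p q" if "q \<le> hi" for q using that by (simp add: p'_def)
  have p'new: "p' (hi + 1) = y" by (simp add: p'_def)
  have yU: "y i \<in> Uset" if "i \<in> QQ" for i using xy[OF that] prec_Uset by blast
  \<comment> \<open>Some coordinate must lie under the new square.\<close>
  obtain j where j: "j \<in> RR" "y j \<notin> {One, Two}" using N1[OF y] by blast
  then have jH: "y j = H" using yU[OF RR_QQ[OF j(1)]] by (auto simp: Uset_def)
  \<comment> \<open>With a single visited square, \<open>track\<close> says nothing about S; there x
    itself is the required vector.\<close>
  have mem: "\<exists>v\<in>S. \<forall>i\<in>QQ. v i = p q i" if q: "q \<in> {lo..hi}" for q
  proof (cases "lo < hi")
    case True
    then show ?thesis using track_S[OF tk q] by blast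
  next
    case False
    then have "q = h" using q h by simp
    then show ?thesis using x px by auto
  qed
  have "track lo (hi + 1) p'"
    unfolding track_def
  proof (intro conjI impI)
    show "\<forall>q\<in>{lo..hi + 1}. (\<forall>i\<in>QQ. p' q i \<in> Uset) \<and> (\<forall>i\<in>QQ - RR. p' q i = One) \<and> (\<exists>i\<in>RR. p' q i = H)"
    proof
      fix q assume "q \<in> {lo..hi + 1}"
      then consider "q \<in> {lo..hi}" | "q = hi + 1" by fastforce
      then show "(\<forall>i\<in>QQ. p' q i \<in> Uset) \<and> (\<forall>i\<in>QQ - RR. p' q i = One) \<and> (\<exists>i\<in>RR. p' q i = H)"
      proof cases
        case 1
        then have "p' q = p q" using p'old by simp
        then show ?thesis using track_U[OF tk 1] track_One[OF tk 1] track_H[OF tk 1] by simp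
      next
        case 2
        then show ?thesis using p'new yU y1 j(1) jH by auto
      qed
    qed
    show "\<forall>q\<in>{lo..<hi + 1}. \<forall>i\<in>QQ. prec (p' q i) (p' (q + 1) i)"
    proof (intro ballI)
      fix q i assume q: "q \<in> {lo..<hi + 1}" and i: "i \<in> QQ"
      show "prec (p' q i) (p' (q + 1) i)"
      proof (cases "q < hi")
        case True
        then show ?thesis using track_prec[OF tk _ _ i, of q] p'old[of q] p'old[of "q + 1"] q by simp
      next
        case False
        then have "q = h" using q h by simp
        then show ?thesis using xy[OF i] px[OF i] p'old[of q] p'new h by simp
      qed
    qed
    show "\<forall>q\<in>{lo..hi + 1}. \<exists>v\<in>S. \<forall>i\<in>QQ. v i = p' q i"
    proof
      fix q assume "q \<in> {lo..hi + 1}"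
      then consider "q \<in> {lo..hi}" | "q = hi + 1" by fastforce
      then show "\<exists>v\<in>S. \<forall>i\<in>QQ. v i = p' q i"
      proof cases
        case 1
        then show ?thesis using mem[OF 1] p'old[of q] by simp
      next
        case 2
        then show ?thesis using y p'new by auto
      qed
    qed
  qed
  note tk' = this
  \<comment> \<open>A coordinate under the new square belongs to no earlier one, so its content is
    still \<open>S0\<close>, as on the unvisited tape.\<close>
  have noH: "p q i \<noteq> H" if "i \<in> RR" "y i = H" "q \<in> {lo..hi}" for q i
    using track_right[OF tk' RR_QQ[OF that(1)], of q "hi + 1"] that p'old[of q] p'new by auto
  have "ct i = tape q" if i: "i \<in> RR" and q: "q \<in> {lo..hi + 1}" "p' q i = H" for i q
  proof (cases "q \<le> hi")
    case True
    then show ?thesis using r q i p'old[of q] by (auto simp: repr_def)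
  next
    case False
    then have "q = hi + 1" using q by simp
    moreover have "ct i = S0" using r noH[OF i] i q(2) \<open>q = hi + 1\<close> p'new by (simp add: repr_def)
    moreover have "tape (hi + 1) = S0" using r by (simp add: repr_def)
    ultimately show ?thesis by simp
  qed
  moreover have "ct i = S0" if i: "i \<in> RR" and q: "\<And>q. q \<in> {lo..hi + 1} \<Longrightarrow> p' q i \<noteq> H" for i
  proof -
    have "p q i \<noteq> H" if "q \<in> {lo..hi}" for q using q[of q] p'old[of q] that by simp
    then show ?thesis using r i by (auto simp: repr_def)
  qed
  ultimately have "repr u s h tape lo (hi + 1) p' ct"
    using r tk' h p'old[of h] unfolding repr_def by auto
  then show ?thesis using h p'new p'old[of h] px by (intro exI[of _ "hi + 1"] exI[of _ p']) auto
qed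

text \<open>The mirror image. Uniqueness to the left is available only for vectors that are
  \<open>One\<close> on the coordinates carrying P, which \<open>track\<close> guarantees for the
  visited squares.\<close>

lemma repr_extend_left:
  assumes r: "repr u s h tape lo hi p ct" and x: "x \<in> S" and y: "y \<in> S"
    and xy: "\<And>i. i \<in> QQ \<Longrightarrow> prec (x i) (y i)" and x1: "\<And>i. i \<in> QQ - RR \<Longrightarrow> x i = One"
    and py: "\<And>i. i \<in> QQ \<Longrightarrow> y i = p h i"
    and un: "\<And>x' i. x' \<in> S \<Longrightarrow> (\<And>i. i \<in> QQ \<Longrightarrow> prec (x' i) (y i)) \<Longrightarrow>
      (\<And>i. i \<in> QQ - RR \<Longrightarrow> x' i = One) \<Longrightarrow> i \<in> QQ \<Longrightarrow> x' i = x i"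
  shows "\<exists>lo' p'. repr u s h tape lo' hi p' ct \<and> h - 1 \<in> {lo'..hi} \<and> (\<forall>i\<in>QQ. p' (h - 1) i = x i) \<and>
    (\<forall>i\<in>QQ. p' h i = y i)"
proof (cases "lo < h")
  case True
  have tk: "track lo hi p" and h: "h \<in> {lo..hi}" using r by (auto simp: repr_def)
  then obtain x' where x': "x' \<in> S" "\<forall>i\<in>QQ. x' i = p (h - 1) i"
    using track_S[OF tk, of "h - 1"] True by auto
  have "prec (p (h - 1) i) (p (h - 1 + 1) i)" if "i \<in> QQ" for i
    using track_prec[OF tk _ _ that, of "h - 1"] h True by simp
  then have "prec (x' i) (y i)" if "i \<in> QQ" for i using py that x' by simp
  moreover have "x' i = One" if "i \<in> QQ - RR" for i
    using track_One[OF tk _ that, of "h - 1"] h True x'(2) that by simp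
  ultimately have "x' i = x i" if "i \<in> QQ" for i using un[OF x'(1) _ _ that] by blast
  then show ?thesis using r h True x' py by (intro exI[of _ lo] exI[of _ p]) auto
next
  case False
  have tk: "track lo hi p" and h: "h = lo" "lo \<le> hi" using r False by (auto simp: repr_def)
  define p' where "p' = p(lo - 1 := x)"
  have p'old: "p' q = p q" if "lo \<le> q" for q using that by (simp add: p'_def)
  have p'new: "p' (lo - 1) = x" by (simp add: p'_def)
  have xU: "x i \<in> Uset" if "i \<in> QQ" for i using xy[OF that] prec_Uset by blast
  obtain j where j: "j \<in> RR" "x j \<notin> {One, Two}" using N1[OF x] by blast
  then have jH: "x j = H" using xU[OF RR_QQ[OF j(1)]] by (auto simp: Uset_def)
  have mem: "\<exists>v\<in>S. \<forall>i\<in>QQ. v i = p q i" if q: "q \<in> {lo..hi}" for q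
  proof (cases "lo < hi")
    case True
    then show ?thesis using track_S[OF tk q] by blast
  next
    case False
    then have "q = h" using q h by simp
    then show ?thesis using y py by auto
  qed
  have "track (lo - 1) hi p'"
    unfolding track_def
  proof (intro conjI impI)
    show "\<forall>q\<in>{lo - 1..hi}. (\<forall>i\<in>QQ. p' q i \<in> Uset) \<and> (\<forall>i\<in>QQ - RR. p' q i = One) \<and> (\<exists>i\<in>RR. p' q i = H)"
    proof
      fix q assume "q \<in> {lo - 1..hi}"
      then consider "q \<in> {lo..hi}" | "q = lo - 1" by fastforce
      then show "(\<forall>i\<in>QQ. p' q i \<in> Uset) \<and> (\<forall>i\<in>QQ - RR. p' q i = One) \<and> (\<exists>i\<in>RR. p' q i = H)"
      proof cases
        case 1
        then have "p' q = p q" using p'old by simp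
        then show ?thesis using track_U[OF tk 1] track_One[OF tk 1] track_H[OF tk 1] by simp
      next
        case 2
        then show ?thesis using p'new xU x1 j(1) jH by auto
      qed
    qed
    show "\<forall>q\<in>{lo - 1..<hi}. \<forall>i\<in>QQ. prec (p' q i) (p' (q + 1) i)"
    proof (intro ballI)
      fix q i assume q: "q \<in> {lo - 1..<hi}" and i: "i \<in> QQ"
      show "prec (p' q i) (p' (q + 1) i)"
      proof (cases "lo \<le> q")
        case True
        then show ?thesis using track_prec[OF tk _ _ i, of q] p'old[of q] p'old[of "q + 1"] q by simp
      next
        case False
        then have "q = lo - 1" using q by simp
        then show ?thesis using xy[OF i] py[OF i] p'old[of h] p'new h by simp
      qed
    qed
    show "\<forall>q\<in>{lo - 1..hi}. \<exists>v\<in>S. \<forall>i\<in>QQ. v i = p' q i"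
    proof
      fix q assume "q \<in> {lo - 1..hi}"
      then consider "q \<in> {lo..hi}" | "q = lo - 1" by fastforce
      then show "\<exists>v\<in>S. \<forall>i\<in>QQ. v i = p' q i"
      proof cases
        case 1
        then show ?thesis using mem[OF 1] p'old[of q] by simp
      next
        case 2
        then show ?thesis using x p'new by auto
      qed
    qed
  qed
  note tk' = this
  have noH: "p q i \<noteq> H" if "i \<in> RR" "x i = H" "q \<in> {lo..hi}" for q i
    using track_right[OF tk' RR_QQ[OF that(1)], of "lo - 1" q] that p'old[of q] p'new by auto
  have "ct i = tape q" if i: "i \<in> RR" and q: "q \<in> {lo - 1..hi}" "p' q i = H" for i q
  proof (cases "lo \<le> q")
    case True
    then show ?thesis using r q i p'old[of q] by (auto simp: repr_def)
  next
    case False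
    then have "q = lo - 1" using q by simp
    moreover have "ct i = S0" using r noH[OF i] i q(2) \<open>q = lo - 1\<close> p'new by (simp add: repr_def)
    moreover have "tape (lo - 1) = S0" using r by (simp add: repr_def)
    ultimately show ?thesis by simp
  qed
  moreover have "ct i = S0" if i: "i \<in> RR" and q: "\<And>q. q \<in> {lo - 1..hi} \<Longrightarrow> p' q i \<noteq> H" for i
  proof -
    have "p q i \<noteq> H" if "q \<in> {lo..hi}" for q using q[of q] p'old[of q] that by simp
    then show ?thesis using r i by (auto simp: repr_def)
  qed
  ultimately have "repr u s h tape (lo - 1) hi p' ct"
    using r tk' h p'old[of h] unfolding repr_def by auto
  then show ?thesis using h p'new p'old[of h] py by (intro exI[of _ "lo - 1"] exI[of _ p']) auto
qed

lemma RR_ne: "\<exists>i. i \<in> RR" using N3 by blast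

text \<open>On \<open>RR\<close> the letters of \<open>V10\<close> are the encodings of a blank
  square in state 1 at the three locations, so the position vector is read off z, and
  \<open>N3\<close> puts a coordinate under the head. This vector is not known to come from S, which
  is why \<open>track\<close> asks for membership in S only when lo < hi.\<close>

lemma start_repr: "\<exists>p ct. repr z 1 0 (\<lambda>_. S0) 0 0 p ct"
proof -
  define p :: "int \<Rightarrow> 'i \<Rightarrow> elt" where "p q i = (if i \<in> RR then
      (if z i = Vel (C 1 S0 S0) then One else if z i = Vel (M 1 S0) then H else Two) else One)" for q i
  have "repr z 1 0 (\<lambda>_. S0) 0 0 p (\<lambda>_. S0)"
    unfolding repr_def track_def
    using N3 by (auto simp: p_def enc_def RR_def V10_def)
  then show ?thesis by blast
qed

text \<open>Each letter fixes the state and the symbol read. That the guessed symbol t is the one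
  really found at h' is seen at a coordinate lying under h'.\<close>

lemma move_fwd:
  assumes r: "repr u s h tape lo hi p ct" and i0: "i0 \<in> {1..num_states T}"
    and ins: "instr T i0 rd = (wr, d, m)" and h': "h' \<in> {lo..hi}" "h' = (case d of L \<Rightarrow> h - 1 | R \<Rightarrow> h + 1)"
    and mv: "\<And>i. i \<in> RR \<Longrightarrow> \<exists>c. (p h i = H \<longrightarrow> c = rd) \<and> (p h' i = H \<longrightarrow> c = t) \<and>
      u i = Vel (enc i0 rd c (p h i)) \<and> u' i = Vel (enc m t (if p h i = H then wr else c) (p h' i))"
  shows "\<exists>ct'. step T (s, h, tape) (m, h', tape(h := wr)) \<and> repr u' m h' (tape(h := wr)) lo hi p ct'"
proof -
  have tk: "track lo hi p" and h: "h \<in> {lo..hi}"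
    and u: "\<And>i. i \<in> RR \<Longrightarrow> u i = Vel (enc s (tape h) (ct i) (p h i))"
    and ct: "\<And>i q. i \<in> RR \<Longrightarrow> q \<in> {lo..hi} \<Longrightarrow> p q i = H \<Longrightarrow> ct i = tape q"
    and ct0: "\<And>i. i \<in> RR \<Longrightarrow> \<forall>q\<in>{lo..hi}. p q i \<noteq> H \<Longrightarrow> ct i = S0"
    and tp: "\<And>q. q \<notin> {lo..hi} \<Longrightarrow> tape q = S0"
    using r unfolding repr_def by blast+
  have U: "p h i \<in> Uset" if "i \<in> RR" for i
    using tk h RR_QQ[OF that] unfolding track_def by blast
  have hh': "h' \<noteq> h" using h'(2) by (cases d) auto
  have *: "i0 = s \<and> rd = tape h \<and> u' i = Vel (enc m t (if p h i = H then wr else ct i) (p h' i)) \<and>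
      (p h' i = H \<longrightarrow> p h i \<noteq> H \<longrightarrow> ct i = t)" if i: "i \<in> RR" for i
  proof -
    obtain c where c: "p h i = H \<longrightarrow> c = rd" "p h' i = H \<longrightarrow> c = t"
      "u i = Vel (enc i0 rd c (p h i))" "u' i = Vel (enc m t (if p h i = H then wr else c) (p h' i))"
      using mv[OF i] by blast
    have "enc i0 rd c (p h i) = enc s (tape h) (ct i) (p h i)" using c(3) u[OF i] by simp
    then have "i0 = s \<and> rd = tape h \<and> (p h i \<noteq> H \<longrightarrow> c = ct i)"
      using enc_inject[OF U[OF i] _ U[OF i]] by blast
    then show ?thesis using c by auto
  qed
  obtain i1 where i1: "i1 \<in> RR" "p h' i1 = H" using tk h'(1) unfolding track_def by blast
  have s: "i0 = s" "rd = tape h" using *[OF i1(1)] by auto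
  \<comment> \<open>A coordinate belongs to one square only, so this one is unaffected by the write
    at h.\<close>
  have "p h i1 \<noteq> H" using track_unique[OF tk RR_QQ[OF i1(1)] h h'(1)] i1(2) hh' by blast
  then have t: "t = (tape(h := wr)) h'" using *[OF i1(1)] i1 ct[OF i1(1) h'(1)] hh' by auto
  define ct' where "ct' i = (if p h i = H then wr else ct i)" for i
  have st: "step T (s, h, tape) (m, h', tape(h := wr))"
    unfolding h'(2) by (rule step.intros) (use i0 ins s in auto)
  have "repr u' m h' (tape(h := wr)) lo hi p ct'"
    unfolding repr_def
  proof (intro conjI ballI impI allI)
    show "u' i = Vel (enc m ((tape(h := wr)) h') (ct' i) (p h' i))" if "i \<in> RR" for i
      using *[OF that] t by (simp add: ct'_def)
    show "ct' i = (tape(h := wr)) q" if "i \<in> RR" "q \<in> {lo..hi}" "p q i = H" for i q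
    proof (cases "q = h")
      case False
      then have "p h i \<noteq> H" using track_unique[OF tk RR_QQ[OF that(1)] that(2) h that(3)] by blast
      then show ?thesis using ct[OF that] False by (simp add: ct'_def)
    qed (use that in \<open>simp add: ct'_def\<close>)
    show "ct' i = S0" if "i \<in> RR" "\<forall>q\<in>{lo..hi}. p q i \<noteq> H" for i
      using ct0[OF that] that(2) h by (simp add: ct'_def)
  qed (use tk h h' tp in auto)
  then show ?thesis using st by blast
qed

text \<open>The predecessor configuration has rd at h'. It really steps to the present one because a
  coordinate under h' shows that the tape holds wr there.\<close>

lemma move_rev:
  assumes r: "repr u s h tape lo hi p ct" and i0: "i0 \<in> {1..num_states T}"
    and ins: "instr T i0 rd = (wr, d, m)" and h': "h' \<in> {lo..hi}" "h = (case d of L \<Rightarrow> h' - 1 | R \<Rightarrow> h' + 1)"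
    and mv: "\<And>i. i \<in> RR \<Longrightarrow> \<exists>c. (p h' i = H \<longrightarrow> c = rd) \<and> (p h i = H \<longrightarrow> c = t) \<and>
      u' i = Vel (enc i0 rd c (p h' i)) \<and> u i = Vel (enc m t (if p h' i = H then wr else c) (p h i))"
  shows "\<exists>ct'. step T (i0, h', tape(h' := rd)) (s, h, tape) \<and> repr u' i0 h' (tape(h' := rd)) lo hi p ct'"
proof -
  have tk: "track lo hi p" and h: "h \<in> {lo..hi}"
    and u: "\<And>i. i \<in> RR \<Longrightarrow> u i = Vel (enc s (tape h) (ct i) (p h i))"
    and ct: "\<And>i q. i \<in> RR \<Longrightarrow> q \<in> {lo..hi} \<Longrightarrow> p q i = H \<Longrightarrow> ct i = tape q"
    and ct0: "\<And>i. i \<in> RR \<Longrightarrow> \<forall>q\<in>{lo..hi}. p q i \<noteq> H \<Longrightarrow> ct i = S0"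
    and tp: "\<And>q. q \<notin> {lo..hi} \<Longrightarrow> tape q = S0"
    using r unfolding repr_def by blast+
  have U: "p h i \<in> Uset" if "i \<in> RR" for i
    using tk h RR_QQ[OF that] unfolding track_def by blast
  have hh': "h' \<noteq> h" using h'(2) by (cases d) auto
  have *: "m = s \<and> t = tape h \<and> u' i = Vel (enc i0 rd (if p h' i = H then rd else ct i) (p h' i)) \<and>
      (p h' i = H \<longrightarrow> ct i = wr)" if i: "i \<in> RR" for i
  proof -
    obtain c where c: "p h' i = H \<longrightarrow> c = rd" "p h i = H \<longrightarrow> c = t"
      "u' i = Vel (enc i0 rd c (p h' i))" "u i = Vel (enc m t (if p h' i = H then wr else c) (p h i))"
      using mv[OF i] by blast
    have "enc m t (if p h' i = H then wr else c) (p h i) = enc s (tape h) (ct i) (p h i)"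
      using c(4) u[OF i] by simp
    then have e: "m = s \<and> t = tape h \<and> (p h i \<noteq> H \<longrightarrow> (if p h' i = H then wr else c) = ct i)"
      using enc_inject[OF U[OF i] _ U[OF i]] by blast
    have "p h i = H \<Longrightarrow> p h' i \<noteq> H"
      using track_unique[OF tk RR_QQ[OF i] h h'(1)] hh' by blast
    moreover have "p h i = H \<Longrightarrow> c = ct i" using c(2) e ct[OF i h] by simp
    ultimately show ?thesis using c e by auto
  qed
  obtain i1 where i1: "i1 \<in> RR" "p h' i1 = H" using tk h'(1) unfolding track_def by blast
  have s: "m = s" "t = tape h" using *[OF i1(1)] by auto
  have wr: "tape h' = wr" using *[OF i1(1)] i1(2) ct[OF i1(1) h'(1) i1(2)] by simp
  define ct' where "ct' i = (if p h' i = H then rd else ct i)" for i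
  have "step T (i0, h', tape(h' := rd)) (m, (case d of L \<Rightarrow> h' - 1 | R \<Rightarrow> h' + 1), (tape(h' := rd))(h' := wr))"
    by (rule step.intros) (use i0 ins in auto)
  moreover have "(tape(h' := rd))(h' := wr) = tape" using wr by auto
  ultimately have st: "step T (i0, h', tape(h' := rd)) (s, h, tape)" using h'(2) s by simp
  have "repr u' i0 h' (tape(h' := rd)) lo hi p ct'"
    unfolding repr_def
  proof (intro conjI ballI impI allI)
    show "u' i = Vel (enc i0 ((tape(h' := rd)) h') (ct' i) (p h' i))" if "i \<in> RR" for i
      using *[OF that] by (simp add: ct'_def)
    show "ct' i = (tape(h' := rd)) q" if "i \<in> RR" "q \<in> {lo..hi}" "p q i = H" for i q
    proof (cases "q = h'")
      case False
      then have "p h' i \<noteq> H" using track_unique[OF tk RR_QQ[OF that(1)] that(2) h'(1) that(3)] by blast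
      then show ?thesis using ct[OF that] False by (simp add: ct'_def)
    qed (use that in \<open>simp add: ct'_def\<close>)
    show "ct' i = S0" if "i \<in> RR" "\<forall>q\<in>{lo..hi}. p q i \<noteq> H" for i
      using ct0[OF that] that(2) h'(1) by (simp add: ct'_def)
  qed (use tk h h' tp in auto)
  then show ?thesis using st by blast
qed

text \<open>A machine operation on the vectors is possible only if it agrees with the encoded
  configuration, so each one is a forward or backward step of the machine.\<close>

lemma reach_repr:
  "reach u \<Longrightarrow> \<exists>s h tape lo hi p ct. conn T (1, 0, \<lambda>_. S0) (s, h, tape) \<and> repr u s h tape lo hi p ct"
proof (induction rule: reach.induct)
  case start
  then show ?case using start_repr unfolding conn_def by blast
next
  case (move u G x y)
  let ?u' = "vop (MOp G) [x, y, u]"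
  obtain s h tape lo hi p ct where cn: "conn T (1, 0, \<lambda>_. S0) (s, h, tape)" and r: "repr u s h tape lo hi p ct"
    using move.IH by blast
  obtain i0 rd t where i0: "i0 \<in> {1..num_states T}" and G: "G = Fwd i0 rd t \<or> G = Rev i0 rd t"
    using move.hyps(2) by (auto simp: Mset_def)
  obtain wr d m where ins: "instr T i0 rd = (wr, d, m)" by (metis prod_cases3)
  have tk: "track lo hi p" and h: "h \<in> {lo..hi}"
    and u: "\<And>i. i \<in> RR \<Longrightarrow> u i = Vel (enc s (tape h) (ct i) (p h i))"
    using r unfolding repr_def by blast+
  have pU: "p h i \<in> Uset" if "i \<in> QQ" for i using tk h that unfolding track_def by blast
  have xy: "prec (x i) (y i)" if "i \<in> QQ" for i
    using mop_nonzero[OF move.hyps(2) refl move.hyps(5)[OF that]] by simp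
  have xU: "x i \<in> Uset" "y i \<in> Uset" if "i \<in> QQ" for i using xy[OF that] prec_Uset by blast+
  have one: "x i = One \<and> y i = One" if "i \<in> QQ - RR" for i
  proof -
    have i: "i \<in> QQ" "i \<notin> RR" using that by auto
    then have "u i \<in> Pset" using reach_type[OF move.hyps(1)] by simp
    then show ?thesis using mop_nonzero[OF move.hyps(2) refl move.hyps(5)[OF i(1)]] VB_not_Pset by blast
  qed
  have p1: "p h i = One" if "i \<in> QQ - RR" for i using tk h that unfolding track_def by blast
  \<comment> \<open>In the direction of the instruction the head goes from the square of q to that
    of q'. For a reverse operation the present head position is that of q'.\<close>
  define q where "q = (case d of L \<Rightarrow> y | R \<Rightarrow> x)"
  define q' where "q' = (case d of L \<Rightarrow> x | R \<Rightarrow> y)"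
  have qU: "q i \<in> Uset" "q' i \<in> Uset" if "i \<in> QQ" for i
    using xU[OF that] by (auto simp: q_def q'_def split: dir.splits)
  have mv: "\<exists>c. (q i = H \<longrightarrow> c = rd) \<and> (q' i = H \<longrightarrow> c = t) \<and>
      (if G = Fwd i0 rd t then u i else ?u' i) = Vel (enc i0 rd c (q i)) \<and>
      (if G = Fwd i0 rd t then ?u' i else u i) = Vel (enc m t (if q i = H then wr else c) (q' i))"
    if i: "i \<in> RR" for i
  proof -
    obtain v where v: "u i = Vel v" using u[OF i] by blast
    have nz: "mop_fun T G (x i) (y i) (Vel v) \<noteq> Zero" using move.hyps(5)[OF RR_QQ[OF i]] v by simp
    have u': "?u' i = mop_fun T G (x i) (y i) (Vel v)" using QQ_I[OF RR_QQ[OF i]] v by (simp del: mop_fun.simps)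
    obtain i0' rd' t' v' where m: "mop_fun T G (x i) (y i) (Vel v) = Vel v'"
      "G = Fwd i0' rd' t' \<and> move_V T i0' rd' t' (x i) (y i) v = Some v' \<or>
       G = Rev i0' rd' t' \<and> move_V T i0' rd' t' (x i) (y i) v' = Some v"
      by (rule mop_Vel[OF move.hyps(2) nz])
    have qq: "(case d of L \<Rightarrow> y i | R \<Rightarrow> x i) = q i" "(case d of L \<Rightarrow> x i | R \<Rightarrow> y i) = q' i"
      by (auto simp: q_def q'_def split: dir.splits)
    have "if G = Fwd i0 rd t then move_V T i0 rd t (x i) (y i) v = Some v'
       else move_V T i0 rd t (x i) (y i) v' = Some v" using m(2) G by auto
    then show ?thesis
      using m(1) v u' unfolding move_V_enc[OF ins] Let_def qq by (auto split: if_splits)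
  qed
  have conn': "conn T (1, 0, \<lambda>_. S0) c" if "step T (s, h, tape) c \<or> step T c (s, h, tape)" for c
    using cn that unfolding conn_def by (rule rtranclp.rtrancl_into_rtrancl)
  have ext_r: "\<exists>hi' p'. repr u s h tape lo hi' p' ct \<and> h + 1 \<in> {lo..hi'} \<and>
      (\<forall>i\<in>QQ. p' (h + 1) i = y i) \<and> (\<forall>i\<in>QQ. p' h i = x i)"
    if "\<And>i. i \<in> QQ \<Longrightarrow> x i = p h i"
  proof (rule repr_extend_right[OF r move.hyps(3,4)])
    fix y' i assume a: "y' \<in> S" "\<And>i. i \<in> QQ \<Longrightarrow> prec (x i) (y' i)" "i \<in> QQ"
    show "y' i = y i"
      by (rule uniq_right[of u G x y y' i]) (fact move.hyps a)+
  qed (use xy one that in simp_all)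
  have ext_l: "\<exists>lo' p'. repr u s h tape lo' hi p' ct \<and> h - 1 \<in> {lo'..hi} \<and>
      (\<forall>i\<in>QQ. p' (h - 1) i = x i) \<and> (\<forall>i\<in>QQ. p' h i = y i)"
    if "\<And>i. i \<in> QQ \<Longrightarrow> y i = p h i"
  proof (rule repr_extend_left[OF r move.hyps(3,4)])
    fix x' i assume a: "x' \<in> S" "\<And>i. i \<in> QQ \<Longrightarrow> prec (x' i) (y i)" "\<And>i. i \<in> QQ - RR \<Longrightarrow> x' i = One" "i \<in> QQ"
    show "x' i = x i"
      by (rule uniq_left[of u G x y x' i]) (fact move.hyps a)+
  qed (use xy one that in simp_all)
  show ?case
  proof (cases "G = Fwd i0 rd t")
    case True
    \<comment> \<open>The letters determine the location; on the coordinates carrying P both vectors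
      are \<open>One\<close>.\<close>
    have ph: "q i = p h i" if i: "i \<in> QQ" for i
    proof (cases "i \<in> RR")
      case True
      obtain c where "u i = Vel (enc i0 rd c (q i))" using mv[OF True] \<open>G = _\<close> by auto
      then have "enc i0 rd c (q i) = enc s (tape h) (ct i) (p h i)" using u[OF True] by simp
      then show ?thesis using enc_inject[OF qU(1)[OF i] _ pU[OF i]] by blast
    next
      case False
      then show ?thesis using one[of i] p1[of i] i by (auto simp: q_def split: dir.splits)
    qed
    define h' where "h' = (case d of L \<Rightarrow> h - 1 | R \<Rightarrow> h + 1)"
    have "\<exists>lo' hi' p'. repr u s h tape lo' hi' p' ct \<and> h' \<in> {lo'..hi'} \<and> (\<forall>i\<in>QQ. p' h' i = q' i) \<and>
      (\<forall>i\<in>QQ. p' h i = q i)"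
    proof (cases d)
      case R
      then have "x i = p h i" if "i \<in> QQ" for i using ph[OF that] by (simp add: q_def)
      from ext_r[OF this] show ?thesis unfolding q_def q'_def h'_def \<open>d = R\<close> by (simp, blast)
    next
      case L
      then have "y i = p h i" if "i \<in> QQ" for i using ph[OF that] by (simp add: q_def)
      from ext_l[OF this] show ?thesis unfolding q_def q'_def h'_def \<open>d = L\<close> by (simp, blast)
    qed
    then obtain lo' hi' p' where r': "repr u s h tape lo' hi' p' ct" and h': "h' \<in> {lo'..hi'}"
      and p': "\<And>i. i \<in> QQ \<Longrightarrow> p' h' i = q' i" "\<And>i. i \<in> QQ \<Longrightarrow> p' h i = q i" by blast
    have "\<exists>c. (p' h i = H \<longrightarrow> c = rd) \<and> (p' h' i = H \<longrightarrow> c = t) \<and>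
      u i = Vel (enc i0 rd c (p' h i)) \<and> ?u' i = Vel (enc m t (if p' h i = H then wr else c) (p' h' i))"
      if "i \<in> RR" for i using mv[OF that] p'[OF RR_QQ[OF that]] True by simp
    from move_fwd[OF r' i0 ins h' h'_def this] show ?thesis using conn' by blast
  next
    case False
    then have GR: "G = Rev i0 rd t" using G by blast
    have ph: "q' i = p h i" if i: "i \<in> QQ" for i
    proof (cases "i \<in> RR")
      case True
      obtain c where "u i = Vel (enc m t (if q i = H then wr else c) (q' i))" using mv[OF True] False by auto
      then have "enc m t (if q i = H then wr else c) (q' i) = enc s (tape h) (ct i) (p h i)"
        using u[OF True] by simp
      then show ?thesis using enc_inject[OF qU(2)[OF i] _ pU[OF i]] by blast
    next
      case False
      then show ?thesis using one[of i] p1[of i] i by (auto simp: q'_def split: dir.splits)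
    qed
    define h' where "h' = (case d of L \<Rightarrow> h + 1 | R \<Rightarrow> h - 1)"
    have hh': "h = (case d of L \<Rightarrow> h' - 1 | R \<Rightarrow> h' + 1)" by (cases d) (auto simp: h'_def)
    have "\<exists>lo' hi' p'. repr u s h tape lo' hi' p' ct \<and> h' \<in> {lo'..hi'} \<and> (\<forall>i\<in>QQ. p' h' i = q i) \<and>
      (\<forall>i\<in>QQ. p' h i = q' i)"
    proof (cases d)
      case L
      then have "x i = p h i" if "i \<in> QQ" for i using ph[OF that] by (simp add: q'_def)
      from ext_r[OF this] show ?thesis unfolding q_def q'_def h'_def \<open>d = L\<close> by (simp, blast)
    next
      case R
      then have "y i = p h i" if "i \<in> QQ" for i using ph[OF that] by (simp add: q'_def)
      from ext_l[OF this] show ?thesis unfolding q_def q'_def h'_def \<open>d = R\<close> by (simp, blast)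
    qed
    then obtain lo' hi' p' where r': "repr u s h tape lo' hi' p' ct" and h': "h' \<in> {lo'..hi'}"
      and p': "\<And>i. i \<in> QQ \<Longrightarrow> p' h' i = q i" "\<And>i. i \<in> QQ \<Longrightarrow> p' h i = q' i" by blast
    have "\<exists>c. (p' h' i = H \<longrightarrow> c = rd) \<and> (p' h i = H \<longrightarrow> c = t) \<and>
      ?u' i = Vel (enc i0 rd c (p' h' i)) \<and> u i = Vel (enc m t (if p' h' i = H then wr else c) (p' h i))"
      if "i \<in> RR" for i using mv[OF that] p'[OF RR_QQ[OF that]] False by simp
    from move_rev[OF r' i0 ins h' hh' this] show ?thesis using conn' by blast
  qed
qed

lemma core_halts: "halts T"
proof -
  obtain u where u: "reach u" "\<forall>i\<in>RR. u i \<in> V0" using reach_V0 by blast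
  obtain s h tape lo hi p ct where cn: "conn T (1, 0, \<lambda>_. S0) (s, h, tape)" and r: "repr u s h tape lo hi p ct"
    using reach_repr[OF u(1)] by blast
  obtain i where i: "i \<in> RR" using RR_ne by blast
  have "u i = Vel (enc s (tape h) (ct i) (p h i))" using r i by (auto simp: repr_def)
  then have "s = 0" using u(2) i by (auto simp: V0_def enc_def split: if_splits)
  then show ?thesis using conn_halted cn unfolding halts_def by blast
qed

end

lemma (in core) halts: "halts T"
proof -
  obtain c where c: "c \<in> F" "\<forall>i\<in>I. c i = b i \<or> c i = P2 \<and> b i \<in> {P0, P1}" using normal_ex by blast
  interpret n: core_n T I S b F c by unfold_locales (use c in auto)
  obtain w \<pi> st \<tau> where "n.cand w \<pi> st \<tau>" "\<forall>w' \<pi>' st' \<tau>'. n.cand w' \<pi>' st' \<tau>' \<longrightarrow>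
     card (n.Q (\<pi> @ st # \<tau>)) \<le> card (n.Q (\<pi>' @ st' # \<tau>'))" using n.min_cand_ex by blast
  then interpret core_c T I S b F c w \<pi> st \<tau> by unfold_locales auto
  show ?thesis by (rule core_halts)
qed

section \<open>Polynomials and congruences\<close>

definition projs :: "nat \<Rightarrow> ('a list \<Rightarrow> 'a) set" where
  "projs n = {\<lambda>xs. xs ! i |i. i < n}"

text \<open>The members of \<open>poly_ops\<close> are undefined off the tuples while those of
  \<open>gen_by\<close> are total, so the two can only be compared on tuples.\<close>

lemma poly_ops_gen_by:
  assumes "p \<in> poly_ops A n"
  shows "\<exists>t\<in>gen_by A (projs n). \<forall>xs\<in>tuples n (univ A). p xs = t xs"
  using assms
proof induction
  case (const c)
  then show ?case by (intro bexI[of _ "\<lambda>_. c"] gen_by.const) auto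
next
  case (proj i)
  then show ?case by (intro bexI[of _ "\<lambda>xs. xs ! i"] gen_by.gen) (auto simp: projs_def)
next
  case (comp f gs)
  then have "\<forall>g\<in>set gs. \<exists>t. t \<in> gen_by A (projs n) \<and> (\<forall>xs\<in>tuples n (univ A). g xs = t xs)" by blast
  then obtain F where F: "\<forall>g\<in>set gs. F g \<in> gen_by A (projs n) \<and> (\<forall>xs\<in>tuples n (univ A). g xs = F g xs)"
    by (auto dest!: bchoice)
  show ?case
  proof (intro bexI ballI)
    show "(\<lambda>xs. oper A f (map (\<lambda>g. g xs) (map F gs))) \<in> gen_by A (projs n)"
      using comp F by (intro gen_by.op) auto
    fix xs assume "xs \<in> tuples n (univ A)"
    then show "(\<lambda>xs\<in>tuples n (univ A). oper A f (map (\<lambda>g. g xs) gs)) xs = oper A f (map (\<lambda>g. g xs) (map F gs))"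
      using F by (simp add: comp_def cong: map_cong)
  qed
qed

lemma gen_by_poly_ops:
  assumes "t \<in> gen_by A (projs n)"
  shows "(\<lambda>xs\<in>tuples n (univ A). t xs) \<in> poly_ops A n"
  using assms
proof induction
  case (const c)
  then show ?case by (rule poly_ops.const)
next
  case (gen g)
  then obtain i where i: "i < n" and g: "g = (\<lambda>xs. xs ! i)" by (auto simp: projs_def)
  show ?case unfolding g by (rule poly_ops.proj[OF i])
next
  case (op f gs)
  let ?r = "\<lambda>g. \<lambda>xs\<in>tuples n (univ A). g xs"
  have "(\<lambda>xs\<in>tuples n (univ A). oper A f (map (\<lambda>g. g xs) (map ?r gs))) \<in> poly_ops A n"
  proof (rule poly_ops.comp)
    show "\<forall>g\<in>set (map ?r gs). g \<in> poly_ops A n" using op(3) unfolding set_map by blast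
  qed (use op in auto)
  moreover have "(\<lambda>xs\<in>tuples n (univ A). oper A f (map (\<lambda>g. g xs) (map ?r gs))) =
      (\<lambda>xs\<in>tuples n (univ A). oper A f (map (\<lambda>g. g xs) gs))"
    by (rule restrict_ext) (simp add: comp_def)
  ultimately show ?case by (rule back_subst[where P = "\<lambda>z. z \<in> poly_ops A n"])
qed

lemma congD:
  assumes "congruence A \<theta>"
  shows cong_refl: "x \<in> univ A \<Longrightarrow> (x, x) \<in> \<theta>" and cong_sym: "(x, y) \<in> \<theta> \<Longrightarrow> (y, x) \<in> \<theta>"
    and cong_trans: "(x, y) \<in> \<theta> \<Longrightarrow> (y, z) \<in> \<theta> \<Longrightarrow> (x, z) \<in> \<theta>"
    and cong_univ: "(x, y) \<in> \<theta> \<Longrightarrow> x \<in> univ A \<and> y \<in> univ A"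
  using assms unfolding congruence_def equiv_def refl_on_def sym_def trans_def by blast+

lemma cong_op:
  assumes "congruence A \<theta>" "f \<in> syms A" "length xs = arity A f" "list_all2 (\<lambda>x y. (x, y) \<in> \<theta>) xs ys"
  shows "(oper A f xs, oper A f ys) \<in> \<theta>"
proof -
  have "set xs \<subseteq> univ A" "set ys \<subseteq> univ A"
    using assms(4) cong_univ[OF assms(1)] by (auto simp: list_all2_conv_all_nth set_conv_nth)
  then have "xs \<in> tuples (arity A f) (univ A)" "ys \<in> tuples (arity A f) (univ A)"
    using assms(3) list_all2_lengthD[OF assms(4)] by (auto simp: tuples_def)
  then show ?thesis using assms unfolding congruence_def by blast
qed

lemma cong_gen_by:
  assumes "congruence A \<theta>" "t \<in> gen_by A G" "\<And>g. g \<in> G \<Longrightarrow> (g v, g w) \<in> \<theta>"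
  shows "(t v, t w) \<in> \<theta>"
  using assms(2)
proof (rule gen_by_rel[where P = "\<lambda>x y. (x, y) \<in> \<theta>"])
  show "(c, c) \<in> \<theta>" if "c \<in> univ A" for c using cong_refl[OF assms(1) that] .
  show "(g v, g w) \<in> \<theta>" if "g \<in> G" for g using assms(3)[OF that] .
  show "(oper A f xs, oper A f ys) \<in> \<theta>"
    if "f \<in> syms A" "length xs = arity A f" "list_all2 (\<lambda>x y. (x, y) \<in> \<theta>) xs ys" for f xs ys
    using cong_op[OF assms(1) that] .
qed

abbreviation Pol1 :: "('f, 'a) ualg \<Rightarrow> ('a \<Rightarrow> 'a) set" where
  "Pol1 A \<equiv> gen_by A {\<lambda>x. x}"

abbreviation Pol2 :: "('f, 'a) ualg \<Rightarrow> ('a \<times> 'a \<Rightarrow> 'a) set" where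
  "Pol2 A \<equiv> gen_by A {fst, snd}"

lemma cong_Pol1: "congruence A \<theta> \<Longrightarrow> p \<in> Pol1 A \<Longrightarrow> (x, y) \<in> \<theta> \<Longrightarrow> (p x, p y) \<in> \<theta>"
  by (rule cong_gen_by) auto

lemma cong_Pol2: "congruence A \<theta> \<Longrightarrow> p \<in> Pol2 A \<Longrightarrow> (x, x') \<in> \<theta> \<Longrightarrow> (y, y') \<in> \<theta> \<Longrightarrow> (p (x, y), p (x', y')) \<in> \<theta>"
  by (rule cong_gen_by) auto

lemma Pol1_id: "(\<lambda>x. x) \<in> Pol1 A"
  by (rule gen_by.gen) simp

lemma Pol1_comp: "p \<in> Pol1 A \<Longrightarrow> t \<in> gen_by A G \<Longrightarrow> (\<lambda>v. p (t v)) \<in> gen_by A G"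
  by (rule gen_by_subst[of p A "{\<lambda>x. x}" t]) auto

lemma Pol2_comp:
  "p \<in> Pol2 A \<Longrightarrow> s \<in> gen_by A G \<Longrightarrow> t \<in> gen_by A G \<Longrightarrow> (\<lambda>v. p (s v, t v)) \<in> gen_by A G"
  by (rule gen_by_subst[of p A "{fst, snd}" "\<lambda>v. (s v, t v)"]) auto

lemma Pol1_closed: "is_algebra A \<Longrightarrow> p \<in> Pol1 A \<Longrightarrow> x \<in> univ A \<Longrightarrow> p x \<in> univ A"
  by (rule gen_by_closed) auto

lemma Pol1_poly_ops:
  assumes "p \<in> Pol1 A"
  shows "(\<lambda>xs\<in>tuples 1 (univ A). p (xs ! 0)) \<in> poly_ops A 1"
  by (rule gen_by_poly_ops, rule Pol1_comp[OF assms], rule gen_by.gen) (auto simp: projs_def)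

lemma poly_ops_Pol1:
  assumes "p \<in> poly_ops A 1"
  shows "\<exists>t\<in>Pol1 A. \<forall>x\<in>univ A. p [x] = t x"
proof -
  obtain t where t: "t \<in> gen_by A (projs 1)" "\<forall>xs\<in>tuples 1 (univ A). p xs = t xs"
    using poly_ops_gen_by[OF assms] by blast
  have "(\<lambda>x. t [x]) \<in> Pol1 A"
    by (rule gen_by_subst[OF t(1)]) (auto simp: projs_def Pol1_id)
  then show ?thesis using t(2) by (intro bexI[of _ "\<lambda>x. t [x]"]) (auto simp: tuples_def)
qed

lemma gen_by_single:
  assumes "t \<in> gen_by A {g}"
  shows "\<exists>p\<in>Pol1 A. \<forall>v. t v = p (g v)"
  using assms
proof induction
  case (const c)
  then show ?case by (intro bexI[of _ "\<lambda>_. c"] gen_by.const) auto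
next
  case (gen h)
  then show ?case by (intro bexI[of _ "\<lambda>x. x"] Pol1_id) auto
next
  case (op f gs)
  then have "\<forall>h\<in>set gs. \<exists>p. p \<in> Pol1 A \<and> (\<forall>v. h v = p (g v))" by blast
  then obtain P where P: "\<forall>h\<in>set gs. P h \<in> Pol1 A \<and> (\<forall>v. h v = P h (g v))" by (auto dest!: bchoice)
  show ?case
  proof (intro bexI allI)
    show "(\<lambda>x. oper A f (map (\<lambda>g. g x) (map P gs))) \<in> Pol1 A" using op P by (intro gen_by.op) auto
    show "oper A f (map (\<lambda>h. h v) gs) = oper A f (map (\<lambda>k. k (g v)) (map P gs))" for v
      using P by (simp add: comp_def cong: map_cong)
  qed
qed

text \<open>The largest congruence below \<beta> that does not split X. Compatibility follows by
  changing the arguments of an operation one at a time, each change being a unary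
  polynomial.\<close>

lemma syntactic_congruence:
  fixes A :: "('f, 'a) ualg" and X :: "'a set"
  assumes A: "is_algebra A" and \<beta>: "congruence A \<beta>"
  defines "\<gamma> \<equiv> {(x, y) \<in> \<beta>. \<forall>p\<in>Pol1 A. p x \<in> X \<longleftrightarrow> p y \<in> X}"
  shows "congruence A \<gamma>"
  unfolding congruence_def
proof (intro conjI ballI impI)
  show "equiv (univ A) \<gamma>"
  proof (rule equivI)
    show "\<gamma> \<subseteq> univ A \<times> univ A" using cong_univ[OF \<beta>] by (auto simp: \<gamma>_def)
    show "refl_on (univ A) \<gamma>" using cong_refl[OF \<beta>] by (auto simp: \<gamma>_def refl_on_def)
    show "sym \<gamma>" using cong_sym[OF \<beta>] by (auto simp: \<gamma>_def sym_def)
    show "trans \<gamma>" using cong_trans[OF \<beta>] unfolding \<gamma>_def trans_def by blast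
  qed
  fix f xs ys
  assume f: "f \<in> syms A" and xs: "xs \<in> tuples (arity A f) (univ A)" and ys: "ys \<in> tuples (arity A f) (univ A)"
    and l: "list_all2 (\<lambda>x y. (x, y) \<in> \<gamma>) xs ys"
  have len: "length xs = arity A f" "length ys = arity A f" and U: "set xs \<subseteq> univ A" "set ys \<subseteq> univ A"
    using xs ys by (auto simp: tuples_def)
  have nth: "(xs ! k, ys ! k) \<in> \<gamma>" if "k < arity A f" for k
    using l that len by (auto simp: list_all2_conv_all_nth)
  have "list_all2 (\<lambda>x y. (x, y) \<in> \<beta>) xs ys" by (rule list_all2_mono[OF l]) (auto simp: \<gamma>_def)
  then have "(oper A f xs, oper A f ys) \<in> \<beta>" by (rule cong_op[OF \<beta> f len(1)])
  moreover have "p (oper A f xs) \<in> X \<longleftrightarrow> p (oper A f ys) \<in> X" if p: "p \<in> Pol1 A" for p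
  proof -
    \<comment> \<open>The first k arguments have been replaced.\<close>
    have "p (oper A f (take k ys @ drop k xs)) \<in> X \<longleftrightarrow> p (oper A f xs) \<in> X" if "k \<le> arity A f" for k
      using that
    proof (induction k)
      case (Suc k)
      let ?zs = "take k ys @ drop k xs"
      have zs: "length ?zs = arity A f" "set ?zs \<subseteq> univ A"
        using U len Suc.prems set_take_subset[of k ys] set_drop_subset[of k xs] by auto
      have a: "?zs[k := xs ! k] = ?zs" using len Suc.prems
        by (intro nth_equalityI) (auto simp: nth_list_update nth_append)
      have b: "?zs[k := ys ! k] = take (Suc k) ys @ drop (Suc k) xs" using len Suc.prems
        by (intro nth_equalityI) (auto simp: nth_list_update nth_append less_Suc_eq)
      have r: "(\<lambda>v. p (oper A f (?zs[k := v]))) \<in> Pol1 A"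
        using Pol1_comp[OF p gen_by_upd[OF f zs Pol1_id]] .
      have "\<forall>p\<in>Pol1 A. p (xs ! k) \<in> X \<longleftrightarrow> p (ys ! k) \<in> X" using nth[of k] Suc.prems by (simp add: \<gamma>_def)
      from bspec[OF this r] have "p (oper A f ?zs) \<in> X \<longleftrightarrow> p (oper A f (take (Suc k) ys @ drop (Suc k) xs)) \<in> X"
        unfolding a b .
      then show ?case using Suc by simp
    qed simp
    from this[of "arity A f"] show ?thesis using len by simp
  qed
  ultimately show "(oper A f xs, oper A f ys) \<in> \<gamma>" by (simp add: \<gamma>_def)
qed

text \<open>Otherwise the syntactic congruence of X contains \<alpha> and the pair (u, v), hence is
  \<beta> by primeness; but the identity polynomial splits (x, y).\<close>

lemma prime_separates:
  assumes A: "is_algebra A" and pr: "prime_quotient A \<alpha> \<beta>" and uv: "(u, v) \<in> \<beta>" "(u, v) \<notin> \<alpha>"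
    and sat: "\<And>x y. (x, y) \<in> \<alpha> \<Longrightarrow> x \<in> X \<Longrightarrow> y \<in> X" and xy: "(x, y) \<in> \<beta>" "x \<in> X" "y \<notin> X"
  shows "\<exists>p\<in>Pol1 A. \<not> (p u \<in> X \<longleftrightarrow> p v \<in> X)"
proof (rule ccontr)
  assume *: "\<not> ?thesis"
  define \<gamma> where "\<gamma> = {(x, y) \<in> \<beta>. \<forall>p\<in>Pol1 A. p x \<in> X \<longleftrightarrow> p y \<in> X}"
  have \<alpha>: "congruence A \<alpha>" and \<beta>: "congruence A \<beta>" and sub: "\<alpha> \<subset> \<beta>"
    and pr': "\<And>\<gamma>. congruence A \<gamma> \<Longrightarrow> \<alpha> \<subset> \<gamma> \<Longrightarrow> \<gamma> \<subset> \<beta> \<Longrightarrow> False"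
    using pr unfolding prime_quotient_def by blast+
  have \<gamma>: "congruence A \<gamma>" unfolding \<gamma>_def by (rule syntactic_congruence[OF A \<beta>])
  have "p x \<in> X \<longleftrightarrow> p y \<in> X" if "(x, y) \<in> \<alpha>" "p \<in> Pol1 A" for x y p
    using sat cong_Pol1[OF \<alpha> that(2,1)] cong_sym[OF \<alpha>] by blast
  then have "\<alpha> \<subseteq> \<gamma>" using sub unfolding \<gamma>_def by blast
  moreover have "(u, v) \<in> \<gamma>" using * uv by (auto simp: \<gamma>_def)
  ultimately have "\<alpha> \<subset> \<gamma>" using uv by blast
  moreover have "\<gamma> \<subseteq> \<beta>" by (auto simp: \<gamma>_def)
  ultimately have "\<gamma> = \<beta>" using pr'[OF \<gamma>] by blast
  then have "(x, y) \<in> \<gamma>" using xy by simp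
  then have "\<forall>p\<in>Pol1 A. p x \<in> X \<longleftrightarrow> p y \<in> X" by (simp add: \<gamma>_def)
  from bspec[OF this Pol1_id] show False using xy by simp
qed

section \<open>Type 4 quotients\<close>

text \<open>Two iterates coincide on the finite set U, and the smaller exponent cancels because the
  iterates are onto.\<close>

lemma funpow_id_on:
  assumes fin: "finite U" and k: "k ` U = U"
  shows "\<exists>n>0. \<forall>x\<in>U. (k ^^ n) x = x"
proof -
  have im: "(k ^^ n) ` U = U" for n
  proof (induction n)
    case (Suc n)
    have "(k ^^ Suc n) ` U = k ` ((k ^^ n) ` U)" by (simp add: image_comp)
    then show ?case using Suc k by simp
  qed simp
  define r where "r n = restrict (k ^^ n) U" for n
  have "(k ^^ n) x \<in> U" if "x \<in> U" for n x using im[of n] that by blast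
  then have "range r \<subseteq> U \<rightarrow>\<^sub>E U" by (auto simp: r_def)
  moreover have "finite (U \<rightarrow>\<^sub>E U)" by (rule finite_PiE) (use fin in auto)
  ultimately have fr: "finite (range r)" by (rule finite_subset)
  have "\<not> inj r"
  proof
    assume "inj r"
    with fr have "finite (UNIV :: nat set)" by (rule finite_imageD)
    then show False by simp
  qed
  then obtain m' n' where "m' \<noteq> n'" "r m' = r n'" unfolding inj_def by blast
  then have "m' < n' \<and> r m' = r n' \<or> n' < m' \<and> r n' = r m'" by auto
  then have "\<exists>m n. m < n \<and> r m = r n" by blast
  then obtain m n where "m < n" and eq: "r m = r n" by blast
  have "(k ^^ (n - m)) x = x" if "x \<in> U" for x
  proof -
    have "x \<in> (k ^^ m) ` U" unfolding im by (rule that)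
    then obtain y where y: "y \<in> U" "x = (k ^^ m) y" by blast
    have "(k ^^ (n - m)) x = (k ^^ (n - m + m)) y" unfolding y(2) funpow_add by simp
    also have "\<dots> = (k ^^ n) y" using \<open>m < n\<close> by simp
    also have "\<dots> = (k ^^ m) y" using fun_cong[OF eq, of y] y(1) by (simp add: r_def)
    finally show ?thesis using y(2) by simp
  qed
  then show ?thesis using \<open>m < n\<close> by (intro exI[of _ "n - m"]) auto
qed

lemma Pol1_funpow: "p \<in> Pol1 A \<Longrightarrow> p ^^ n \<in> Pol1 A"
proof (induction n)
  case 0
  then show ?case using Pol1_id by (simp add: id_def)
next
  case (Suc n)
  then show ?case using Pol1_comp[of p A "p ^^ n" "{\<lambda>x. x}"] by (simp add: comp_def)
qed

text \<open>If f has image U, some h makes f h f still separating; by minimality its image is again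
  U, so f h permutes U, and a power of it is the identity on U.\<close>

lemma minimal_set_idempotent:
  assumes A: "is_algebra A" "finite (univ A)" and pr: "prime_quotient A \<alpha> \<beta>" and U: "U \<in> minimal_sets A \<alpha> \<beta>"
  shows "\<exists>e\<in>Pol1 A. e ` univ A \<subseteq> U \<and> (\<forall>x\<in>U. e x = x)"
proof -
  have \<alpha>: "congruence A \<alpha>" and \<beta>: "congruence A \<beta>"
    using pr unfolding prime_quotient_def by blast+
  have "U \<in> poly_images A \<alpha> \<beta>" and min: "\<And>U'. U' \<in> poly_images A \<alpha> \<beta> \<Longrightarrow> \<not> U' \<subset> U"
    using U by (auto simp: minimal_sets_def)
  then obtain p where p: "p \<in> poly_ops A 1" "\<not> (\<forall>(x, y)\<in>\<beta>. (p [x], p [y]) \<in> \<alpha>)" "U = (\<lambda>x. p [x]) ` univ A"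
    unfolding poly_images_def by blast
  obtain f where f: "f \<in> Pol1 A" "\<And>x. x \<in> univ A \<Longrightarrow> p [x] = f x" using poly_ops_Pol1[OF p(1)] by blast
  have fU: "f x \<in> U" if "x \<in> univ A" for x using that p(3) f(2) by auto
  have Usub: "U \<subseteq> univ A" using p(3) f Pol1_closed[OF A(1)] by auto
  obtain u v where uv: "(u, v) \<in> \<beta>" "(f u, f v) \<notin> \<alpha>"
  proof -
    obtain u v where "(u, v) \<in> \<beta>" "(p [u], p [v]) \<notin> \<alpha>" using p(2) by blast
    then show ?thesis using that f(2) cong_univ[OF \<beta>] by metis
  qed
  have fuv: "(f u, f v) \<in> \<beta>" by (rule cong_Pol1[OF \<beta> f(1) uv(1)])
  \<comment> \<open>A union of \<alpha>-classes that contains u but not v; a polynomial h separating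
    the images of u and v with respect to it remains separating after f.\<close>
  let ?X = "{z. (f z, f u) \<in> \<alpha>}"
  have "\<exists>h\<in>Pol1 A. \<not> (h (f u) \<in> ?X \<longleftrightarrow> h (f v) \<in> ?X)"
  proof (rule prime_separates[OF A(1) pr fuv uv(2)])
    show "(u, v) \<in> \<beta>" by (rule uv)
    show "u \<in> ?X" using cong_refl[OF \<alpha>] Pol1_closed[OF A(1) f(1)] cong_univ[OF \<beta> uv(1)] by simp
    show "v \<notin> ?X" using uv(2) cong_sym[OF \<alpha>] by blast
    show "y \<in> ?X" if "(x, y) \<in> \<alpha>" "x \<in> ?X" for x y
      using that cong_Pol1[OF \<alpha> f(1)] cong_sym[OF \<alpha>] cong_trans[OF \<alpha>] by blast
  qed
  then obtain h where h: "h \<in> Pol1 A" "\<not> ((f (h (f u)), f u) \<in> \<alpha> \<longleftrightarrow> (f (h (f v)), f u) \<in> \<alpha>)" by auto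
  then have sep: "(f (h (f u)), f (h (f v))) \<notin> \<alpha>" using cong_sym[OF \<alpha>] cong_trans[OF \<alpha>] by blast
  define k where "k x = f (h x)" for x
  have k: "k \<in> Pol1 A" unfolding k_def using Pol1_comp[OF f(1) h(1)] by simp
  have kU: "k x \<in> U" if "x \<in> univ A" for x unfolding k_def using fU Pol1_closed[OF A(1) h(1) that] .
  have kf: "(\<lambda>x. k (f x)) \<in> Pol1 A" by (rule Pol1_comp[OF k f(1)])
  have "(\<lambda>x. k (f x)) ` univ A \<in> poly_images A \<alpha> \<beta>"
  proof -
    let ?p = "\<lambda>xs\<in>tuples 1 (univ A). k (f (xs ! 0))"
    have p: "?p \<in> poly_ops A 1" by (rule Pol1_poly_ops[OF kf])
    have eq: "?p [x] = k (f x)" if "x \<in> univ A" for x using that by (simp add: tuples_def)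
    have "(?p [u], ?p [v]) \<notin> \<alpha>" using sep eq cong_univ[OF \<beta> uv(1)] by (simp add: k_def)
    moreover have "(\<lambda>x. k (f x)) ` univ A = (\<lambda>x. ?p [x]) ` univ A" using eq by simp
    ultimately show ?thesis using p uv(1) unfolding poly_images_def by blast
  qed
  from min[OF this] have "(\<lambda>x. k (f x)) ` univ A = U"
    using kU Pol1_closed[OF A(1) f(1)] by blast
  moreover have "f ` univ A = U" using p(3) f(2) by simp
  ultimately have "k ` U = U" by (metis image_image)
  moreover have "finite U" using Usub A(2) by (rule finite_subset)
  ultimately obtain n where n: "n > 0" "\<forall>x\<in>U. (k ^^ n) x = x" using funpow_id_on by blast
  have "(k ^^ n) x \<in> U" if "x \<in> univ A" for x
  proof -
    obtain n' where "n = Suc n'" using n(1) gr0_implies_Suc by blast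
    then show ?thesis using kU Pol1_closed[OF A(1) Pol1_funpow[OF k] that] by simp
  qed
  then show ?thesis using n(2) Pol1_funpow[OF k] by blast
qed

text \<open>The reason why a type 4 trace has no complement.\<close>

lemma two_alg_monotone:
  assumes "t \<in> poly_ops (two_alg {Meet, Join} a b) n" "a \<noteq> b" "xs \<in> tuples n {a, b}" "ys \<in> tuples n {a, b}"
    and le: "\<And>i. i < n \<Longrightarrow> xs ! i = b \<Longrightarrow> ys ! i = b"
  shows "t xs \<in> {a, b} \<and> t ys \<in> {a, b} \<and> (t xs = b \<longrightarrow> t ys = b)"
  using assms(1)
proof induction
  case (const c)
  then show ?case using assms by (auto simp: two_alg_def)
next
  case (proj i)
  then have "xs ! i \<in> {a, b}" "ys ! i \<in> {a, b}"
    using assms(3,4) nth_mem[of i xs] nth_mem[of i ys] by (auto simp: tuples_def subset_iff)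
  then show ?case using assms proj by (auto simp: two_alg_def)
next
  case (comp f gs)
  have u: "univ (two_alg {Meet, Join} a b) = {a, b}" by (simp add: two_alg_def)
  have f: "f = Meet \<or> f = Join" and "length gs = 2" using comp.hyps by (auto simp: two_alg_def)
  then obtain g h where gs: "gs = [g, h]" using len_expand(1)[of gs] by auto
  have IH: "g xs \<in> {a, b}" "g ys \<in> {a, b}" "g xs = b \<longrightarrow> g ys = b"
    "h xs \<in> {a, b}" "h ys \<in> {a, b}" "h xs = b \<longrightarrow> h ys = b"
    using comp.IH unfolding gs by auto
  have "(\<lambda>xs\<in>tuples n (univ (two_alg {Meet, Join} a b)). oper (two_alg {Meet, Join} a b) f (map (\<lambda>g. g xs) gs)) zs =
      (if f = Meet then if g zs = b \<and> h zs = b then b else a else if g zs = a \<and> h zs = a then a else b)"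
    if "zs \<in> tuples n {a, b}" for zs
    using that f unfolding u gs by (auto simp: two_alg_def)
  from this[OF assms(3)] this[OF assms(4)] show ?case using IH assms(2) by (auto split: if_splits)
qed

abbreviation trace_alg :: "('f, 'a) ualg \<Rightarrow> 'a rel \<Rightarrow> 'a set \<Rightarrow> (nat \<times> ('a list \<Rightarrow> 'a), 'a set) ualg" where
  "trace_alg A \<alpha> N \<equiv> quotient_alg (induced_alg A N) (\<alpha> \<inter> N \<times> N)"

lemma trace_class:
  assumes \<alpha>: "congruence A \<alpha>" and N: "N \<subseteq> univ A" and y: "y \<in> N"
  shows "y \<in> (\<alpha> \<inter> N \<times> N) `` {y}" "y' \<in> N \<Longrightarrow>
    (\<alpha> \<inter> N \<times> N) `` {y} = (\<alpha> \<inter> N \<times> N) `` {y'} \<longleftrightarrow> (y, y') \<in> \<alpha>"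
proof -
  show "y \<in> (\<alpha> \<inter> N \<times> N) `` {y}" using y N cong_refl[OF \<alpha>] by blast
  show "(\<alpha> \<inter> N \<times> N) `` {y} = (\<alpha> \<inter> N \<times> N) `` {y'} \<longleftrightarrow> (y, y') \<in> \<alpha>" if "y' \<in> N"
  proof
    assume "(\<alpha> \<inter> N \<times> N) `` {y} = (\<alpha> \<inter> N \<times> N) `` {y'}"
    moreover have "y' \<in> (\<alpha> \<inter> N \<times> N) `` {y'}" using that N cong_refl[OF \<alpha>] by blast
    ultimately show "(y, y') \<in> \<alpha>" by blast
  next
    assume "(y, y') \<in> \<alpha>"
    then show "(\<alpha> \<inter> N \<times> N) `` {y} = (\<alpha> \<inter> N \<times> N) `` {y'}"
      using y that cong_sym[OF \<alpha>] cong_trans[OF \<alpha>] by blast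
  qed
qed

text \<open>The quotient evaluates on chosen representatives; the choice is harmless modulo
  \<alpha>.\<close>

lemma trace_class_rep:
  assumes \<alpha>: "congruence A \<alpha>" and N: "N \<subseteq> univ A" and y: "y \<in> N"
  shows "(SOME z. z \<in> (\<alpha> \<inter> N \<times> N) `` {y}) \<in> N \<and> (y, SOME z. z \<in> (\<alpha> \<inter> N \<times> N) `` {y}) \<in> \<alpha>"
  using someI[of "\<lambda>z. z \<in> (\<alpha> \<inter> N \<times> N) `` {y}", OF trace_class(1)[OF assms]] by blast

text \<open>Lifts the meet and the join of the quotient trace to polynomials of A. Basic operations
  of the induced algebra are already polynomials of A, so a composition is lifted by
  substitution.\<close>

lemma trace_alg_poly:
  assumes \<alpha>: "congruence A \<alpha>" and N: "N \<subseteq> univ A"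
    and P: "P \<in> poly_ops (trace_alg A \<alpha> N) n"
  shows "\<exists>t\<in>gen_by A (projs n). \<forall>ys\<in>tuples n N. t ys \<in> N \<and>
    P (map (\<lambda>y. (\<alpha> \<inter> N \<times> N) `` {y}) ys) = (\<alpha> \<inter> N \<times> N) `` {t ys}"
  using P
proof induction
  let ?M = "trace_alg A \<alpha> N" and ?cls = "\<lambda>y. (\<alpha> \<inter> N \<times> N) `` {y}"
  have uM: "univ ?M = N // (\<alpha> \<inter> N \<times> N)" by (simp add: quotient_alg_def induced_alg_def)
  have mp: "map ?cls ys \<in> tuples n (univ ?M)" if "ys \<in> tuples n N" for ys
    using that by (auto simp: tuples_def uM quotient_def)
  {
    case (const c)
    then obtain y where y: "y \<in> N" "c = ?cls y" unfolding uM by (auto elim: quotientE)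
    have "(\<lambda>_. y) \<in> gen_by A (projs n)" using y N by (intro gen_by.const) auto
    then show ?case using y mp by (intro bexI[of _ "\<lambda>_. y"]) auto
  next
    case (proj i)
    have "(\<lambda>xs. xs ! i) \<in> gen_by A (projs n)" using proj by (intro gen_by.gen) (auto simp: projs_def)
    moreover have "ys ! i \<in> N" "length ys = n" if "ys \<in> tuples n N" for ys
      using that proj by (auto simp: tuples_def)
    ultimately show ?case using mp proj by (intro bexI[of _ "\<lambda>xs. xs ! i"]) auto
  next
    case (comp f gs)
    obtain m p where f: "f = (m, p)" by (cases f)
    have p: "p \<in> poly_ops A m" "\<And>xs. xs \<in> tuples m N \<Longrightarrow> p xs \<in> N" and len: "length gs = m"
      using comp.hyps by (auto simp: f quotient_alg_def induced_alg_def)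
    obtain tp where tp: "tp \<in> gen_by A (projs m)" "\<forall>xs\<in>tuples m (univ A). p xs = tp xs"
      using poly_ops_gen_by[OF p(1)] by blast
    have "\<forall>g\<in>set gs. \<exists>t. t \<in> gen_by A (projs n) \<and>
      (\<forall>ys\<in>tuples n N. t ys \<in> N \<and> g (map ?cls ys) = ?cls (t ys))" using comp.IH by blast
    from bchoice[OF this] obtain F where F: "\<And>g. g \<in> set gs \<Longrightarrow> F g \<in> gen_by A (projs n)"
      "\<And>g ys. g \<in> set gs \<Longrightarrow> ys \<in> tuples n N \<Longrightarrow> F g ys \<in> N \<and> g (map ?cls ys) = ?cls (F g ys)" by blast
    let ?t = "\<lambda>ys. tp (map (\<lambda>g. F g ys) gs)"
    have t: "?t \<in> gen_by A (projs n)"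
      by (rule gen_by_subst[OF tp(1), where \<phi> = "\<lambda>ys. map (\<lambda>g. F g ys) gs"])
        (use F(1) len in \<open>auto simp: projs_def\<close>)
    have "?t ys \<in> N \<and> (\<lambda>xs\<in>tuples n (univ ?M). oper ?M f (map (\<lambda>g. g xs) gs)) (map ?cls ys) = ?cls (?t ys)"
      if ys: "ys \<in> tuples n N" for ys
    proof -
      let ?as = "map (\<lambda>g. F g ys) gs"
      let ?bs = "map (\<lambda>X. SOME x. x \<in> X) (map (\<lambda>g. g (map ?cls ys)) gs)"
      have as: "?as \<in> tuples m N" using F(2)[OF _ ys] len by (auto simp: tuples_def)
      have rep: "(SOME x. x \<in> g (map ?cls ys)) \<in> N \<and> (F g ys, SOME x. x \<in> g (map ?cls ys)) \<in> \<alpha>"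
        if "g \<in> set gs" for g
        using trace_class_rep[OF \<alpha> N, of "F g ys"] F(2)[OF that ys] by simp
      have bs: "?bs \<in> tuples m N" using rep len by (auto simp: tuples_def)
      have sub: "tuples m N \<subseteq> tuples m (univ A)" using N by (auto simp: tuples_def)
      have pa: "p ?as = tp ?as" "p ?bs = tp ?bs" using tp(2) as bs sub by blast+
      have "(tp ?as, tp ?bs) \<in> \<alpha>"
        by (rule cong_gen_by[OF \<alpha> tp(1)]) (use rep len in \<open>auto simp: projs_def\<close>)
      moreover have tN: "tp ?as \<in> N" "tp ?bs \<in> N" using p(2) as bs pa by metis+
      ultimately have "?cls (tp ?as) = ?cls (tp ?bs)" using trace_class(2)[OF \<alpha> N tN] by blast
      moreover have "oper ?M f (map (\<lambda>g. g (map ?cls ys)) gs) = ?cls (p ?bs)"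
        by (simp add: quotient_alg_def induced_alg_def f)
      ultimately show ?thesis using mp[OF ys] tN pa by simp
    qed
    then have "\<forall>ys\<in>tuples n N. ?t ys \<in> N \<and>
        (\<lambda>xs\<in>tuples n (univ ?M). oper ?M f (map (\<lambda>g. g xs) gs)) (map ?cls ys) = ?cls (?t ys)" by (rule ballI)
    then show ?case by (rule bexI[OF _ t])
  }
qed

text \<open>The opposite passage: a polynomial of A that exchanges two classes of the trace would
  appear as a complement in the two-element lattice.\<close>

lemma trace_alg_unary:
  assumes \<alpha>: "congruence A \<alpha>" and N: "N \<subseteq> univ A" and q: "q \<in> Pol1 A" and qN: "\<And>y. y \<in> N \<Longrightarrow> q y \<in> N"
  shows "\<exists>P\<in>poly_ops (trace_alg A \<alpha> N) 1. \<forall>y\<in>N. P [(\<alpha> \<inter> N \<times> N) `` {y}] = (\<alpha> \<inter> N \<times> N) `` {q y}"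
proof -
  let ?M = "trace_alg A \<alpha> N" and ?cls = "\<lambda>y. (\<alpha> \<inter> N \<times> N) `` {y}"
  let ?P = "\<lambda>xs\<in>tuples 1 (univ A). q (xs ! 0)"
  let ?g = "\<lambda>xs\<in>tuples 1 (univ ?M). xs ! 0"
  have P1: "?P [y] = q y" if "y \<in> N" for y using that N by (auto simp: tuples_def)
  have "?P xs \<in> N" if "xs \<in> tuples 1 N" for xs
    using that qN N by (auto simp: tuples_def length_Suc_conv)
  then have "(1, ?P) \<in> syms ?M"
    using Pol1_poly_ops[OF q] by (simp add: quotient_alg_def induced_alg_def del: restrict_apply)
  moreover have "?g \<in> poly_ops ?M 1" by (rule poly_ops.proj) simp
  ultimately have G: "(\<lambda>xs\<in>tuples 1 (univ ?M). oper ?M (1, ?P) (map (\<lambda>g. g xs) [?g])) \<in> poly_ops ?M 1"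
    by (intro poly_ops.comp) (simp_all add: quotient_alg_def induced_alg_def del: restrict_apply)
  have "(\<lambda>xs\<in>tuples 1 (univ ?M). oper ?M (1, ?P) (map (\<lambda>g. g xs) [?g])) [?cls y] = ?cls (q y)"
    if y: "y \<in> N" for y
  proof -
    have t: "[?cls y] \<in> tuples 1 (univ ?M)"
      using y by (auto simp: tuples_def quotient_alg_def induced_alg_def quotient_def)
    let ?r = "SOME x. x \<in> ?cls y"
    have r: "?r \<in> N" "(y, ?r) \<in> \<alpha>" using trace_class_rep[OF \<alpha> N y] by auto
    have "(q y, q ?r) \<in> \<alpha>" by (rule cong_Pol1[OF \<alpha> q r(2)])
    then have "?cls (q y) = ?cls (q ?r)" using trace_class(2)[OF \<alpha> N qN[OF y] qN[OF r(1)]] by blast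
    moreover have "oper ?M (1, ?P) [?cls y] = ?cls (?P [?r])"
      by (simp add: quotient_alg_def induced_alg_def)
    ultimately show ?thesis using t P1[OF r(1)] by simp
  qed
  then show ?thesis using G by blast
qed

text \<open>Only a join is required: the statement for the exchanged pair expresses the meet as a
  join, so both orientations of the trace have the same form. The polynomial e retracts A onto the
  minimal set.\<close>

definition lattice_pair :: "('f, 'a) ualg \<Rightarrow> 'a rel \<Rightarrow> 'a rel \<Rightarrow> ('a \<Rightarrow> 'a) \<Rightarrow> 'a \<Rightarrow> 'a \<Rightarrow> bool" where
  "lattice_pair A \<alpha> \<beta> e x0 x1 \<longleftrightarrow> (x0, x1) \<in> \<beta> \<and> (x0, x1) \<notin> \<alpha> \<and> e \<in> Pol1 A \<and>
    (\<forall>z\<in>univ A. e (e z) = e z) \<and> (e x0, x0) \<in> \<alpha> \<and> (e x1, x1) \<in> \<alpha> \<and>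
    (\<forall>z. (x0, z) \<in> \<beta> \<longrightarrow> (e z, x0) \<in> \<alpha> \<or> (e z, x1) \<in> \<alpha>) \<and>
    (\<forall>p\<in>Pol1 A. \<not> ((p x0, x1) \<in> \<alpha> \<and> (p x1, x0) \<in> \<alpha>)) \<and>
    (\<exists>q\<in>Pol2 A. (q (x0, x0), x0) \<in> \<alpha> \<and> (q (x0, x1), x1) \<in> \<alpha> \<and> (q (x1, x0), x1) \<in> \<alpha> \<and> (q (x1, x1), x1) \<in> \<alpha>)"

lemma type4_lattice_pair:
  assumes A: "is_algebra A" "finite (univ A)" and pr: "prime_quotient A \<alpha> \<beta>" and ty: "has_type A \<alpha> \<beta> Type4"
  shows "\<exists>e x0 x1. lattice_pair A \<alpha> \<beta> e x0 x1 \<and> lattice_pair A \<alpha> \<beta> e x1 x0"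
proof -
  have \<alpha>: "congruence A \<alpha>" and \<beta>: "congruence A \<beta>" and sub: "\<alpha> \<subset> \<beta>"
    using pr unfolding prime_quotient_def by blast+
  obtain N where "N \<in> traces A \<alpha> \<beta>" and mt: "minimal_type (trace_alg A \<alpha> N) Type4"
    using ty unfolding has_type_def by blast
  then obtain U x where U: "U \<in> minimal_sets A \<alpha> \<beta>" and N: "N = U \<inter> \<beta> `` {x}" and x: "x \<in> U"
    unfolding traces_def by blast
  obtain e where e: "e \<in> Pol1 A" "e ` univ A \<subseteq> U" "\<forall>x\<in>U. e x = x"
    using minimal_set_idempotent[OF A pr U] by blast
  have NA: "N \<subseteq> univ A" using N cong_univ[OF \<beta>] by blast
  let ?M = "trace_alg A \<alpha> N" and ?cls = "\<lambda>y. (\<alpha> \<inter> N \<times> N) `` {y}"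
  obtain a b where ab: "a \<noteq> b" and pe: "poly_equivalent ?M (two_alg {Meet, Join} a b)"
    using mt by auto
  have "univ ?M = univ (two_alg {Meet, Join} a b)" and po: "\<And>n. poly_ops ?M n = poly_ops (two_alg {Meet, Join} a b) n"
    using pe unfolding poly_equivalent_def by blast+
  then have uM: "N // (\<alpha> \<inter> N \<times> N) = {a, b}"
    by (simp add: quotient_alg_def induced_alg_def two_alg_def)
  obtain x0 where x0: "x0 \<in> N" "a = ?cls x0" using uM by (metis insertI1 quotientE)
  obtain x1 where x1: "x1 \<in> N" "b = ?cls x1" using uM by (metis insertI1 insertI2 quotientE)
  note cl = trace_class(2)[OF \<alpha> NA]
  have N\<beta>: "(y, y') \<in> \<beta>" if "y \<in> N" "y' \<in> N" for y y'
    using that cong_sym[OF \<beta>] cong_trans[OF \<beta>] unfolding N by blast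
  have NI: "e z \<in> N" if "y \<in> N" "(y, z) \<in> \<beta>" for y z
  proof -
    have "e y = y" using that(1) e(3) N by blast
    then have "(y, e z) \<in> \<beta>" using cong_Pol1[OF \<beta> e(1) that(2)] by simp
    moreover have "(x, y) \<in> \<beta>" using that(1) N by blast
    ultimately have "(x, e z) \<in> \<beta>" using cong_trans[OF \<beta>] by blast
    moreover have "e z \<in> U" using e(2) cong_univ[OF \<beta> that(2)] by blast
    ultimately show ?thesis by (simp add: N)
  qed
  have two: "(y, x0) \<in> \<alpha> \<or> (y, x1) \<in> \<alpha>" if "y \<in> N" for y
  proof -
    have "?cls y \<in> {a, b}" using that uM by (metis quotientI)
    then show ?thesis using cl[OF that x0(1)] cl[OF that x1(1)] x0(2) x1(2) by auto
  qed
  have eN: "e y = y" if "y \<in> N" for y using that e(3) N by blast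
  have refl: "(y, y) \<in> \<alpha>" if "y \<in> N" for y using that NA cong_refl[OF \<alpha>] by blast
  have n\<alpha>: "(x0, x1) \<notin> \<alpha>" using ab cl[OF x0(1) x1(1)] x0(2) x1(2) by blast
  have ee: "e (e z) = e z" if "z \<in> univ A" for z using e(2,3) that by blast
  \<comment> \<open>Followed by the retraction e, such a p preserves N and induces a complement on
    the two classes.\<close>
  have noswap: "\<not> ((p x0, x1) \<in> \<alpha> \<and> (p x1, x0) \<in> \<alpha>)" if p: "p \<in> Pol1 A" for p
  proof
    assume sw: "(p x0, x1) \<in> \<alpha> \<and> (p x1, x0) \<in> \<alpha>"
    define q where "q z = e (p z)" for z
    have q: "q \<in> Pol1 A" unfolding q_def using Pol1_comp[OF e(1) p] by simp
    have qN: "q y \<in> N" if "y \<in> N" for y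
    proof -
      have "(p y, p x0) \<in> \<beta>" by (rule cong_Pol1[OF \<beta> p N\<beta>[OF that x0(1)]])
      moreover have "(p x0, x1) \<in> \<beta>" using sw sub by blast
      ultimately have "(x1, p y) \<in> \<beta>" using cong_sym[OF \<beta>] cong_trans[OF \<beta>] by blast
      then show ?thesis unfolding q_def using NI[OF x1(1)] by blast
    qed
    obtain P where P: "P \<in> poly_ops ?M 1" "\<forall>y\<in>N. P [?cls y] = ?cls (q y)"
      using trace_alg_unary[OF \<alpha> NA q qN] by blast
    have "(q x0, x1) \<in> \<alpha>" "(q x1, x0) \<in> \<alpha>"
      using cong_Pol1[OF \<alpha> e(1)] sw eN[OF x0(1)] eN[OF x1(1)] unfolding q_def by metis+
    then have "P [a] = b" "P [b] = a"
      using P(2) x0 x1 cl[OF qN[OF x0(1)] x1(1)] cl[OF qN[OF x1(1)] x0(1)] by auto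
    then show False
      using two_alg_monotone[OF P(1)[unfolded po] ab, of "[a]" "[b]"] ab by (auto simp: tuples_def)
  qed
  have lat: "\<exists>q\<in>Pol2 A. \<forall>y\<in>N. \<forall>y'\<in>N. q (y, y') \<in> N \<and>
      ?cls (q (y, y')) = oper (two_alg {Meet, Join} a b) f [?cls y, ?cls y']" if f: "f \<in> {Meet, Join}" for f
  proof -
    let ?L = "two_alg {Meet, Join} a b"
    let ?gs = "[\<lambda>xs\<in>tuples 2 (univ ?L). xs ! 0, \<lambda>xs\<in>tuples 2 (univ ?L). xs ! 1]"
    have "(\<lambda>xs\<in>tuples 2 (univ ?L). oper ?L f (map (\<lambda>g. g xs) ?gs)) \<in> poly_ops ?L 2"
    proof (rule poly_ops.comp)
      show "f \<in> syms ?L" "length ?gs = arity ?L f" using f by (auto simp: two_alg_def)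
      show "\<forall>g\<in>set ?gs. g \<in> poly_ops ?L 2"
        using poly_ops.proj[of 0 2 ?L] poly_ops.proj[of 1 2 ?L] by (simp del: restrict_apply)
    qed
    then have "(\<lambda>xs\<in>tuples 2 (univ ?L). oper ?L f (map (\<lambda>g. g xs) ?gs)) \<in> poly_ops ?M 2" by (simp only: po)
    from trace_alg_poly[OF \<alpha> NA this]
    obtain t where t: "t \<in> gen_by A (projs 2)" and tv: "\<And>ys. ys \<in> tuples 2 N \<Longrightarrow> t ys \<in> N \<and>
      (\<lambda>xs\<in>tuples 2 (univ ?L). oper ?L f (map (\<lambda>g. g xs) ?gs)) (map ?cls ys) = ?cls (t ys)" by blast
    have "(\<lambda>v. t [fst v, snd v]) \<in> Pol2 A"
    proof (rule gen_by_subst[OF t])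
      fix g :: "'b list \<Rightarrow> 'b" assume "g \<in> projs 2"
      then have "(\<lambda>v. g [fst v, snd v]) = fst \<or> (\<lambda>v. g [fst v, snd v]) = snd"
        by (auto simp: projs_def less_expand(1))
      then show "(\<lambda>v. g [fst v, snd v]) \<in> Pol2 A" by (elim disjE) (simp_all add: gen_by.gen)
    qed
    moreover have "t [y, y'] \<in> N \<and> ?cls (t [y, y']) = oper ?L f [?cls y, ?cls y']"
      if y: "y \<in> N" "y' \<in> N" for y y'
    proof -
      have 1: "[y, y'] \<in> tuples 2 N" using y by (simp add: tuples_def)
      have uL: "univ ?L = {a, b}" by (simp add: two_alg_def)
      have "?cls y \<in> {a, b}" "?cls y' \<in> {a, b}" using y uM by (metis quotientI)+
      then have 2: "[?cls y, ?cls y'] \<in> tuples 2 (univ ?L)" by (simp add: tuples_def uL)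
      show ?thesis using tv[OF 1] 2 by simp
    qed
    ultimately show ?thesis by (intro bexI[of _ "\<lambda>v. t [fst v, snd v]"]) auto
  qed
  have clx: "?cls y = a \<longleftrightarrow> (y, x0) \<in> \<alpha>" "?cls y = b \<longleftrightarrow> (y, x1) \<in> \<alpha>" if "y \<in> N" for y
    using cl[OF that x0(1)] cl[OF that x1(1)] x0(2) x1(2) by simp_all
  obtain jn where jn: "jn \<in> Pol2 A" "\<forall>y\<in>N. \<forall>y'\<in>N. jn (y, y') \<in> N \<and>
      ?cls (jn (y, y')) = oper (two_alg {Meet, Join} a b) Join [?cls y, ?cls y']" using lat[of Join] by auto
  obtain mt where mt: "mt \<in> Pol2 A" "\<forall>y\<in>N. \<forall>y'\<in>N. mt (y, y') \<in> N \<and>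
      ?cls (mt (y, y')) = oper (two_alg {Meet, Join} a b) Meet [?cls y, ?cls y']" using lat[of Meet] by auto
  have opJ: "oper (two_alg {Meet, Join} a b) Join [u, v] = (if u = a \<and> v = a then a else b)"
    and opM: "oper (two_alg {Meet, Join} a b) Meet [u, v] = (if u = b \<and> v = b then b else a)" for u v
    by (auto simp: two_alg_def)
  have J: "(jn (x0, x0), x0) \<in> \<alpha>" "(jn (x0, x1), x1) \<in> \<alpha>" "(jn (x1, x0), x1) \<in> \<alpha>" "(jn (x1, x1), x1) \<in> \<alpha>"
    using jn(2) x0 x1 ab clx unfolding opJ by (metis (full_types))+
  have M: "(mt (x1, x1), x1) \<in> \<alpha>" "(mt (x1, x0), x0) \<in> \<alpha>" "(mt (x0, x1), x0) \<in> \<alpha>" "(mt (x0, x0), x0) \<in> \<alpha>"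
    using mt(2) x0 x1 ab clx unfolding opM by (metis (full_types))+
  have "lattice_pair A \<alpha> \<beta> e x0 x1"
    unfolding lattice_pair_def
  proof (intro conjI ballI allI impI)
    show "(e z, x0) \<in> \<alpha> \<or> (e z, x1) \<in> \<alpha>" if "(x0, z) \<in> \<beta>" for z using two[OF NI[OF x0(1) that]] .
    show "\<exists>q\<in>Pol2 A. (q (x0, x0), x0) \<in> \<alpha> \<and> (q (x0, x1), x1) \<in> \<alpha> \<and> (q (x1, x0), x1) \<in> \<alpha> \<and> (q (x1, x1), x1) \<in> \<alpha>"
      using jn(1) J by blast
  qed (use N\<beta> x0 x1 n\<alpha> e(1) ee eN refl noswap in auto)
  moreover have "lattice_pair A \<alpha> \<beta> e x1 x0"
    unfolding lattice_pair_def
  proof (intro conjI ballI allI impI)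
    show "(x1, x0) \<notin> \<alpha>" using n\<alpha> cong_sym[OF \<alpha>] by blast
    show "(e z, x1) \<in> \<alpha> \<or> (e z, x0) \<in> \<alpha>" if "(x1, z) \<in> \<beta>" for z using two[OF NI[OF x1(1) that]] by blast
    show "\<exists>q\<in>Pol2 A. (q (x1, x1), x1) \<in> \<alpha> \<and> (q (x1, x0), x0) \<in> \<alpha> \<and> (q (x0, x1), x0) \<in> \<alpha> \<and> (q (x0, x0), x0) \<in> \<alpha>"
      using mt(1) M by blast
  qed (use N\<beta> x0 x1 e(1) ee eN refl noswap in auto)
  ultimately show ?thesis by blast
qed

text \<open>Transfer of the lattice structure from a trace to a pair \<open>(c, b)\<close> below which the
  semilattice operation \<open>W\<close> leaves only two classes.\<close>

lemma lattice_pair_transfer_aux: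
  assumes A: "is_algebra A" and pr: "prime_quotient A \<alpha> \<beta>" and lp: "lattice_pair A \<alpha> \<beta> e x0 x1"
    and W: "(\<lambda>v. W (fst v) (snd v)) \<in> Pol2 A" and cb: "(c, b) \<in> \<beta>" "(c, b) \<notin> \<alpha>" and Wcb: "W c b = c" "W b b = b"
    and two: "\<And>v. v \<in> univ A \<Longrightarrow> (W v b, b) \<in> \<beta> \<Longrightarrow> (W v b, b) \<in> \<alpha> \<or> (W v b, c) \<in> \<alpha>"
    and k: "k \<in> Pol1 A" "(W (k x1) b, b) \<in> \<alpha>" "(W (k x0) b, b) \<notin> \<alpha>"
  shows "(\<forall>p\<in>Pol1 A. (W (p c) b, b) \<in> \<alpha> \<longrightarrow> (W (p b) b, b) \<in> \<alpha>) \<and>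
    (\<exists>q\<in>Pol2 A. (q (c, c), c) \<in> \<alpha> \<and> (q (c, b), b) \<in> \<alpha> \<and> (q (b, c), b) \<in> \<alpha>)"
proof -
  have \<alpha>: "congruence A \<alpha>" and \<beta>: "congruence A \<beta>" and sub: "\<alpha> \<subset> \<beta>"
    using pr unfolding prime_quotient_def by blast+
  note sy = cong_sym[OF \<alpha>] and tr = cong_trans[OF \<alpha>] and syb = cong_sym[OF \<beta>] and trb = cong_trans[OF \<beta>]
  have x01: "(x0, x1) \<in> \<beta>" "(x0, x1) \<notin> \<alpha>" and e: "e \<in> Pol1 A" and ee: "\<And>z. z \<in> univ A \<Longrightarrow> e (e z) = e z"
    and ex: "(e x0, x0) \<in> \<alpha>" "(e x1, x1) \<in> \<alpha>"
    and e2: "\<And>z. (x0, z) \<in> \<beta> \<Longrightarrow> (e z, x0) \<in> \<alpha> \<or> (e z, x1) \<in> \<alpha>"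
    and nosw: "\<And>p. p \<in> Pol1 A \<Longrightarrow> (p x0, x1) \<in> \<alpha> \<Longrightarrow> (p x1, x0) \<in> \<alpha> \<Longrightarrow> False"
    using lp unfolding lattice_pair_def by blast+
  obtain jn where jn: "jn \<in> Pol2 A" "(jn (x0, x0), x0) \<in> \<alpha>" "(jn (x0, x1), x1) \<in> \<alpha>" "(jn (x1, x0), x1) \<in> \<alpha>"
    using lp unfolding lattice_pair_def by blast
  have bA: "b \<in> univ A" "c \<in> univ A" using cong_univ[OF \<beta> cb(1)] by auto
  have WP: "(\<lambda>z. W (p z) b) \<in> Pol1 A" if "p \<in> Pol1 A" for p
    using Pol2_comp[OF W that gen_by.const[OF bA(1)]] by simp
  \<comment> \<open>Modulo \<alpha> this carries x0 to c and x1 to b; g below carries c and b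
    back.\<close>
  define k' where "k' z = W (k z) b" for z
  have k': "k' \<in> Pol1 A" unfolding k'_def by (rule WP[OF k(1)])
  have kx1: "(k' x1, b) \<in> \<alpha>" using k(2) by (simp add: k'_def)
  have kx0: "(k' x0, c) \<in> \<alpha>"
  proof -
    have "(k' x0, k' x1) \<in> \<beta>" by (rule cong_Pol1[OF \<beta> k' x01(1)])
    then have "(W (k x0) b, b) \<in> \<beta>" using kx1 sub trb unfolding k'_def by blast
    then show ?thesis using two k(3) Pol1_closed[OF A k(1)] cong_univ[OF \<beta> x01(1)] unfolding k'_def by blast
  qed
  have "\<exists>p\<in>Pol1 A. \<not> (p c \<in> {z. (e z, x1) \<in> \<alpha>} \<longleftrightarrow> p b \<in> {z. (e z, x1) \<in> \<alpha>})"
  proof (rule prime_separates[OF A pr cb])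
    show "(x1, x0) \<in> \<beta>" using x01 syb by blast
    show "x1 \<in> {z. (e z, x1) \<in> \<alpha>}" using ex by simp
    show "x0 \<notin> {z. (e z, x1) \<in> \<alpha>}" using ex x01(2) sy tr by blast
    show "y \<in> {z. (e z, x1) \<in> \<alpha>}" if "(x, y) \<in> \<alpha>" "x \<in> {z. (e z, x1) \<in> \<alpha>}" for x y
      using that cong_Pol1[OF \<alpha> e] sy tr by blast
  qed
  then obtain p where p: "p \<in> Pol1 A" "\<not> ((e (p c), x1) \<in> \<alpha> \<longleftrightarrow> (e (p b), x1) \<in> \<alpha>)" by auto
  define g where "g z = e (p z)" for z
  have g: "g \<in> Pol1 A" unfolding g_def using Pol1_comp[OF e p(1)] by simp
  have gcb: "(g c, g b) \<in> \<beta>" by (rule cong_Pol1[OF \<beta> g cb(1)])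
  have eg: "e (g z) = g z" if "z \<in> univ A" for z unfolding g_def by (rule ee[OF Pol1_closed[OF A p(1) that]])
  have gx: "(g z, x0) \<in> \<alpha> \<or> (g z, x1) \<in> \<alpha>" if z: "z \<in> {b, c}" for z
  proof -
    have "(g b, x1) \<in> \<beta> \<or> (g c, x1) \<in> \<beta>" using p(2) sub unfolding g_def by blast
    then have "(g z, x1) \<in> \<beta>" using z gcb syb trb by blast
    then have "(x0, g z) \<in> \<beta>" using x01(1) syb trb by blast
    then show ?thesis using e2 eg[of z] z bA by fastforce
  qed
  have gk: "(\<lambda>z. g (k' z)) \<in> Pol1 A" by (rule Pol1_comp[OF g k'])
  have gk0: "(g (k' x0), g c) \<in> \<alpha>" and gk1: "(g (k' x1), g b) \<in> \<alpha>"
    using cong_Pol1[OF \<alpha> g] kx0 kx1 by blast+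
  \<comment> \<open>With the other orientation, g after k' would exchange x0 and x1.\<close>
  have gcgb: "(g c, x0) \<in> \<alpha> \<and> (g b, x1) \<in> \<alpha>"
  proof (rule ccontr)
    assume "\<not> ?thesis"
    then have "(g c, x1) \<in> \<alpha> \<and> (g b, x0) \<in> \<alpha>"
      using gx[of c] gx[of b] p(2) unfolding g_def by blast
    then show False using nosw[OF gk] gk0 gk1 tr by blast
  qed
  show ?thesis
  proof (intro conjI ballI impI)
    fix r assume r: "r \<in> Pol1 A" "(W (r c) b, b) \<in> \<alpha>"
    show "(W (r b) b, b) \<in> \<alpha>"
    proof (rule ccontr)
      assume n: "(W (r b) b, b) \<notin> \<alpha>"
      \<comment> \<open>It exchanges c and b modulo \<alpha>; conjugated by k' and g it would
        exchange x0 and x1.\<close>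
      define r' where "r' z = W (r z) b" for z
      have r': "r' \<in> Pol1 A" unfolding r'_def by (rule WP[OF r(1)])
      have rc: "(r' c, b) \<in> \<alpha>" using r(2) by (simp add: r'_def)
      have "(r' b, r' c) \<in> \<beta>" using cong_Pol1[OF \<beta> r'] cb(1) syb by blast
      then have "(W (r b) b, b) \<in> \<beta>" using rc sub trb unfolding r'_def by blast
      then have rb: "(r' b, c) \<in> \<alpha>" using two n Pol1_closed[OF A r(1) bA(1)] unfolding r'_def by blast
      have gr: "(\<lambda>z. g (r' z)) \<in> Pol1 A" by (rule Pol1_comp[OF g r'])
      have P: "(\<lambda>z. g (r' (k' z))) \<in> Pol1 A" using Pol1_comp[OF gr k'] .
      have "(g (r' (k' x0)), g (r' c)) \<in> \<alpha>" "(g (r' (k' x1)), g (r' b)) \<in> \<alpha>"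
        using cong_Pol1[OF \<alpha> gr] kx0 kx1 by blast+
      moreover have "(g (r' c), g b) \<in> \<alpha>" "(g (r' b), g c) \<in> \<alpha>"
        using cong_Pol1[OF \<alpha> g] rc rb by blast+
      ultimately show False using nosw[OF P] gcgb tr by blast
    qed
  next
    \<comment> \<open>The join of the trace, transported to the pair (c, b).\<close>
    define q where "q v = k' (jn (g (fst v), g (snd v)))" for v
    have "(\<lambda>v. g (fst v)) \<in> Pol2 A" "(\<lambda>v. g (snd v)) \<in> Pol2 A"
      by (rule Pol1_comp[OF g], rule gen_by.gen, simp)+
    then have "(\<lambda>v. jn (g (fst v), g (snd v))) \<in> Pol2 A" by (rule Pol2_comp[OF jn(1)])
    then have q: "q \<in> Pol2 A" unfolding q_def by (rule Pol1_comp[OF k'])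
    have jg: "(jn (g u, g v), jn (y, y')) \<in> \<alpha>" if "(g u, y) \<in> \<alpha>" "(g v, y') \<in> \<alpha>" for u v y y'
      using cong_Pol2[OF \<alpha> jn(1) that] .
    have "(jn (g c, g c), x0) \<in> \<alpha>" "(jn (g c, g b), x1) \<in> \<alpha>" "(jn (g b, g c), x1) \<in> \<alpha>"
      using jg gcgb jn tr by blast+
    then have "(k' (jn (g c, g c)), k' x0) \<in> \<alpha>" "(k' (jn (g c, g b)), k' x1) \<in> \<alpha>" "(k' (jn (g b, g c)), k' x1) \<in> \<alpha>"
      using cong_Pol1[OF \<alpha> k'] by blast+
    then have "(q (c, c), c) \<in> \<alpha>" "(q (c, b), b) \<in> \<alpha>" "(q (b, c), b) \<in> \<alpha>"
      using kx0 kx1 tr unfolding q_def by auto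
    then show "\<exists>q\<in>Pol2 A. (q (c, c), c) \<in> \<alpha> \<and> (q (c, b), b) \<in> \<alpha> \<and> (q (b, c), b) \<in> \<alpha>" using q by blast
  qed
qed

text \<open>A polynomial separating the trace modulo truth may send either of its two classes to
  true. Since both orientations are lattice pairs, the suitable one can be used.\<close>

lemma lattice_pair_transfer:
  assumes A: "is_algebra A" and pr: "prime_quotient A \<alpha> \<beta>"
    and lp: "lattice_pair A \<alpha> \<beta> e x0 x1" "lattice_pair A \<alpha> \<beta> e x1 x0"
    and W: "(\<lambda>v. W (fst v) (snd v)) \<in> Pol2 A" and cb: "(c, b) \<in> \<beta>" "(c, b) \<notin> \<alpha>" and Wcb: "W c b = c" "W b b = b"
    and two: "\<And>v. v \<in> univ A \<Longrightarrow> (W v b, b) \<in> \<beta> \<Longrightarrow> (W v b, b) \<in> \<alpha> \<or> (W v b, c) \<in> \<alpha>"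
  shows "(\<forall>p\<in>Pol1 A. (W (p c) b, b) \<in> \<alpha> \<longrightarrow> (W (p b) b, b) \<in> \<alpha>) \<and>
    (\<exists>q\<in>Pol2 A. (q (c, c), c) \<in> \<alpha> \<and> (q (c, b), b) \<in> \<alpha> \<and> (q (b, c), b) \<in> \<alpha>)"
proof -
  have \<alpha>: "congruence A \<alpha>" and \<beta>: "congruence A \<beta>" and sub: "\<alpha> \<subset> \<beta>"
    using pr unfolding prime_quotient_def by blast+
  have bA: "b \<in> univ A" using cong_univ[OF \<beta> cb(1)] by auto
  have x01: "(x0, x1) \<in> \<beta>" "(x0, x1) \<notin> \<alpha>" using lp unfolding lattice_pair_def by blast+
  let ?X = "{z. (W z b, b) \<in> \<alpha>}"
  have "\<exists>k\<in>Pol1 A. \<not> (k x0 \<in> ?X \<longleftrightarrow> k x1 \<in> ?X)"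
  proof (rule prime_separates[OF A pr x01])
    show "(b, c) \<in> \<beta>" using cb cong_sym[OF \<beta>] by blast
    show "b \<in> ?X" using Wcb cong_refl[OF \<alpha> bA] by simp
    show "c \<notin> ?X" using Wcb cb by simp
    show "y \<in> ?X" if "(x, y) \<in> \<alpha>" "x \<in> ?X" for x y
    proof -
      have "(W y b, W x b) \<in> \<alpha>"
        using cong_Pol2[OF \<alpha> W cong_sym[OF \<alpha> that(1)] cong_refl[OF \<alpha> bA]] by simp
      then show ?thesis using that(2) cong_trans[OF \<alpha>] by blast
    qed
  qed
  then obtain k where k: "k \<in> Pol1 A" "\<not> ((W (k x0) b, b) \<in> \<alpha> \<longleftrightarrow> (W (k x1) b, b) \<in> \<alpha>)" by auto
  show ?thesis
  proof (cases "(W (k x1) b, b) \<in> \<alpha>")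
    case True
    then show ?thesis
      using lattice_pair_transfer_aux[OF A pr lp(1) W cb Wcb two k(1) True] k(2) by blast
  next
    case False
    then show ?thesis
      using lattice_pair_transfer_aux[OF A pr lp(2) W cb Wcb two k(1) _ False] k(2) by blast
  qed
qed

section \<open>Finite members of the variety\<close>

lemma finite_Bset: "finite (Bset T)"
proof -
  have UT: "(UNIV :: tsym set) = {S0, S1}" using tsym.exhaust by blast
  have ft: "finite (UNIV :: tsym set)" unfolding UT by simp
  let ?n = "num_states T"
  have "{v. state_of v \<le> ?n} \<subseteq> (\<lambda>(i, r, s). C i r s) ` ({..?n} \<times> UNIV \<times> UNIV) \<union>
      (\<lambda>(i, r, s). D i r s) ` ({..?n} \<times> UNIV \<times> UNIV) \<union> (\<lambda>(i, r). M i r) ` ({..?n} \<times> UNIV)"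
  proof
    fix v assume "v \<in> {v. state_of v \<le> ?n}"
    then show "v \<in> (\<lambda>(i, r, s). C i r s) ` ({..?n} \<times> UNIV \<times> UNIV) \<union>
      (\<lambda>(i, r, s). D i r s) ` ({..?n} \<times> UNIV \<times> UNIV) \<union> (\<lambda>(i, r). M i r) ` ({..?n} \<times> UNIV)"
      by (cases v) (auto simp: image_iff)
  qed
  moreover have "finite ((\<lambda>(i, r, s). C i r s) ` ({..?n} \<times> UNIV \<times> UNIV) \<union>
      (\<lambda>(i, r, s). D i r s) ` ({..?n} \<times> UNIV \<times> UNIV) \<union> (\<lambda>(i, r). M i r) ` ({..?n} \<times> UNIV))"
    using ft by (intro finite_UnI finite_imageI finite_cartesian_product) auto
  ultimately have "finite {v. state_of v \<le> ?n}" by (rule finite_subset)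
  then have "finite (Vel ` {v. state_of v \<le> ?n})" "finite (Bar ` {v. state_of v \<le> ?n})" by auto
  moreover have "Vset T = Vel ` {v. state_of v \<le> ?n}" "Vbarset T = Bar ` {v. state_of v \<le> ?n}"
    by (auto simp: Vset_def Vbarset_def)
  ultimately show ?thesis by (simp add: Bset_def Pset_def Uset_def)
qed

text \<open>A finite member is a quotient of a subalgebra of a \<^emph>\<open>finite\<close> power: identify the indices on
  which finitely many preimages of its elements agree.\<close>

lemma variety_finite_index:
  fixes A :: "('f, 'b) ualg" and B :: "('f, 'a) ualg"
  assumes A: "A \<in> variety TYPE('i) B" and fin: "finite (univ A)" and finB: "finite (univ B)"
  shows "\<exists>(I :: (('i \<Rightarrow> 'a) \<Rightarrow> 'a) set) S h. finite I \<and> subuniverse (power_alg B I) S \<and>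
    homomorphism (subalgebra (power_alg B I) S) A h \<and> h ` S = univ A"
proof -
  obtain I :: "'i set" and S h where S: "subuniverse (power_alg B I) S"
    and h: "homomorphism (subalgebra (power_alg B I) S) A h" "h ` S = univ A"
    using A unfolding variety_def by blast
  obtain F where F: "F \<subseteq> S" "finite F" "univ A = h ` F"
    using finite_subset_image[of "univ A" h S] fin h(2) by auto
  have S_sub: "S \<subseteq> I \<rightarrow>\<^sub>E univ B" and S_ne: "S \<noteq> {}"
    and S_op: "\<And>f xs. f \<in> syms B \<Longrightarrow> xs \<in> tuples (arity B f) S \<Longrightarrow>
      (\<lambda>i\<in>I. oper B f (map (\<lambda>x. x i) xs)) \<in> S"
    using S by (auto simp: subuniverse_def power_alg_def)
  have h_op: "h (\<lambda>i\<in>I. oper B f (map (\<lambda>x. x i) xs)) = oper A f (map h xs)"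
    if "f \<in> syms B" "xs \<in> tuples (arity B f) S" for f xs
    using h(1) that unfolding homomorphism_def by (simp add: subalgebra_def power_alg_def)
  \<comment> \<open>The finitely many preimages in F take one of finitely many patterns at an index;
    indices with equal patterns are identified.\<close>
  define \<phi> where "\<phi> i = (\<lambda>f\<in>F. f i)" for i
  define I' where "I' = \<phi> ` I"
  \<comment> \<open>Pulls a vector on patterns back to I; S' collects those whose pullback lies in
    S, so h after \<psi> is the new homomorphism.\<close>
  define \<psi> where "\<psi> G = (\<lambda>i\<in>I. G (\<phi> i))" for G :: "(('i \<Rightarrow> 'a) \<Rightarrow> 'a) \<Rightarrow> 'a"
  define S' where "S' = {G \<in> I' \<rightarrow>\<^sub>E univ B. \<psi> G \<in> S}"
  have "I' \<subseteq> F \<rightarrow>\<^sub>E univ B" using F(1) S_sub by (fastforce simp: I'_def \<phi>_def)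
  moreover have "finite (F \<rightarrow>\<^sub>E univ B)" by (rule finite_PiE) (use F finB in auto)
  ultimately have finI: "finite I'" by (rule finite_subset)
  have ev: "(\<lambda>j\<in>I'. j f) \<in> S' \<and> \<psi> (\<lambda>j\<in>I'. j f) = f" if f: "f \<in> F" for f
  proof -
    have fS: "f \<in> I \<rightarrow>\<^sub>E univ B" using F(1) S_sub f by blast
    have "\<psi> (\<lambda>j\<in>I'. j f) i = f i" for i
      using fS f by (cases "i \<in> I") (auto simp: \<psi>_def I'_def \<phi>_def)
    then have 1: "\<psi> (\<lambda>j\<in>I'. j f) = f" by (rule ext)
    moreover have "(\<lambda>j\<in>I'. j f) \<in> I' \<rightarrow>\<^sub>E univ B" using fS f by (auto simp: I'_def \<phi>_def)
    ultimately show ?thesis using f F(1) by (auto simp: S'_def)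
  qed
  have \<psi>_op: "\<psi> (\<lambda>j\<in>I'. oper B f (map (\<lambda>x. x j) Gs)) = (\<lambda>i\<in>I. oper B f (map (\<lambda>x. x i) (map \<psi> Gs)))" for f Gs
    by (auto simp: \<psi>_def I'_def comp_def fun_eq_iff)
  have \<psi>S: "map \<psi> Gs \<in> tuples n S" if "Gs \<in> tuples n S'" for Gs n
    using that by (auto simp: tuples_def S'_def)
  have op: "(\<lambda>j\<in>I'. oper B f (map (\<lambda>x. x j) Gs)) \<in> S'" if f: "f \<in> syms B" and Gs: "Gs \<in> tuples (arity B f) S'" for f Gs
  proof -
    have 1: "\<psi> (\<lambda>j\<in>I'. oper B f (map (\<lambda>x. x j) Gs)) \<in> S"
      unfolding \<psi>_op by (rule S_op[OF f \<psi>S[OF Gs]])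
    have "oper B f (map (\<lambda>x. x (\<phi> i)) Gs) \<in> univ B" if "i \<in> I" for i
    proof -
      have "\<psi> (\<lambda>j\<in>I'. oper B f (map (\<lambda>x. x j) Gs)) i \<in> univ B" using 1 S_sub that by blast
      then show ?thesis using that by (simp add: \<psi>_def I'_def)
    qed
    then have "(\<lambda>j\<in>I'. oper B f (map (\<lambda>x. x j) Gs)) \<in> I' \<rightarrow>\<^sub>E univ B" by (auto simp: I'_def)
    then show ?thesis using 1 by (simp add: S'_def)
  qed
  have "F \<noteq> {}" using S_ne h(2) F(3) by auto
  then have "S' \<noteq> {}" using ev by blast
  then have sub: "subuniverse (power_alg B I') S'"
    using op by (auto simp: subuniverse_def power_alg_def S'_def)
  have hom: "homomorphism (subalgebra (power_alg B I') S') A (\<lambda>G. h (\<psi> G))"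
    unfolding homomorphism_def
  proof (intro conjI ballI)
    have "h (\<psi> G) \<in> univ A" if "G \<in> S'" for G using that h(2) by (auto simp: S'_def)
    then show "(\<lambda>G. h (\<psi> G)) ` univ (subalgebra (power_alg B I') S') \<subseteq> univ A"
      by (auto simp: subalgebra_def)
    fix f Gs assume "f \<in> syms (subalgebra (power_alg B I') S')"
      "Gs \<in> tuples (arity (subalgebra (power_alg B I') S') f) (univ (subalgebra (power_alg B I') S'))"
    then have f: "f \<in> syms B" and Gs: "Gs \<in> tuples (arity B f) S'"
      by (auto simp: subalgebra_def power_alg_def)
    have "oper (subalgebra (power_alg B I') S') f Gs = (\<lambda>j\<in>I'. oper B f (map (\<lambda>x. x j) Gs))"
      by (simp add: subalgebra_def power_alg_def)
    then have "h (\<psi> (oper (subalgebra (power_alg B I') S') f Gs)) = oper A f (map h (map \<psi> Gs))"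
      by (simp only: \<psi>_op h_op[OF f \<psi>S[OF Gs]])
    then show "h (\<psi> (oper (subalgebra (power_alg B I') S') f Gs)) = oper A f (map (\<lambda>G. h (\<psi> G)) Gs)"
      by (simp add: comp_def)
  qed
  have "(\<lambda>G. h (\<psi> G)) ` S' = univ A"
  proof
    show "(\<lambda>G. h (\<psi> G)) ` S' \<subseteq> univ A" using h(2) by (auto simp: S'_def)
    show "univ A \<subseteq> (\<lambda>G. h (\<psi> G)) ` S'"
    proof
      fix y assume "y \<in> univ A"
      then obtain f where "f \<in> F" "y = h f" using F(3) by blast
      then show "y \<in> (\<lambda>G. h (\<psi> G)) ` S'" using ev by (metis imageI)
    qed
  qed
  then show ?thesis using finI sub hom by blast
qed

section \<open>Pulling the pair back to the subpower\<close>

lemma hom_gen_by: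
  assumes A: "is_algebra A" and h: "homomorphism A B h" and sig: "syms B = syms A" "\<forall>f\<in>syms A. arity B f = arity A f"
    and t: "t \<in> gen_by A G" and G: "\<And>g v. g \<in> G \<Longrightarrow> g v \<in> univ A \<and> (\<lambda>v. h (g v)) \<in> G'"
  shows "(\<lambda>v. h (t v)) \<in> gen_by B G'"
  using t
proof induction
  case (const c)
  then show ?case using h by (intro gen_by.const) (auto simp: homomorphism_def)
next
  case (gen g)
  then show ?case using G by (intro gen_by.gen) blast
next
  case (op f gs)
  have "h (oper A f (map (\<lambda>g. g v) gs)) = oper B f (map (\<lambda>k. k v) (map (\<lambda>g v. h (g v)) gs))" for v
  proof -
    have "g v \<in> univ A" if "g \<in> set gs" for g
      using gen_by_closed[OF _ A, of g G v] op(3) G that by blast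
    then have "map (\<lambda>g. g v) gs \<in> tuples (arity A f) (univ A)" using op(2) by (auto simp: tuples_def)
    then show ?thesis using h op(1) by (simp add: homomorphism_def comp_def)
  qed
  moreover have "(\<lambda>v. oper B f (map (\<lambda>k. k v) (map (\<lambda>g v. h (g v)) gs))) \<in> gen_by B G'"
    using op sig by (intro gen_by.op) auto
  ultimately show ?case by simp
qed

lemma Pol2_closed:
  assumes "is_algebra A" "q \<in> Pol2 A" "x \<in> univ A" "y \<in> univ A"
  shows "q (x, y) \<in> univ A"
  by (rule gen_by_closed[OF assms(2,1)]) (use assms(3,4) in auto)

lemma lift_Pol2:
  assumes A: "is_algebra A" and h: "homomorphism A B h" "h ` univ A = univ B"
    and sig: "syms B = syms A" "\<forall>f\<in>syms A. arity B f = arity A f" and q: "q \<in> Pol2 B"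
  shows "\<exists>q'\<in>Pol2 A. \<forall>x\<in>univ A. \<forall>y\<in>univ A. h (q' (x, y)) = q (h x, h y)"
  using q
proof induction
  case (const c)
  then obtain c' where "c' \<in> univ A" "c = h c'" using h(2) by blast
  then show ?case by (intro bexI[of _ "\<lambda>_. c'"] gen_by.const) auto
next
  case (gen g)
  then have "g = fst \<or> g = snd" by blast
  then show ?case
  proof
    assume "g = fst" then show ?thesis by (intro bexI[of _ fst] gen_by.gen) auto
  next
    assume "g = snd" then show ?thesis by (intro bexI[of _ snd] gen_by.gen) auto
  qed
next
  case (op f gs)
  have "\<forall>g\<in>set gs. \<exists>q'. q' \<in> Pol2 A \<and> (\<forall>x\<in>univ A. \<forall>y\<in>univ A. h (q' (x, y)) = g (h x, h y))"
    using op.IH by blast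
  from bchoice[OF this] obtain L where L: "\<And>g. g \<in> set gs \<Longrightarrow> L g \<in> Pol2 A"
    "\<And>g x y. g \<in> set gs \<Longrightarrow> x \<in> univ A \<Longrightarrow> y \<in> univ A \<Longrightarrow> h (L g (x, y)) = g (h x, h y)" by blast
  have f: "f \<in> syms A" "arity B f = arity A f" using op.hyps sig by auto
  show ?case
  proof (intro bexI ballI)
    show "(\<lambda>v. oper A f (map (\<lambda>g. g v) (map L gs))) \<in> Pol2 A"
      using f op.hyps L(1) by (intro gen_by.op) auto
    fix x y assume xy: "x \<in> univ A" "y \<in> univ A"
    have "L g (x, y) \<in> univ A" if "g \<in> set gs" for g
      by (rule Pol2_closed[OF A L(1)[OF that] xy])
    then have "map (\<lambda>g. L g (x, y)) gs \<in> tuples (arity A f) (univ A)" using op.hyps f by (auto simp: tuples_def)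
    then have "h (oper A f (map (\<lambda>g. L g (x, y)) gs)) = oper B f (map h (map (\<lambda>g. L g (x, y)) gs))"
      using h(1) f(1) unfolding homomorphism_def by blast
    then show "h (oper A f (map (\<lambda>g. g (x, y)) (map L gs))) = oper B f (map (\<lambda>g. g (h x, h y)) gs)"
      using L(2)[OF _ xy] by (simp add: comp_def cong: map_cong)
  qed
qed

text \<open>The choice of b is what makes truth modulo \<alpha> literal: by minimality, no element
  of S strictly below b lies above a pair that \<beta> relates and \<alpha> does not.\<close>

lemma type4_halts:
  fixes I :: "'i set" and B :: "(opsym, 'b) ualg"
  assumes finI: "finite I" and S: "subuniverse (power_alg (BT T) I) S"
    and hom: "homomorphism (subalgebra (power_alg (BT T) I) S) B h" and onto: "h ` S = univ B"
    and sig: "same_signature (BT T) B" and finB: "finite (univ B)"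
    and pr: "prime_quotient B \<alpha> \<beta>" and ty: "has_type B \<alpha> \<beta> Type4"
  shows "halts T"
proof -
  define A where "A = subalgebra (power_alg (BT T) I) S"
  have A_univ: "univ A = S" and A_syms: "syms A = ops T" and A_ar: "arity A = op_arity"
    and A_op: "\<And>f xs. oper A f xs = (\<lambda>i\<in>I. op_fun T f (map (\<lambda>x. x i) xs))"
    by (auto simp: A_def subalgebra_def power_alg_def BT_def)
  have S_op: "oper A f xs \<in> S" if "f \<in> ops T" "length xs = op_arity f" "set xs \<subseteq> S" for f xs
    using S that unfolding A_op by (auto simp: subuniverse_def power_alg_def BT_def tuples_def)
  have S_sub: "S \<subseteq> I \<rightarrow>\<^sub>E Bset T" and S_ne: "S \<noteq> {}"
    using S by (auto simp: subuniverse_def power_alg_def BT_def)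
  have alg: "is_algebra A"
    unfolding is_algebra_def A_univ A_syms A_ar using S_op S_ne by (auto simp: tuples_def)
  have hom: "homomorphism A B h" using hom by (simp add: A_def)
  have arT: "arity (BT T) = op_arity" by (simp add: BT_def)
  have sB: "syms B = syms A" and aB: "\<forall>f\<in>syms A. arity B f = arity A f"
    using sig unfolding same_signature_def A_syms A_ar arT by metis+
  have hS: "h x \<in> univ B" if "x \<in> S" for x using onto that by blast
  have h_op: "h (oper A f xs) = oper B f (map h xs)" if "f \<in> ops T" "length xs = op_arity f" "set xs \<subseteq> S" for f xs
    using hom that unfolding homomorphism_def A_syms A_ar A_univ by (auto simp: tuples_def)
  have algB: "is_algebra B"
    unfolding is_algebra_def
  proof (intro conjI ballI)
    show "univ B \<noteq> {}" using onto S_ne by auto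
    fix f ys assume f: "f \<in> syms B" and ys: "ys \<in> tuples (arity B f) (univ B)"
    then have "set ys \<subseteq> h ` S" using onto by (simp add: tuples_def)
    then have "\<forall>y\<in>set ys. \<exists>x. x \<in> S \<and> h x = y" by blast
    from bchoice[OF this] obtain g where g: "\<forall>y\<in>set ys. g y \<in> S \<and> h (g y) = y" ..
    have f': "f \<in> ops T" "arity B f = op_arity f" using f sB aB A_syms A_ar by auto
    have len: "length (map g ys) = op_arity f" using ys f' by (simp add: tuples_def)
    have gS: "set (map g ys) \<subseteq> S" using g by auto
    have "map h (map g ys) = ys" using g by (simp add: map_idI)
    then have "oper B f ys = h (oper A f (map g ys))" using h_op[OF f'(1) len gS] by simp
    then show "oper B f ys \<in> univ B" using hS S_op[OF f'(1) len gS] by simp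
  qed
  have \<alpha>: "congruence B \<alpha>" and \<beta>: "congruence B \<beta>" and sub: "\<alpha> \<subset> \<beta>"
    using pr unfolding prime_quotient_def by blast+
  note sy = cong_sym[OF \<alpha>] and tra = cong_trans[OF \<alpha>] and syb = cong_sym[OF \<beta>] and trb = cong_trans[OF \<beta>]
  obtain e x0 x1 where lp: "lattice_pair B \<alpha> \<beta> e x0 x1" "lattice_pair B \<alpha> \<beta> e x1 x0"
    using type4_lattice_pair[OF algB finB pr ty] by blast
  have x01: "(x0, x1) \<in> \<beta>" "(x0, x1) \<notin> \<alpha>" using lp unfolding lattice_pair_def by blast+
  define m where "m x y = (\<lambda>i\<in>I. wedge (x i) (y i))" for x y :: "'i \<Rightarrow> elt"
  define W where "W u v = oper B WedgeOp [u, v]" for u v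
  have m_op: "m x y = oper A WedgeOp [x, y]" for x y by (simp add: m_def A_op)
  have mS: "m x y \<in> S" if "x \<in> S" "y \<in> S" for x y unfolding m_op using that by (intro S_op) auto
  have hm: "h (m x y) = W (h x) (h y)" if "x \<in> S" "y \<in> S" for x y
    unfolding m_op W_def using that h_op[of WedgeOp "[x, y]"] by simp
  have W: "(\<lambda>v. W (fst v) (snd v)) \<in> Pol2 B"
  proof -
    have "WedgeOp \<in> syms B" "arity B WedgeOp = 2" using sB aB by (auto simp: A_syms A_ar)
    then have "(\<lambda>v. oper B WedgeOp (map (\<lambda>g. g v) [fst, snd])) \<in> Pol2 B"
      by (intro gen_by.op) (auto intro: gen_by.gen)
    then show ?thesis by (simp add: W_def)
  qed
  have W_cong: "(W u v, W u' v') \<in> \<theta>" if "congruence B \<theta>" "(u, u') \<in> \<theta>" "(v, v') \<in> \<theta>" for u v u' v' \<theta>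
    using cong_Pol2[OF that(1) W that(2,3)] by simp
  have m_comm: "m x y = m y x" for x y unfolding m_def by (simp add: wedge_commute cong: restrict_cong)
  have m_idem: "m x x = x" if "x \<in> S" for x
    using that S_sub by (auto simp: m_def fun_eq_iff PiE_def extensional_def)
  define le where "le x y \<longleftrightarrow> (\<forall>i\<in>I. ble (x i) (y i))" for x y :: "'i \<Rightarrow> elt"
  have le_m: "le x y \<longleftrightarrow> m x y = x" if "x \<in> S" for x y
  proof
    assume l: "le x y"
    show "m x y = x"
    proof
      fix i show "m x y i = x i"
        using l that S_sub by (cases "i \<in> I") (auto simp: m_def le_def ble_iff_wedge PiE_def extensional_def)
    qed
  next
    assume eq: "m x y = x"
    have "wedge (x i) (y i) = x i" if "i \<in> I" for i
      using fun_cong[OF eq, of i] that by (simp add: m_def)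
    then show "le x y" by (simp add: le_def ble_iff_wedge)
  qed
  have m_le: "le (m x y) x" "le (m x y) y" for x y
    unfolding le_def m_def using wedge_le by auto
  have le_trans: "le x y \<Longrightarrow> le y z \<Longrightarrow> le x z" for x y z
    unfolding le_def using ble_trans by blast
  \<comment> \<open>The weights increase strictly along the order of the algebra, so the rank is a
    strict measure for the order on S.\<close>
  define rk where "rk x = (\<Sum>i\<in>I. if x i = Zero then 0 else if x i = P2 then 1 else 2 :: nat)" for x :: "'i \<Rightarrow> elt"
  have rk: "rk x < rk y" if "le x y" "x \<noteq> y" "x \<in> S" "y \<in> S" for x y
  proof -
    have "\<exists>i\<in>I. x i \<noteq> y i"
    proof (rule ccontr)
      assume "\<not> ?thesis"
      then have "x = y" using that(3,4) S_sub by (intro PiE_ext[of x I "\<lambda>_. Bset T" y]) auto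
      then show False using that(2) by simp
    qed
    then obtain i where i: "i \<in> I" "x i \<noteq> y i" by blast
    have l: "ble (x j) (y j)" if "j \<in> I" for j using \<open>le x y\<close> that by (simp add: le_def)
    show ?thesis
      unfolding rk_def
    proof (rule sum_strict_mono_ex1[OF finI])
      show "\<forall>j\<in>I. (if x j = Zero then 0 else if x j = P2 then 1 else 2 :: nat)
          \<le> (if y j = Zero then 0 else if y j = P2 then 1 else 2)"
      proof
        fix j assume "j \<in> I"
        from l[OF this] show "(if x j = Zero then 0 else if x j = P2 then 1 else 2 :: nat)
            \<le> (if y j = Zero then 0 else if y j = P2 then 1 else 2)" by (auto simp: ble_def)
      qed
      show "\<exists>j\<in>I. (if x j = Zero then 0 else if x j = P2 then 1 else 2 :: nat)
          < (if y j = Zero then 0 else if y j = P2 then 1 else 2)"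
        using l[OF i(1)] i by (intro bexI[of _ i]) (auto simp: ble_def)
    qed
  qed
  define E where "E x \<longleftrightarrow> x \<in> S \<and> (\<exists>c\<in>S. le c x \<and> (h c, h x) \<in> \<beta> \<and> (h c, h x) \<notin> \<alpha>)" for x
  \<comment> \<open>The meet of preimages of x0 and x1 is \<beta>-related to both, and it cannot be
    \<alpha>-related to both.\<close>
  have "\<exists>x. E x"
  proof -
    obtain a0 a1 where a: "a0 \<in> S" "h a0 = x0" "a1 \<in> S" "h a1 = x1"
      using x01(1) cong_univ[OF \<beta>] onto by (metis imageE)
    have W0: "W x0 x0 = x0" "W x1 x1 = x1" using hm a m_idem by metis+
    have r: "(x0, x0) \<in> \<beta>" "(x1, x1) \<in> \<beta>" using x01(1) cong_refl[OF \<beta>] cong_univ[OF \<beta>] by blast+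
    have b0: "(h (m a0 a1), x0) \<in> \<beta>"
      using W_cong[OF \<beta> r(1) syb[OF x01(1)]] W0 hm[OF a(1,3)] a by simp
    have b1: "(h (m a0 a1), x1) \<in> \<beta>"
      using W_cong[OF \<beta> x01(1) r(2)] W0 hm[OF a(1,3)] a by simp
    have "(h (m a0 a1), x0) \<notin> \<alpha> \<or> (h (m a0 a1), x1) \<notin> \<alpha>" using x01(2) sy tra by blast
    then show ?thesis using b0 b1 m_le[of a0 a1] mS[OF a(1,3)] a unfolding E_def by blast
  qed
  then obtain b where Eb: "E b" and bmin: "\<And>x. E x \<Longrightarrow> rk b \<le> rk x"
    using ex_has_least_nat[of E _ rk] by blast
  have bS: "b \<in> S" using Eb by (simp add: E_def)
  have notE: "\<not> E x" if "x \<in> S" "le x b" "x \<noteq> b" for x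
    using rk[OF that(2,3,1) bS] bmin[of x] by auto
  define F where "F = {c \<in> S. le c b \<and> c \<noteq> b \<and> (h c, h b) \<in> \<beta>}"
  \<comment> \<open>If v were \<alpha>-related to b, the meet of v with a witness below b would be
    \<alpha>-related to that witness, and v would satisfy E.\<close>
  have F_not\<alpha>: "(h v, h b) \<notin> \<alpha>" if v: "v \<in> F" for v
  proof
    assume v\<alpha>: "(h v, h b) \<in> \<alpha>"
    obtain c0 where c0: "c0 \<in> S" "le c0 b" "(h c0, h b) \<in> \<beta>" "(h c0, h b) \<notin> \<alpha>" using Eb by (auto simp: E_def)
    have vS: "v \<in> S" "le v b" "v \<noteq> b" using v by (auto simp: F_def)
    have "(h (m v c0), h c0) \<in> \<alpha>"
    proof -
      have "(W (h v) (h c0), W (h b) (h c0)) \<in> \<alpha>"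
        by (rule W_cong[OF \<alpha> v\<alpha> cong_refl[OF \<alpha> hS[OF c0(1)]]])
      moreover have "W (h b) (h c0) = h c0"
        using hm[OF bS c0(1)] m_comm le_m[OF c0(1)] c0(2) by metis
      ultimately show ?thesis using hm[OF vS(1) c0(1)] by simp
    qed
    moreover have "(h c0, h v) \<in> \<beta>" "(h c0, h v) \<notin> \<alpha>" using c0 v\<alpha> sub syb trb sy tra by blast+
    ultimately have "(h (m v c0), h v) \<in> \<beta>" "(h (m v c0), h v) \<notin> \<alpha>" using sub trb sy tra by blast+
    then have "E v" using vS(1) mS[OF vS(1) c0(1)] m_le(1) unfolding E_def by blast
    then show False using notE vS by blast
  qed
  \<comment> \<open>By minimality of b, the meet of two members of F is \<alpha>-related to each of
    them.\<close>
  have F_eq: "(h v, h v') \<in> \<alpha>" if v: "v \<in> F" and v': "v' \<in> F" for v v'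
  proof -
    have below: "(h (m v v'), h v) \<in> \<alpha>" if v: "v \<in> F" and v': "v' \<in> F" for v v'
    proof (rule ccontr)
      assume n: "(h (m v v'), h v) \<notin> \<alpha>"
      have vS: "v \<in> S" "le v b" "v \<noteq> b" "(h v, h b) \<in> \<beta>" and vS': "v' \<in> S" "(h v', h b) \<in> \<beta>"
        using v v' by (auto simp: F_def)
      have "(h v', h v) \<in> \<beta>" using vS(4) vS'(2) syb trb by blast
      then have "(W (h v) (h v'), W (h v) (h v)) \<in> \<beta>"
        by (rule W_cong[OF \<beta> cong_refl[OF \<beta> hS[OF vS(1)]]])
      then have "(h (m v v'), h v) \<in> \<beta>" using hm vS(1) vS'(1) m_idem[OF vS(1)] by metis
      then have "E v" using n vS(1) mS[OF vS(1) vS'(1)] m_le(1) unfolding E_def by blast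
      then show False using notE vS by blast
    qed
    show ?thesis using below[OF v v'] below[OF v' v] m_comm sy tra by metis
  qed
  define X where "X = {z. (W z (h b), h b) \<in> \<alpha>}"
  have Wbb: "W (h b) (h b) = h b" using hm[OF bS bS] m_idem[OF bS] by simp
  \<comment> \<open>Here the order on S and truth in the quotient coincide: a meet with b that is
    \<alpha>-related to b but different from it would lie in F.\<close>
  have X_tr: "le b v \<longleftrightarrow> h v \<in> X" if v: "v \<in> S" for v
  proof
    assume "le b v"
    then have "m b v = b" using le_m[OF bS] by blast
    then have "W (h v) (h b) = h b" using hm[OF v bS] m_comm by metis
    then show "h v \<in> X" using cong_refl[OF \<alpha> hS[OF bS]] by (simp add: X_def)
  next
    assume "h v \<in> X"
    then have \<alpha>v: "(h (m v b), h b) \<in> \<alpha>" using hm[OF v bS] by (simp add: X_def)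
    have "m v b = b"
    proof (rule ccontr)
      assume "m v b \<noteq> b"
      then have "m v b \<in> F" using mS[OF v bS] m_le(2) \<alpha>v sub by (auto simp: F_def)
      then show False using F_not\<alpha> \<alpha>v by blast
    qed
    then have "m b v = b" using m_comm by simp
    then show "le b v" using le_m[OF bS] by blast
  qed
  have X_sat: "u \<in> X \<longleftrightarrow> v \<in> X" if "(u, v) \<in> \<alpha>" for u v
  proof -
    have "(W u (h b), W v (h b)) \<in> \<alpha>" by (rule W_cong[OF \<alpha> that cong_refl[OF \<alpha> hS[OF bS]]])
    then show ?thesis unfolding X_def using sy tra by blast
  qed
  have tf: "(\<forall>p\<in>Pol1 B. (W (p (h c)) (h b), h b) \<in> \<alpha> \<longrightarrow> (W (p (h b)) (h b), h b) \<in> \<alpha>) \<and>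
    (\<exists>q\<in>Pol2 B. (q (h c, h c), h c) \<in> \<alpha> \<and> (q (h c, h b), h b) \<in> \<alpha> \<and> (q (h b, h c), h b) \<in> \<alpha>)"
    if c: "c \<in> F" for c
  proof (rule lattice_pair_transfer[OF algB pr lp W])
    show "(h c, h b) \<in> \<beta>" "(h c, h b) \<notin> \<alpha>" using c F_not\<alpha> by (auto simp: F_def)
    show "W (h c) (h b) = h c" using hm[of c b] le_m[of c b] c bS by (auto simp: F_def)
    show "W (h b) (h b) = h b" by (rule Wbb)
    fix v assume "v \<in> univ B" and v\<beta>: "(W v (h b), h b) \<in> \<beta>"
    then obtain v' where v': "v' \<in> S" "v = h v'" using onto by blast
    have hv: "h (m v' b) = W v (h b)" using hm[OF v'(1) bS] v'(2) by simp
    show "(W v (h b), h b) \<in> \<alpha> \<or> (W v (h b), h c) \<in> \<alpha>"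
    proof (cases "m v' b = b")
      case True
      then show ?thesis using hv cong_refl[OF \<alpha> hS[OF bS]] by simp
    next
      case False
      then have "m v' b \<in> F" using mS[OF v'(1) bS] m_le(2) v\<beta> hv by (simp add: F_def)
      then show ?thesis using F_eq[OF _ c] hv by metis
    qed
  qed
  have hgen: "\<exists>p\<in>Pol1 B. \<forall>v. h (t v) = p (if v then h y else h x)"
    if t: "t \<in> gen_by A {\<lambda>v. if v then y else x}" and xy: "x \<in> S" "y \<in> S" for t x y
  proof -
    have "(\<lambda>v. h (t v)) \<in> gen_by B {\<lambda>v. if v then h y else h x}"
      by (rule hom_gen_by[OF alg hom sB aB t]) (use xy A_univ in auto)
    from gen_by_single[OF this] show ?thesis .
  qed
  have tS: "t v \<in> S" if t: "t \<in> gen_by A {\<lambda>v. if v then y else x}" and xy: "x \<in> S" "y \<in> S" for t x y v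
  proof -
    have "t v \<in> univ A" by (rule gen_by_closed[OF t alg]) (use xy A_univ in auto)
    then show ?thesis using A_univ by simp
  qed
  interpret core T I S b F
  proof (unfold_locales, fold A_def le_def m_def)
    show "F \<noteq> {}"
    proof -
      obtain c where "c \<in> S" "le c b" "(h c, h b) \<in> \<beta>" "(h c, h b) \<notin> \<alpha>" using Eb by (auto simp: E_def)
      moreover have "c \<noteq> b" using calculation cong_refl[OF \<alpha> hS[OF bS]] by auto
      ultimately show ?thesis by (auto simp: F_def)
    qed
    show "F \<subseteq> S" by (auto simp: F_def)
    show "ble (c i) (b i)" if "c \<in> F" "i \<in> I" for c i using that by (auto simp: F_def le_def)
    show "\<exists>i\<in>I. \<not> ble (b i) (c i)" if c: "c \<in> F" for c
    proof -
      have "\<not> le b c"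
      proof
        assume "le b c"
        then have "m b c = b" using le_m[OF bS] by blast
        moreover have "m c b = c" using le_m[of c b] c by (auto simp: F_def)
        ultimately show False using m_comm[of b c] c by (auto simp: F_def)
      qed
      then show ?thesis by (simp add: le_def)
    qed
    show "le b (t True)" if c: "c \<in> F" and t: "t \<in> gen_by A {\<lambda>v. if v then b else c}" and l: "le b (t False)" for c t
    proof -
      have cS: "c \<in> S" using c by (simp add: F_def)
      obtain p where p: "p \<in> Pol1 B" "\<forall>v. h (t v) = p (if v then h b else h c)" using hgen[OF t cS bS] by blast
      have "p (h c) \<in> X" using l X_tr[OF tS[OF t cS bS]] p(2) by metis
      then have "p (h b) \<in> X" using tf[OF c] p(1) unfolding X_def by blast
      then show ?thesis using X_tr[OF tS[OF t cS bS]] p(2) by metis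
    qed
    show "m (t False) b \<in> F"
      if c: "c \<in> F" and t: "t \<in> gen_by A {\<lambda>v. if v then b else c}" and l: "le b (t True)" and nl: "\<not> le b (t False)" for c t
    proof -
      have cS: "c \<in> S" and cb: "(h c, h b) \<in> \<beta>" using c by (auto simp: F_def)
      obtain p where p: "p \<in> Pol1 B" "\<forall>v. h (t v) = p (if v then h b else h c)" using hgen[OF t cS bS] by blast
      have S1: "t v \<in> S" for v by (rule tS[OF t cS bS])
      have "(h (t False), h (t True)) \<in> \<beta>" using cong_Pol1[OF \<beta> p(1) cb] p(2) by simp
      then have "(W (h (t False)) (h b), W (h (t True)) (h b)) \<in> \<beta>"
        by (rule W_cong[OF \<beta> _ cong_refl[OF \<beta> hS[OF bS]]])
      moreover have "m (t True) b = b" using l le_m[OF bS] m_comm by metis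
      ultimately have "(h (m (t False) b), h b) \<in> \<beta>" using hm[OF S1 bS] by metis
      moreover have "m (t False) b \<noteq> b" using nl le_m[OF bS] m_comm by metis
      ultimately show ?thesis using mS[OF S1 bS] m_le(2) by (simp add: F_def)
    qed
    show "le b (u c) = le b (u c')" if c: "c \<in> F" "c' \<in> F" and u: "u \<in> gen_by A {\<lambda>x. x}" for c c' u
    proof -
      have cS: "c \<in> S" "c' \<in> S" using c by (auto simp: F_def)
      define t where "t v = u (if v then c' else c)" for v
      have t: "t \<in> gen_by A {\<lambda>v. if v then c' else c}"
        unfolding t_def by (rule Pol1_comp[OF u]) (rule gen_by.gen, simp)
      obtain p where p: "p \<in> Pol1 B" "\<forall>v. h (t v) = p (if v then h c' else h c)" using hgen[OF t cS] by blast
      have "(h (t False), h (t True)) \<in> \<alpha>" using cong_Pol1[OF \<alpha> p(1) F_eq[OF c]] p(2) by simp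
      then have "h (t False) \<in> X \<longleftrightarrow> h (t True) \<in> X" by (rule X_sat)
      then have "le b (t False) \<longleftrightarrow> le b (t True)" using X_tr[OF tS[OF t cS]] by simp
      then show ?thesis by (simp add: t_def)
    qed
    show "\<exists>q\<in>gen_by A {\<lambda>(x, y). if x then b else c, \<lambda>(x, y). if y then b else c}.
        q (False, False) \<in> F \<and> q (False, True) = b \<and> q (True, False) = b" if c: "c \<in> F" for c
    proof -
      have cS: "c \<in> S" and cb: "le c b" using c by (auto simp: F_def)
      obtain q where q: "q \<in> Pol2 B" "(q (h c, h c), h c) \<in> \<alpha>" "(q (h c, h b), h b) \<in> \<alpha>" "(q (h b, h c), h b) \<in> \<alpha>"
        using tf[OF c] by blast
      obtain q' where q': "q' \<in> Pol2 A" "\<And>x y. x \<in> S \<Longrightarrow> y \<in> S \<Longrightarrow> h (q' (x, y)) = q (h x, h y)"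
        using lift_Pol2[OF alg hom _ sB aB q(1)] onto unfolding A_univ by blast
      have qS: "q' (x, y) \<in> S" if "x \<in> S" "y \<in> S" for x y
        using Pol2_closed[OF alg q'(1)] that A_univ by simp
      let ?G = "{\<lambda>(x, y). if x then b else c, \<lambda>(x, y). if y then b else c}"
      \<comment> \<open>The lifted join is correct only modulo \<alpha>; meeting it with b makes its
        true values equal to b and places its false value in F.\<close>
      let ?q1 = "\<lambda>v. q' (if fst v then b else c, if snd v then b else c)"
      let ?q = "\<lambda>v. m (?q1 v) b"
      have g: "(\<lambda>v. if fst v then b else c) \<in> gen_by A ?G" "(\<lambda>v. if snd v then b else c) \<in> gen_by A ?G"
        by (rule gen_by.gen, simp add: case_prod_unfold)+
      have "?q1 \<in> gen_by A ?G" by (rule Pol2_comp[OF q'(1) g])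
      moreover have "(\<lambda>_. b) \<in> gen_by A ?G" by (rule gen_by.const) (simp add: A_univ bS)
      ultimately have "(\<lambda>v. oper A WedgeOp (map (\<lambda>g. g v) [?q1, \<lambda>_. b])) \<in> gen_by A ?G"
        by (intro gen_by.op) (auto simp: A_syms A_ar)
      then have qG: "?q \<in> gen_by A ?G" by (simp add: m_op)
      have val: "m (q' (x, y)) b = b" if xy: "x \<in> S" "y \<in> S" "(q (h x, h y), h b) \<in> \<alpha>" for x y
      proof -
        have "h (q' (x, y)) \<in> X"
          using X_sat[OF xy(3)] q'(2)[OF xy(1,2)] Wbb cong_refl[OF \<alpha> hS[OF bS]] by (simp add: X_def)
        then have "le b (q' (x, y))" using X_tr[OF qS[OF xy(1,2)]] by blast
        then show ?thesis using le_m[OF bS] m_comm by metis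
      qed
      have "(h (q' (c, c)), h c) \<in> \<alpha>" using q(2) q'(2)[OF cS cS] by simp
      then have "(W (h (q' (c, c))) (h b), W (h c) (h b)) \<in> \<alpha>"
        by (rule W_cong[OF \<alpha> _ cong_refl[OF \<alpha> hS[OF bS]]])
      moreover have "W (h c) (h b) = h c" using hm[OF cS bS] le_m[OF cS] cb by simp
      ultimately have 1: "(h (m (q' (c, c)) b), h c) \<in> \<alpha>" using hm[OF qS[OF cS cS] bS] by simp
      have "m (q' (c, c)) b \<noteq> b" using 1 F_not\<alpha>[OF c] sy by metis
      moreover have "(h (m (q' (c, c)) b), h b) \<in> \<beta>" using 1 c sub trb by (auto simp: F_def)
      ultimately have "m (q' (c, c)) b \<in> F" using mS[OF qS[OF cS cS] bS] m_le(2) by (simp add: F_def)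
      then show ?thesis using qG val[OF cS bS q(3)] val[OF bS cS q(4)] by (intro bexI[of _ ?q]) auto
    qed
  qed (use finI S bS in auto)
  show ?thesis by (rule halts)
qed

theorem theorem5p1:
  fixes T :: turing
  assumes "turing_machine T"
    and "\<not> halts T"
  shows "Type4 \<notin> typ_class (variety TYPE('i) (BT T) :: (opsym, 'b) ualg set)"
proof
  assume "Type4 \<in> typ_class (variety TYPE('i) (BT T) :: (opsym, 'b) ualg set)"
  then obtain B :: "(opsym, 'b) ualg" and \<alpha> \<beta> where B: "B \<in> variety TYPE('i) (BT T)" "finite (univ B)"
    and ty: "prime_quotient B \<alpha> \<beta>" "has_type B \<alpha> \<beta> Type4"
    unfolding typ_class_def by blast
  have "finite (univ (BT T))" using finite_Bset by (simp add: BT_def)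
  from variety_finite_index[OF B this]
  obtain I :: "(('i \<Rightarrow> elt) \<Rightarrow> elt) set" and S h where I: "finite I" "subuniverse (power_alg (BT T) I) S"
    "homomorphism (subalgebra (power_alg (BT T) I) S) B h" "h ` S = univ B" by (elim exE conjE)
  have "same_signature (BT T) B" using B(1) by (simp add: variety_def)
  then have "halts T" by (rule type4_halts[OF I _ B(2) ty])
  then show False using assms(2) by blast
qed

end
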